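(* Let $X\sim\mathrm{IP}(\mu;\delta,\beta,\gamma)$ with $\delta\le 0$, let $n$ be a positive integer and let $g\in\mathcal{H}^{n,n}(X)$. For non-negative integers $m$ let \[ S_{m,1}(g)=\sum_{i=1}^{m}\frac{\binom{m}{i}(1-(m+i)\delta)\,\mathbb{E}^2\big[q^i(X)g^{(i)}(X)\big]}{(m+1)_i\,\mathbb{E}[q^i(X)]\Big(\prod_{j=i-1}^{2i-2}(1-j\delta)\Big)(1-m\delta)}+\frac{\mathbb{E}\big[q(X)(g'(X))^2\big]}{(m+1)(1-m\delta)}, \] and define \[ S_{n,\mathrm{(str)}}=\sum_{i=1}^{n}\frac{\mathbb{E}^2[q^i(X)g^{(i)}(X)]}{i!\,\mathbb{E}[q^i(X)]\prod_{j=i-1}^{2i-2}(1-j\delta)} +\frac{\mathbb{E}\big[q^n(X)(g^{(n)}(X))^2\big]-\frac{\mathbb{E}^2[q^n(X)g^{(n)}(X)]}{\mathbb{E}[q^n(X)]}}{(n+1)!\prod_{j=n}^{2n-1}(1-j\delta)}, \] \[ S_{n,\mathrm{(weak)}}=\sum_{i=1}^{n-1}\frac{\mathbb{E}^2[q^i(X)g^{(i)}(X)]}{i!\,\mathbb{E}[q^i(X)]\prod_{j=i-1}^{2i-2}(1-j\delta)} +\frac{\mathbb{E}\big[q^n(X)(g^{(n)}(X))^2\big]}{n!\prod_{j=n-1}^{2n-2}(1-j\delta)}. \] Then: (a) $S_{n,1}(g)\le S_{n,\mathrm{(str)}}$, where equality holds when $n=1$, or when $n>1$ and $g$ is a polynomial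 of degree at most $n+1$; (b) $S_{n-1,1}(g)\le S_{n,\mathrm{(weak)}}$, where equality holds when $n=1$, or when $n>1$ and $g$ is a polynomial of degree at most $n$.
   Context: A random variable $X$ with density $f$ and finite mean $\mu=\mathbb{E}X$ belongs to the integrated Pearson family, written $X\sim\mathrm{IP}(\mu;\delta,\beta,\gamma)$, if there is a quadratic polynomial $q(x)=\delta x^2+\beta x+\gamma$ (with $|\delta|+|\beta|+|\gamma|>0$) such that $\int_{-\infty}^{x}(\mu-t)f(t)\,dt=q(x)f(x)$ for all $x\in\mathbb{R}$. Let $J(X)=(\alpha,\omega)$ denote the support of $X$. For $x\in\mathbb{R}$ and $k\in\mathbb{N}$, $(x)_k=x(x-1)\cdots(x-k+1)$ with $(x)_0=1$. For a positive integer $n$ with $\mathbb{E}|X|^{2n}<\infty$, $\mathcal{H}^{n,n}(X)$ is the class of Borel functions $g:(\alpha,\omega)\to\mathbb{R}$ such that $g\in C^{n-1}(\alpha,\omega)$, $g^{(n-1)}$ is absolutely continuous on $(\alpha,\omega)$ with a.s. derivative $g^{(n)}$, and $\mathbb{E}[q^n(X)(g^{(n)}(X))^2]<\infty$. Empty sums equal $0$, empty products equal $1$, and $\mathbb{E}^2[Y]$ means $(\mathbb{E}Y)^2$. *)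

theory Defs
  imports "HOL-Analysis.Analysis" "HOL-Computational_Algebra.Polynomial"
begin

text \<open>A real random variable X is represented by its (Lebesgue) density f;
  E[h(X)] is the Lebesgue integral of h times f.\<close>

definition is_density :: "(real \<Rightarrow> real) \<Rightarrow> bool" where
  "is_density f \<longleftrightarrow> f \<in> borel_measurable borel \<and> (\<forall>x. 0 \<le> f x)
     \<and> integrable lborel f \<and> (LINT x|lborel. f x) = 1"

definition qpoly :: "real \<Rightarrow> real \<Rightarrow> real \<Rightarrow> real \<Rightarrow> real" where
  "qpoly \<delta> \<beta> \<gamma> x = \<delta> * x\<^sup>2 + \<beta> * x + \<gamma>"

definition IP :: "(real \<Rightarrow> real) \<Rightarrow> real \<Rightarrow> real \<Rightarrow> real \<Rightarrow> real \<Rightarrow> bool" where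
  "IP f \<mu> \<delta> \<beta> \<gamma> \<longleftrightarrow> is_density f \<and> integrable lborel (\<lambda>t. t * f t)
     \<and> \<mu> = (LINT t|lborel. t * f t)
     \<and> \<bar>\<delta>\<bar> + \<bar>\<beta>\<bar> + \<bar>\<gamma>\<bar> > 0
     \<and> (\<forall>x. (LINT t:{..x}|lborel. (\<mu> - t) * f t) = qpoly \<delta> \<beta> \<gamma> x * f x)"

definition supp_lo :: "(real \<Rightarrow> real) \<Rightarrow> ereal" where
  "supp_lo f = Sup {ereal a | a. AE x in lborel. 0 < f x \<longrightarrow> a \<le> x}"

definition supp_hi :: "(real \<Rightarrow> real) \<Rightarrow> ereal" where
  "supp_hi f = Inf {ereal b | b. AE x in lborel. 0 < f x \<longrightarrow> x \<le> b}"

definition supp :: "(real \<Rightarrow> real) \<Rightarrow> real set" where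
  "supp f = {x. supp_lo f < ereal x \<and> ereal x < supp_hi f}"

definition Exp :: "(real \<Rightarrow> real) \<Rightarrow> (real \<Rightarrow> real) \<Rightarrow> real" where
  "Exp f h = (LINT x:supp f|lborel. h x * f x)"

definition falling :: "real \<Rightarrow> nat \<Rightarrow> real" where
  "falling x k = (\<Prod>j<k. x - real j)"

definition abs_cont_on_interval :: "(real \<Rightarrow> real) \<Rightarrow> real \<Rightarrow> real \<Rightarrow> bool" where
  "abs_cont_on_interval h a b \<longleftrightarrow>
     (\<forall>\<epsilon>>0. \<exists>d>0. \<forall>(N::nat) (u::nat \<Rightarrow> real) v.
        (\<forall>k<N. a \<le> u k \<and> u k \<le> v k \<and> v k \<le> b)
        \<and> (\<forall>k<N. \<forall>l<N. k \<noteq> l \<longrightarrow> v k \<le> u l \<or> v l \<le> u k)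
        \<and> (\<Sum>k<N. v k - u k) < d
        \<longrightarrow> (\<Sum>k<N. \<bar>h (v k) - h (u k)\<bar>) < \<epsilon>)"

definition loc_abs_cont_on :: "real set \<Rightarrow> (real \<Rightarrow> real) \<Rightarrow> bool" where
  "loc_abs_cont_on J h \<longleftrightarrow>
     (\<forall>a b. a \<in> J \<longrightarrow> b \<in> J \<longrightarrow> a \<le> b \<longrightarrow> abs_cont_on_interval h a b)"

text \<open>Class H^{n,n}(X): g with derivatives G 0 = g, G 1, ..., G (n-1) (classical,
  on J), G (n-1) absolutely continuous on J with a.e. derivative G n, and
  E[q^n(X) (g^{(n)}(X))^2] finite.  Here G i plays the role of g^{(i)}.\<close>
definition in_Hnn :: "(real \<Rightarrow> real) \<Rightarrow> (real \<Rightarrow> real) \<Rightarrow> nat \<Rightarrow> (real \<Rightarrow> real)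
     \<Rightarrow> (nat \<Rightarrow> real \<Rightarrow> real) \<Rightarrow> bool" where
  "in_Hnn f q n g G \<longleftrightarrow>
     set_borel_measurable lborel (supp f) g
     \<and> (\<forall>x\<in>supp f. G 0 x = g x)
     \<and> (\<forall>k<n - 1. \<forall>x\<in>supp f. (G k has_real_derivative G (Suc k) x) (at x))
     \<and> continuous_on (supp f) (G (n - 1))
     \<and> loc_abs_cont_on (supp f) (G (n - 1))
     \<and> (AE x in lborel. x \<in> supp f \<longrightarrow> (G (n - 1) has_real_derivative G n x) (at x))
     \<and> set_borel_measurable lborel (supp f) (G n)
     \<and> set_integrable lborel (supp f) (\<lambda>x. q x ^ n * (G n x)\<^sup>2 * f x)"

definition S1 :: "(real \<Rightarrow> real) \<Rightarrow> real \<Rightarrow> real \<Rightarrow> real \<Rightarrow> (nat \<Rightarrow> real \<Rightarrow> real) \<Rightarrow> nat \<Rightarrow> real" where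
  "S1 f \<delta> \<beta> \<gamma> G m =
     (\<Sum>i=1..m. (real (m choose i) * (1 - real (m + i) * \<delta>)
                  * (Exp f (\<lambda>x. qpoly \<delta> \<beta> \<gamma> x ^ i * G i x))\<^sup>2)
               / (falling (real m + 1) i * Exp f (\<lambda>x. qpoly \<delta> \<beta> \<gamma> x ^ i)
                  * (\<Prod>j\<in>{i - 1..2 * i - 2}. 1 - real j * \<delta>) * (1 - real m * \<delta>)))
     + Exp f (\<lambda>x. qpoly \<delta> \<beta> \<gamma> x * (G 1 x)\<^sup>2) / ((real m + 1) * (1 - real m * \<delta>))"

definition Sstr :: "(real \<Rightarrow> real) \<Rightarrow> real \<Rightarrow> real \<Rightarrow> real \<Rightarrow> (nat \<Rightarrow> real \<Rightarrow> real) \<Rightarrow> nat \<Rightarrow> real" where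
  "Sstr f \<delta> \<beta> \<gamma> G n =
     (\<Sum>i=1..n. (Exp f (\<lambda>x. qpoly \<delta> \<beta> \<gamma> x ^ i * G i x))\<^sup>2
               / (fact i * Exp f (\<lambda>x. qpoly \<delta> \<beta> \<gamma> x ^ i)
                  * (\<Prod>j\<in>{i - 1..2 * i - 2}. 1 - real j * \<delta>)))
     + (Exp f (\<lambda>x. qpoly \<delta> \<beta> \<gamma> x ^ n * (G n x)\<^sup>2)
        - (Exp f (\<lambda>x. qpoly \<delta> \<beta> \<gamma> x ^ n * G n x))\<^sup>2 / Exp f (\<lambda>x. qpoly \<delta> \<beta> \<gamma> x ^ n))
       / (fact (n + 1) * (\<Prod>j\<in>{n..2 * n - 1}. 1 - real j * \<delta>))"

definition Sweak :: "(real \<Rightarrow> real) \<Rightarrow> real \<Rightarrow> real \<Rightarrow> real \<Rightarrow> (nat \<Rightarrow> real \<Rightarrow> real) \<Rightarrow> nat \<Rightarrow> real" where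
  "Sweak f \<delta> \<beta> \<gamma> G n =
     (\<Sum>i=1..n - 1. (Exp f (\<lambda>x. qpoly \<delta> \<beta> \<gamma> x ^ i * G i x))\<^sup>2
               / (fact i * Exp f (\<lambda>x. qpoly \<delta> \<beta> \<gamma> x ^ i)
                  * (\<Prod>j\<in>{i - 1..2 * i - 2}. 1 - real j * \<delta>)))
     + Exp f (\<lambda>x. qpoly \<delta> \<beta> \<gamma> x ^ n * (G n x)\<^sup>2)
       / (fact n * (\<Prod>j\<in>{n - 1..2 * n - 2}. 1 - real j * \<delta>))"

end

(*
The weight f has orthogonal eigenpolynomials p_0, p_1, ... of the operator
L p = -((mu - x) p' + q p''), with eigenvalues l_i = i (1 - (i - 1) delta), and differentiating turns
the problem for f into the same problem for q f with eigenvalues l_(i+1) - l_1. In terms of the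
Fourier coefficients c_i of g, both inequalities bound E[q g'^2] - sum l_i c_i^2 by a multiple of the
same expression for q^n f and g^(n), and iterating over the weights q^k f reduces them to a spectral
gap: a function orthogonal to all polynomials of degree at most m satisfies
l_(m+1) E[h^2] <= E[q h'^2]. Completeness of the polynomials is not needed for it: if h vanishes at
the zeros of p_(m+1), then on every piece between consecutive zeros of p' (where p = p_(m+1) is
monotone) Cauchy--Schwarz gives h^2 <= |p| |integral of h'^2 / |p'||, and Tonelli together with
(q f p')' = -l p f turns this into the claim; the general case follows by subtracting an interpolating
polynomial.
*)

theory Submission
  imports Defs
begin

subsection \<open>Absolutely continuous functions\<close>

text \<open>All constants of the statement are products of eigenvalue differences. Since l_i - l_j =
  (i - j)(1 - (i + j - 1) \<delta>), the denominator i! times the product of 1 - j \<delta> is the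
  product of l_i - l_j over j < i. The summands are therefore the c_i^2, and the coefficients in
  \<open>S1\<close> multiply them by (l_(m+1) - l_i) / l_(m+1), which turns \<open>S1\<close> into
  the sum of the c_i^2 plus (E[q g'^2] - sum l_i c_i^2) / l_(m+1).

  The weight q^k f is in general no longer attached to the drift \<mu> - x: the drift becomes \<mu>
  + k \<beta> - (1 - 2 k \<delta>) x. Hence the free parameters a and d of
  \<open>pearson_weight\<close>; \<delta> \<le> 0 keeps a positive, the eigenvalues increasing and
  all moments finite.

  The density f is not known to be differentiable. All analysis rests on one identity for the
  integrals of ((d - a x) p + q p') w over half-lines, which already contains the vanishing of the
  boundary terms. Likewise g enters only through integrals of its derivatives over compact
  intervals, so that the last derivative, which exists merely almost everywhere, needs no separate
  treatment in the iteration.\<close>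

lemma sum_lengths_le_of_disjoint:
  fixes u v :: "'i \<Rightarrow> real"
  assumes "finite I" and le: "\<And>i. i \<in> I \<Longrightarrow> u i \<le> v i"
    and sub: "\<And>i. i \<in> I \<Longrightarrow> {u i<..<v i} \<subseteq> T"
    and T: "T \<in> sets borel" "emeasure lborel T < ennreal d" and "0 < d"
    and disj: "\<And>i j. i \<in> I \<Longrightarrow> j \<in> I \<Longrightarrow> i \<noteq> j \<Longrightarrow> {u i<..<v i} \<inter> {u j<..<v j} = {}"
  shows "(\<Sum>i\<in>I. v i - u i) < d"
proof -
  have "ennreal (\<Sum>i\<in>I. v i - u i) = (\<Sum>i\<in>I. emeasure lborel {u i<..<v i})"
    using le by (subst sum_ennreal[symmetric]) (auto intro!: sum.cong)
  also have "\<dots> = emeasure lborel (\<Union>i\<in>I. {u i<..<v i})"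
    using \<open>finite I\<close> disj by (intro sum_emeasure) (auto simp: disjoint_family_on_def)
  also have "\<dots> \<le> emeasure lborel T"
    using sub T by (intro emeasure_mono) auto
  finally have "ennreal (\<Sum>i\<in>I. v i - u i) < ennreal d"
    using T(2) by (rule le_less_trans)
  thus ?thesis using \<open>0 < d\<close> by (simp add: ennreal_less_iff sum_nonneg le)
qed

text \<open>Reindexing by an arbitrary finite set, because the intervals of a tagged division form a
  set of pairs and not a sequence.\<close>

lemma abs_cont_on_intervalD_finite:
  fixes u v :: "'i \<Rightarrow> real"
  assumes "abs_cont_on_interval h a b" and "0 < e"
  obtains d where "0 < d" and
    "\<And>I u v. \<lbrakk>finite (I::'i set); \<And>i. i \<in> I \<Longrightarrow> a \<le> u i \<and> u i \<le> v i \<and> v i \<le> b;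
       \<And>i j. \<lbrakk>i \<in> I; j \<in> I; i \<noteq> j\<rbrakk> \<Longrightarrow> v i \<le> u j \<or> v j \<le> u i; (\<Sum>i\<in>I. v i - u i) < d\<rbrakk>
       \<Longrightarrow> (\<Sum>i\<in>I. \<bar>h (v i) - h (u i)\<bar>) < e"
proof -
  from assms(1)[unfolded abs_cont_on_interval_def, rule_format, OF assms(2)]
  obtain d where d: "d > 0" and *: "\<forall>(N::nat) u v. (\<forall>k<N. a \<le> u k \<and> u k \<le> v k \<and> v k \<le> b)
        \<and> (\<forall>k<N. \<forall>l<N. k \<noteq> l \<longrightarrow> v k \<le> u l \<or> v l \<le> u k)
        \<and> (\<Sum>k<N. v k - u k) < d
        \<longrightarrow> (\<Sum>k<N. \<bar>h (v k) - h (u k)\<bar>) < e"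
    by blast
  show ?thesis
  proof (rule that[OF d])
    fix I :: "'i set" and u v :: "'i \<Rightarrow> real"
    assume I: "finite I" and 1: "\<And>i. i \<in> I \<Longrightarrow> a \<le> u i \<and> u i \<le> v i \<and> v i \<le> b"
      and 2: "\<And>i j. \<lbrakk>i \<in> I; j \<in> I; i \<noteq> j\<rbrakk> \<Longrightarrow> v i \<le> u j \<or> v j \<le> u i"
      and 3: "(\<Sum>i\<in>I. v i - u i) < d"
    obtain p where p: "bij_betw p {..<card I} I"
      using ex_bij_betw_nat_finite[OF I] by (auto simp: atLeast0LessThan)
    have pI: "p k \<in> I" if "k < card I" for k
      using p that by (auto simp: bij_betw_def)
    have pne: "p k \<noteq> p l" if "k < card I" "l < card I" "k \<noteq> l" for k l
      using p that by (auto simp: bij_betw_def inj_on_def)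
    have "(\<Sum>k<card I. \<bar>h (v (p k)) - h (u (p k))\<bar>) < e"
    proof (rule *[rule_format], intro conjI allI impI)
      have "(\<Sum>k<card I. v (p k) - u (p k)) = (\<Sum>i\<in>I. v i - u i)"
        by (rule sum.reindex_bij_betw[OF p])
      thus "(\<Sum>k<card I. v (p k) - u (p k)) < d" using 3 by simp
    qed (use 1 2 pI pne in auto)
    also have "(\<Sum>k<card I. \<bar>h (v (p k)) - h (u (p k))\<bar>) = (\<Sum>i\<in>I. \<bar>h (v i) - h (u i)\<bar>)"
      by (rule sum.reindex_bij_betw[OF p])
    finally show "(\<Sum>i\<in>I. \<bar>h (v i) - h (u i)\<bar>) < e" .
  qed
qed

text \<open>The fundamental theorem of calculus for an absolutely continuous function, by a gauge argument:
  near a point where the derivative exists the increments are controlled by differentiability, and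
  the intervals tagged in the exceptional null set lie in an open set of small measure, so that
  absolute continuity controls the sum of their increments.\<close>
lemma abs_cont_has_integral_deriv:
  fixes h g :: "real \<Rightarrow> real"
  assumes "a \<le> b" and ac: "abs_cont_on_interval h a b"
    and ae: "AE x in lborel. x \<in> {a..b} \<longrightarrow> (h has_real_derivative g x) (at x)"
  shows "(g has_integral (h b - h a)) {a..b}"
proof -
  from ae obtain N where N: "N \<in> null_sets lborel"
    and der: "\<And>x. x \<in> {a..b} \<Longrightarrow> x \<notin> N \<Longrightarrow> (h has_real_derivative g x) (at x)"
    by (auto simp: eventually_ae_filter)
  have Nl: "N \<in> null_sets lebesgue" using N by (rule null_sets_completionI)
  \<comment> \<open>With value 0 on the null set, the tags in N contribute only increments of
    h.\<close>
  define g0 where "g0 x = (if x \<in> N then 0 else g x)" for x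
  have "(g0 has_integral (h b - h a)) (cbox a b)"
    unfolding has_integral
  proof (intro allI impI)
    fix e :: real assume e: "e > 0"
    obtain d where d: "0 < d" and dAC:
      "\<And>I u v. \<lbrakk>finite (I::(real \<times> real set) set); \<And>i. i \<in> I \<Longrightarrow> a \<le> u i \<and> u i \<le> v i \<and> v i \<le> b;
       \<And>i j. \<lbrakk>i \<in> I; j \<in> I; i \<noteq> j\<rbrakk> \<Longrightarrow> v i \<le> u j \<or> v j \<le> u i; (\<Sum>i\<in>I. v i - u i) < d\<rbrakk>
       \<Longrightarrow> (\<Sum>i\<in>I. \<bar>h (v i) - h (u i)\<bar>) < e / 2"
      by (rule abs_cont_on_intervalD_finite[OF ac, of "e/2"]) (use e in \<open>simp, blast\<close>)
    obtain T where T: "open T" "N \<subseteq> T" "emeasure lebesgue (T - N) < ennreal d"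
      using sets_lebesgue_outer_open[OF _ d, of N] Nl by (metis null_setsD2)
    have "emeasure lborel T = emeasure lborel (T - N)"
      using N T by (subst emeasure_Diff_null_set) auto
    moreover have "T - N \<in> sets lborel" using T(1) N by auto
    ultimately have Td: "emeasure lborel T < ennreal d"
      using T(3) by simp
    \<comment> \<open>The summand 1 covers the degenerate interval a = b.\<close>
    define \<epsilon> where "\<epsilon> = e / (2 * (b - a + 1))"
    have eps: "\<epsilon> > 0" using e \<open>a \<le> b\<close> by (simp add: \<epsilon>_def)
    have "\<exists>r>0. (x \<in> N \<longrightarrow> ball x r \<subseteq> T) \<and> (x \<in> {a..b} - N \<longrightarrow>
            (\<forall>y. \<bar>y - x\<bar> < r \<longrightarrow> \<bar>h y - h x - g x * (y - x)\<bar> \<le> \<epsilon> * \<bar>y - x\<bar>))" for x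
    proof (cases "x \<in> N")
      case True
      then obtain r where "r > 0" "ball x r \<subseteq> T" using T by (meson open_contains_ball subsetD)
      thus ?thesis using True by auto
    next
      case False
      show ?thesis
      proof (cases "x \<in> {a..b}")
        case True
        from der[OF True False] have "(h has_derivative (\<lambda>u. g x * u)) (at x)"
          by (simp add: has_field_derivative_def)
        then obtain r where "r > 0" "\<And>y. norm (y - x) < r \<Longrightarrow> norm (h y - h x - g x * (y - x)) \<le> \<epsilon> * norm (y - x)"
          using eps unfolding has_derivative_at_alt by blast
        thus ?thesis using False by auto
      qed (use False in \<open>auto intro!: exI[of _ 1]\<close>)
    qed
    then obtain r where r: "\<And>x. r x > 0" "\<And>x. x \<in> N \<Longrightarrow> ball x (r x) \<subseteq> T"
      "\<And>x y. x \<in> {a..b} \<Longrightarrow> x \<notin> N \<Longrightarrow> \<bar>y - x\<bar> < r x \<Longrightarrow> \<bar>h y - h x - g x * (y - x)\<bar> \<le> \<epsilon> * \<bar>y - x\<bar>"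
      by (metis Diff_iff)
    show "\<exists>\<gamma>. gauge \<gamma> \<and> (\<forall>D. D tagged_division_of (cbox a b) \<and> \<gamma> fine D \<longrightarrow>
        norm ((\<Sum>(x, k)\<in>D. measure lborel k *\<^sub>R g0 x) - (h b - h a)) < e)"
    proof (intro exI[of _ "\<lambda>x. ball x (r x)"] conjI allI impI)
      show "gauge (\<lambda>x. ball x (r x))" using r(1) gauge_ball_dependent by blast
      fix D assume D: "D tagged_division_of cbox a b \<and> (\<lambda>x. ball x (r x)) fine D"
      hence fin: "finite D" and fine: "\<And>x K. (x, K) \<in> D \<Longrightarrow> K \<subseteq> ball x (r x)"
        by (auto simp: fine_def)
      have K: "K = {Inf K..Sup K} \<and> Inf K \<le> x \<and> x \<le> Sup K \<and> a \<le> Inf K \<and> Sup K \<le> b \<and> measure lborel K = Sup K - Inf K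
          \<and> Inf K \<in> ball x (r x) \<and> Sup K \<in> ball x (r x)"
        if "(x, K) \<in> D" for x K
      proof -
        from D that obtain u v where K: "K = {u..v}" "x \<in> K" "K \<subseteq> {a..b}"
          by (metis box_real(2) tagged_division_ofD(2,3,4))
        have "u \<le> v" using K by auto
        moreover have "u \<in> K" "v \<in> K" using K by auto
        hence "u \<in> ball x (r x)" "v \<in> ball x (r x)" using fine[OF that] by blast+
        ultimately show ?thesis using K by auto
      qed
      have K_le: "Inf K \<le> Sup K" if "(x, K) \<in> D" for x K
        using K[OF that] by linarith
      let ?inc = "\<lambda>(x::real, K::real set). h (Sup K) - h (Inf K)"
      let ?t = "\<lambda>(x, K::real set). measure lborel K *\<^sub>R g0 x - (h (Sup K) - h (Inf K))"
      let ?A = "{p\<in>D. fst p \<in> N}" and ?B = "{p\<in>D. fst p \<notin> N}"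
      have hba: "(\<Sum>p\<in>D. ?inc p) = h b - h a" "(\<Sum>(x,K)\<in>D. Sup K - Inf K) = b - a"
        using additive_tagged_division_1[OF \<open>a \<le> b\<close>, of D h]
          additive_tagged_division_1[OF \<open>a \<le> b\<close>, of D "\<lambda>x. x"] D by (auto simp: box_real)
      have "\<bar>\<Sum>p\<in>?B. ?t p\<bar> \<le> (\<Sum>p\<in>?B. \<bar>?t p\<bar>)" by (rule sum_abs)
      also have "\<dots> \<le> (\<Sum>(x,K)\<in>?B. \<epsilon> * (Sup K - Inf K))"
      proof (rule sum_mono, clarsimp)
        fix x K assume xK: "(x, K) \<in> D" "x \<notin> N"
        note k = K[OF xK(1)]
        have ab: "\<bar>Sup K - x\<bar> = Sup K - x" "\<bar>Inf K - x\<bar> = x - Inf K" using k by auto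
        have 1: "\<bar>h (Sup K) - h x - g x * (Sup K - x)\<bar> \<le> \<epsilon> * \<bar>Sup K - x\<bar>"
          using k xK by (intro r(3)) (auto simp: dist_real_def)
        have 2: "\<bar>h (Inf K) - h x - g x * (Inf K - x)\<bar> \<le> \<epsilon> * \<bar>Inf K - x\<bar>"
          using k xK by (intro r(3)) (auto simp: dist_real_def)
        have c: "measure lborel K = Sup K - Inf K" using k by blast
        have "measure lborel K * g0 x = g x * (Sup K - x) - g x * (Inf K - x)"
          unfolding c using xK by (simp add: g0_def algebra_simps)
        moreover have "\<epsilon> * (Sup K - Inf K) = \<epsilon> * (Sup K - x) + \<epsilon> * (x - Inf K)"
          by (simp add: algebra_simps)
        ultimately show "\<bar>measure lborel K * g0 x - (h (Sup K) - h (Inf K))\<bar> \<le> \<epsilon> * (Sup K - Inf K)"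
          using 1[unfolded ab] 2[unfolded ab] by linarith
      qed
      also have "\<dots> \<le> (\<Sum>(x,K)\<in>D. \<epsilon> * (Sup K - Inf K))"
        using fin K_le eps by (intro sum_mono2) auto
      also have "\<dots> = \<epsilon> * (b - a)"
        using hba(2) by (simp add: sum_distrib_left[symmetric] case_prod_unfold)
      also have "\<dots> < e / 2"
        using e \<open>a \<le> b\<close> by (simp add: \<epsilon>_def field_simps)
      finally have B: "\<bar>\<Sum>p\<in>?B. ?t p\<bar> < e / 2" .
      \<comment> \<open>One-point intervals may lie inside other intervals of the division, which
        violates the ordering that \<open>dAC\<close> asks for; their increments are 0.\<close>
      let ?A' = "{p\<in>?A. Inf (snd p) < Sup (snd p)}"
      have inter: "{Inf (snd p)<..<Sup (snd p)} \<inter> {Inf (snd p')<..<Sup (snd p')} = {}"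
        if "p \<in> ?A'" "p' \<in> ?A'" "p \<noteq> p'" for p p'
      proof -
        have i: "interior K = {Inf K<..<Sup K}" if "(x, K) \<in> D" for x K
          by (subst K[OF that, THEN conjunct1]) (simp add: interior_atLeastAtMost_real)
        obtain x k x' k' where p: "p = (x, k)" "p' = (x', k')" by (metis surj_pair)
        have "interior k \<inter> interior k' = {}"
          using D that p by (intro tagged_division_ofD(5)[of D "cbox a b" x k x' k']) auto
        thus ?thesis using i[of x k] i[of x' k'] p that by auto
      qed
      have "(\<Sum>p\<in>?A'. \<bar>h (Sup (snd p)) - h (Inf (snd p))\<bar>) < e / 2"
      proof (rule dAC)
        show "(\<Sum>p\<in>?A'. Sup (snd p) - Inf (snd p)) < d"
        proof (rule sum_lengths_le_of_disjoint[where T = T, OF _ _ _ _ Td d inter])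
          fix p assume p: "p \<in> ?A'"
          have "{Inf (snd p)..Sup (snd p)} \<subseteq> ball (fst p) (r (fst p))"
            using K[of "fst p" "snd p"] fine[of "fst p" "snd p"] p by auto
          thus "{Inf (snd p)<..<Sup (snd p)} \<subseteq> T" using r(2)[of "fst p"] p by fastforce
        qed (use fin T(1) in auto)
        fix p p' assume p: "p \<in> ?A'" "p' \<in> ?A'" "p \<noteq> p'"
        show "Sup (snd p) \<le> Inf (snd p') \<or> Sup (snd p') \<le> Inf (snd p)"
        proof (rule ccontr)
          assume "\<not> ?thesis"
          hence "max (Inf (snd p)) (Inf (snd p')) < min (Sup (snd p)) (Sup (snd p'))"
            using p by auto
          then obtain z where "max (Inf (snd p)) (Inf (snd p')) < z" "z < min (Sup (snd p)) (Sup (snd p'))"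
            using dense by blast
          thus False using inter[OF p] by auto
        qed
      qed (use fin K in auto)
      also have "(\<Sum>p\<in>?A'. \<bar>h (Sup (snd p)) - h (Inf (snd p))\<bar>) = (\<Sum>p\<in>?A. \<bar>h (Sup (snd p)) - h (Inf (snd p))\<bar>)"
      proof (intro sum.mono_neutral_left ballI)
        fix p assume "p \<in> ?A - ?A'"
        hence "Sup (snd p) = Inf (snd p)" using K_le[of "fst p" "snd p"] by auto
        thus "\<bar>h (Sup (snd p)) - h (Inf (snd p))\<bar> = 0" by simp
      qed (use fin in auto)
      finally have A1: "(\<Sum>p\<in>?A. \<bar>h (Sup (snd p)) - h (Inf (snd p))\<bar>) < e / 2" .
      have "(\<Sum>p\<in>?A. ?t p) = (\<Sum>p\<in>?A. - (h (Sup (snd p)) - h (Inf (snd p))))"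
        by (intro sum.cong) (auto simp: g0_def)
      hence "\<bar>\<Sum>p\<in>?A. ?t p\<bar> \<le> (\<Sum>p\<in>?A. \<bar>- (h (Sup (snd p)) - h (Inf (snd p)))\<bar>)"
        by (simp only: sum_abs)
      hence A: "\<bar>\<Sum>p\<in>?A. ?t p\<bar> < e / 2" using A1 by (simp add: abs_minus_commute)
      have "D = ?A \<union> ?B" by auto
      hence "(\<Sum>p\<in>D. ?t p) = (\<Sum>p\<in>?A \<union> ?B. ?t p)" by simp
      also have "\<dots> = (\<Sum>p\<in>?A. ?t p) + (\<Sum>p\<in>?B. ?t p)"
        using fin by (intro sum.union_disjoint) auto
      finally have "\<bar>\<Sum>p\<in>D. ?t p\<bar> < e" using A B by linarith
      moreover have "(\<Sum>p\<in>D. ?t p) = (\<Sum>(x, k)\<in>D. measure lborel k *\<^sub>R g0 x) - (h b - h a)"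
        unfolding hba(1)[symmetric] sum_subtractf[symmetric] by (intro sum.cong) auto
      ultimately show "norm ((\<Sum>(x, k)\<in>D. measure lborel k *\<^sub>R g0 x) - (h b - h a)) < e" by simp
    qed
  qed
  hence "(g0 has_integral (h b - h a)) {a..b}" by (simp add: box_real)
  thus ?thesis
    by (rule has_integral_spike[rotated 2, of _ _ _ N])
      (use Nl in \<open>auto simp: negligible_iff_null_sets g0_def\<close>)
qed

subsection \<open>The Sturm--Liouville operator on polynomials\<close>

text \<open>With \<tau> = (q w)' / w this is p -> -(q w p')' / w.\<close>

definition sl_op :: "real poly \<Rightarrow> real poly \<Rightarrow> real poly \<Rightarrow> real poly" where
  "sl_op q \<tau> p = - (\<tau> * pderiv p + q * pderiv (pderiv p))"

text \<open>The factor by which the operator with drift d - a x multiplies the leading coefficient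
  of a polynomial of degree i.\<close>

definition sl_ev :: "real \<Rightarrow> real \<Rightarrow> nat \<Rightarrow> real" where
  "sl_ev a \<delta> i = real i * (a - (real i - 1) * \<delta>)"

lemma sl_op_add: "sl_op q \<tau> (p + r) = sl_op q \<tau> p + sl_op q \<tau> r"
  by (simp add: sl_op_def pderiv_add algebra_simps)

lemma sl_op_smult: "sl_op q \<tau> (smult k p) = smult k (sl_op q \<tau> p)"
  by (simp add: sl_op_def pderiv_smult smult_add_right smult_diff_right)

lemma sl_op_diff: "sl_op q \<tau> (p - r) = sl_op q \<tau> p - sl_op q \<tau> r"
  by (simp add: sl_op_def pderiv_diff algebra_simps)

lemma sl_op_0 [simp]: "sl_op q \<tau> 0 = 0"
  by (simp add: sl_op_def)

lemma sl_op_sum: "sl_op q \<tau> (\<Sum>i\<in>I. p i) = (\<Sum>i\<in>I. sl_op q \<tau> (p i))"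
  by (induction I rule: infinite_finite_induct) (auto simp: sl_op_add)

text \<open>In the monomial basis the operator is upper triangular with the \<open>sl_ev\<close> on
  the diagonal; solvability and eigenpolynomials follow by back substitution.\<close>

lemma coeff_sl_op:
  "coeff (sl_op [:c, b, \<delta>:] [:d, - a:] p) k =
     sl_ev a \<delta> k * coeff p k - (d + b * real k) * real (Suc k) * coeff p (Suc k)
     - c * real (Suc k) * real (Suc (Suc k)) * coeff p (Suc (Suc k))"
proof -
  consider "k = 0" | "k = 1" | j where "k = Suc (Suc j)"
    by (metis One_nat_def not0_implies_Suc)
  thus ?thesis
    by cases (simp_all add: sl_op_def sl_ev_def coeff_pderiv algebra_simps power2_eq_square)
qed

lemma sl_ev_0 [simp]: "sl_ev a \<delta> 0 = 0"
  by (simp add: sl_ev_def)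

text \<open>Differentiation kills the constants: the spectrum for the weight q w is the one for w
  without its first element, moved back to start at 0.\<close>

lemma sl_ev_shift:
  "sl_ev (a - 2 * \<delta>) \<delta> i = sl_ev a \<delta> (Suc i) - sl_ev a \<delta> 1"
  by (simp add: sl_ev_def algebra_simps)

lemma sl_ev_diff:
  "sl_ev a \<delta> i - sl_ev a \<delta> j = (real i - real j) * (a - (real i + real j - 1) * \<delta>)"
  by (simp add: sl_ev_def algebra_simps)

lemma sl_ev_less:
  assumes "a > 0" "\<delta> \<le> 0" "i < j"
  shows "sl_ev a \<delta> i < sl_ev a \<delta> j"
proof -
  have "0 \<le> (real j + real i - 1) * - \<delta>"
    using assms by (intro mult_nonneg_nonneg) auto
  hence "0 < (real j - real i) * (a - (real j + real i - 1) * \<delta>)"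
    using assms by (intro mult_pos_pos) auto
  thus ?thesis by (simp flip: sl_ev_diff)
qed

lemma sl_ev_pos:
  assumes "a > 0" "\<delta> \<le> 0" "0 < i"
  shows "0 < sl_ev a \<delta> i"
  using sl_ev_less[OF assms] by simp

lemma degree_sl_op_le:
  "degree (sl_op [:c, b, \<delta>:] [:d, - a:] p) \<le> degree p"
  by (rule degree_le) (auto simp: coeff_sl_op coeff_eq_0)

text \<open>Back substitution from the top degree: l differs from the first m + 1 diagonal entries,
  so no pivot vanishes.\<close>

lemma sl_op_solve:
  assumes "degree p \<le> m" "\<And>i. i \<le> m \<Longrightarrow> sl_ev a \<delta> i \<noteq> l"
  shows "\<exists>r. degree r \<le> m \<and> sl_op [:c, b, \<delta>:] [:d, - a:] r - smult l r = p"
  using assms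
proof (induction m arbitrary: p)
  case 0
  then obtain k where "p = [:k:]" by (metis degree_eq_zeroE le_zero_eq)
  moreover have "l \<noteq> 0" using 0(2)[of 0] by simp
  ultimately show ?case
    by (intro exI[of _ "[:- k / l:]"]) (simp add: sl_op_def)
next
  case (Suc m)
  let ?L = "sl_op [:c, b, \<delta>:] [:d, - a:]"
  define k where "k = coeff p (Suc m) / (sl_ev a \<delta> (Suc m) - l)"
  define s where "s = monom k (Suc m)"
  have s: "degree s \<le> Suc m" "coeff s (Suc m) = k"
    by (auto simp: s_def degree_monom_le)
  let ?p = "p - (?L s - smult l s)"
  have "degree ?p \<le> Suc m"
    using Suc.prems(1) s(1) degree_sl_op_le[of c b \<delta> d a s]
    by (intro degree_diff_le) (auto intro: order_trans degree_smult_le)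
  moreover have "coeff ?p (Suc m) = 0"
    using Suc.prems(2)[of "Suc m"] s
    by (simp add: coeff_sl_op coeff_eq_0 k_def field_simps)
  ultimately have "degree ?p \<le> m"
    by (metis le_Suc_eq leading_coeff_0_iff degree_0 zero_le)
  from Suc.IH[OF this] Suc.prems(2) obtain r where r: "degree r \<le> m" "?L r - smult l r = ?p"
    by auto
  have "?L (r + s) - smult l (r + s) = p"
    using r(2) by (simp add: sl_op_add smult_add_right algebra_simps)
  moreover have "degree (r + s) \<le> Suc m" using r s by (intro degree_add_le) auto
  ultimately show ?case by blast
qed

text \<open>Applying L - l_m to x^m cancels the top coefficient, and in degree below m the value l_m
  is no eigenvalue, so the remainder can be solved away.\<close>

lemma sl_op_eigenpoly:
  assumes "a > 0" "\<delta> \<le> 0"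
  shows "\<exists>\<phi>. degree \<phi> = m \<and> \<phi> \<noteq> 0 \<and> sl_op [:c, b, \<delta>:] [:d, - a:] \<phi> = smult (sl_ev a \<delta> m) \<phi>"
proof (cases m)
  case 0
  thus ?thesis by (intro exI[of _ 1]) (simp add: sl_op_def)
next
  case (Suc k)
  let ?L = "sl_op [:c, b, \<delta>:] [:d, - a:]" and ?l = "sl_ev a \<delta> m"
  define s :: "real poly" where "s = monom 1 m"
  have s: "degree s = m" "coeff s m = 1" by (auto simp: s_def degree_monom_eq)
  let ?p = "?L s - smult ?l s"
  have "degree ?p \<le> m"
    using s(1) degree_sl_op_le[of c b \<delta> d a s]
    by (intro degree_diff_le) (auto intro: order_trans degree_smult_le)
  moreover have "coeff ?p m = 0"
    using s by (simp add: coeff_sl_op coeff_eq_0)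
  ultimately have "degree ?p \<le> k"
    by (metis Suc le_Suc_eq leading_coeff_0_iff degree_0 zero_le)
  from sl_op_solve[OF this, of a \<delta> ?l] sl_ev_less[OF assms, of _ m]
  obtain r where r: "degree r \<le> k" "?L r - smult ?l r = ?p"
    using Suc by (metis le_imp_less_Suc less_irrefl)
  have "coeff (s - r) m = 1" using r s Suc by (simp add: coeff_eq_0)
  moreover have "degree (s - r) \<le> m" using r s Suc by (intro degree_diff_le) auto
  ultimately have "degree (s - r) = m" "s - r \<noteq> 0"
    using le_degree[of "s - r" m] by auto
  moreover have "?L (s - r) = smult ?l (s - r)"
    using r(2) by (simp add: sl_op_diff smult_diff_right algebra_simps)
  ultimately show ?thesis by blast
qed

text \<open>Newton's scheme: the divided differences with respect to one node are interpolated at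
  the remaining ones.\<close>

lemma poly_interpolation:
  fixes v :: "real \<Rightarrow> real"
  assumes "finite Z" "card Z \<le> Suc m"
  shows "\<exists>p. degree p \<le> m \<and> (\<forall>z\<in>Z. poly p z = v z)"
  using assms
proof (induction m arbitrary: Z v)
  case 0
  then consider "Z = {}" | z where "Z = {z}"
    by (metis card_0_eq card_1_singletonE le_Suc_eq le_zero_eq One_nat_def)
  thus ?case
  proof cases
    case 2
    thus ?thesis by (intro exI[of _ "[:v z:]"]) auto
  qed (auto intro: exI[of _ 0])
next
  case (Suc m)
  show ?case
  proof (cases "Z = {}")
    case False
    then obtain z where z: "z \<in> Z" by auto
    have "card (Z - {z}) \<le> Suc m" using Suc.prems z by (simp add: card_Diff_singleton)
    from Suc.IH[OF _ this, of "\<lambda>x. (v x - v z) / (x - z)"] Suc.prems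
    obtain p where p: "degree p \<le> m" "\<And>x. x \<in> Z - {z} \<Longrightarrow> poly p x = (v x - v z) / (x - z)"
      by auto
    have "degree ([:v z:] + [:- z, 1:] * p) \<le> Suc m"
      using p(1) degree_mult_le[of "[:- z, 1:]" p] by (intro degree_add_le) auto
    moreover have "poly ([:v z:] + [:- z, 1:] * p) x = v x" if "x \<in> Z" for x
      using p(2)[of x] that by (cases "x = z") (auto simp: field_simps)
    ultimately show ?thesis by blast
  qed (auto intro: exI[of _ 0])
qed

lemma poly_sgn_eq:
  fixes p :: "real poly"
  assumes "\<And>x. x \<in> closed_segment u v \<Longrightarrow> poly p x \<noteq> 0"
  shows "sgn (poly p u) = sgn (poly p v)"
proof -
  have *: "sgn (poly p u) = sgn (poly p v)"
    if uv: "u < v" and nz: "\<And>x. x \<in> {u..v} \<Longrightarrow> poly p x \<noteq> 0" for u v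
  proof (rule ccontr)
    assume "sgn (poly p u) \<noteq> sgn (poly p v)"
    with nz[of u] nz[of v] uv have "poly p u * poly p v < 0"
      by (auto simp: sgn_if mult_less_0_iff split: if_splits)
    with poly_IVT[OF uv this] nz show False by auto
  qed
  consider "u < v" | "u = v" | "v < u" by linarith
  thus ?thesis
    using *[of u v] *[of v u] assms by cases (auto simp: closed_segment_eq_real_ivl)
qed

subsection \<open>Pearson weights\<close>

text \<open>Local absolute continuity in integrated form. No pointwise derivative occurs, so a
  classical derivative and an almost everywhere one look alike.\<close>

definition primitive_on :: "real set \<Rightarrow> (real \<Rightarrow> real) \<Rightarrow> (real \<Rightarrow> real) \<Rightarrow> bool" where
  "primitive_on J h h' \<longleftrightarrow> h \<in> borel_measurable borel \<and> h' \<in> borel_measurable borel \<and>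
     (\<forall>x\<in>J. \<forall>y\<in>J. x \<le> y \<longrightarrow> set_integrable lborel {x..y} h' \<and> (LINT t:{x..y}|lborel. h' t) = h y - h x)"

lemma primitive_onD:
  assumes "primitive_on J h h'"
  shows "h \<in> borel_measurable borel" "h' \<in> borel_measurable borel"
    and "\<And>x y. \<lbrakk>x \<in> J; y \<in> J; x \<le> y\<rbrakk> \<Longrightarrow> set_integrable lborel {x..y} h'"
    and "\<And>x y. \<lbrakk>x \<in> J; y \<in> J; x \<le> y\<rbrakk> \<Longrightarrow> (LINT t:{x..y}|lborel. h' t) = h y - h x"
  using assms unfolding primitive_on_def by auto

lemma primitive_on_poly: "primitive_on J (poly p) (poly (pderiv p))"
proof -
  have "set_integrable lborel {x..y} (poly (pderiv p))" for x y
    by (rule borel_integrable_atLeastAtMost') (intro continuous_intros)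
  moreover have "(LINT t:{x..y}|lborel. poly (pderiv p) t) = poly p y - poly p x" if "x \<le> y" for x y
    unfolding set_lebesgue_integral_def
    using integral_FTC_atLeastAtMost[OF that, of "poly p" "poly (pderiv p)"]
    by (simp add: has_real_derivative_iff_has_vector_derivative[symmetric]
        has_field_derivative_at_within poly_DERIV continuous_on_poly continuous_on_id)
  ultimately show ?thesis
    by (auto simp: primitive_on_def intro!: borel_measurable_continuous_onI continuous_intros)
qed

lemma primitive_on_diff:
  assumes "primitive_on J h h'" "primitive_on J k k'"
  shows "primitive_on J (\<lambda>x. h x - k x) (\<lambda>x. h' x - k' x)"
proof -
  note [measurable] = primitive_onD(1,2)[OF assms(1)] primitive_onD(1,2)[OF assms(2)]
  show ?thesis
    unfolding primitive_on_def
    using primitive_onD(3,4)[OF assms(1)] primitive_onD(3,4)[OF assms(2)]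
    by (auto simp: set_integral_diff)
qed

text \<open>The sign s selects the side of z, here and below: the set is the open interval between z
  and x, to the right of z for s = 1 and to the left for s = -1.\<close>

lemma primitive_on_between:
  assumes "primitive_on J h h'" and "s = 1 \<or> s = -1" and "z \<in> J" "x \<in> J" "0 < s * (x - z)"
  shows "integrable lborel (\<lambda>t. indicator {t. 0 < s * (t - z) \<and> 0 < s * (x - t)} t * h' t)" (is "integrable _ ?f")
    and "(LINT t|lborel. indicator {t. 0 < s * (t - z) \<and> 0 < s * (x - t)} t * h' t) = s * (h x - h z)"
proof -
  note [measurable] = primitive_onD(1,2)[OF assms(1)]
  define l u where "l = min z x" "u = max z x"
  have lu: "l \<in> J" "u \<in> J" "l \<le> u" using assms by (auto simp: l_u_def min_def max_def)
  have 1: "AE t in lborel. ?f t = indicator {l..u} t *\<^sub>R h' t"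
    using AE_lborel_singleton[of l] AE_lborel_singleton[of u]
  proof eventually_elim
    case (elim t)
    thus ?case using assms(2,5) by (auto simp: l_u_def indicator_def min_def max_def split: if_splits)
  qed
  have i: "integrable lborel (\<lambda>t. indicator {l..u} t *\<^sub>R h' t)"
    using primitive_onD(3)[OF assms(1) lu] by (simp add: set_integrable_def)
  have [measurable]: "{t. 0 < s * (t - z) \<and> 0 < s * (x - t)} \<in> sets borel" by measurable
  show "integrable lborel ?f"
    by (rule integrable_cong_AE_imp[OF i]) (use 1 in auto)
  have "(LINT t|lborel. ?f t) = (LINT t|lborel. indicator {l..u} t *\<^sub>R h' t)"
    by (rule integral_cong_AE) (use 1 in auto)
  also have "\<dots> = h u - h l"
    using primitive_onD(4)[OF assms(1) lu] by (simp add: set_lebesgue_integral_def)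
  also have "\<dots> = s * (h x - h z)" using assms by (auto simp: l_u_def)
  finally show "(LINT t|lborel. ?f t) = s * (h x - h z)" .
qed

text \<open>Supplies the majorant for absolute integrability in
  \<open>integration_by_parts\<close>.\<close>

lemma primitive_on_abs:
  assumes "primitive_on J h h'" "is_interval J" "J \<noteq> {}"
  obtains H where "primitive_on J H (\<lambda>t. \<bar>h' t\<bar>)"
proof -
  note [measurable] = primitive_onD(1,2)[OF assms(1)]
  obtain c where c: "c \<in> J" using assms by auto
  \<comment> \<open>On either side of c one of the two integrals runs over at most one point and
    vanishes.\<close>
  define H where "H x = (LINT t|lborel. indicator {t. c \<le> t \<and> t \<le> x} t * \<bar>h' t\<bar>)
    - (LINT t|lborel. indicator {t. x \<le> t \<and> t \<le> c} t * \<bar>h' t\<bar>)" for x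
  have [measurable]: "H \<in> borel_measurable borel"
    unfolding H_def by measurable
  have i: "set_integrable lborel {x..y} (\<lambda>t. \<bar>h' t\<bar>)" if "x \<in> J" "y \<in> J" for x y
  proof (cases "x \<le> y")
    case True
    from set_integrable_abs[OF primitive_onD(3)[OF assms(1) that True]] show ?thesis .
  qed (auto simp: set_integrable_def)
  define I where "I x y = (LINT t:{x..y}|lborel. \<bar>h' t\<bar>)" for x y
  have split: "I x z = I x y + I y z" if "x \<in> J" "y \<in> J" "z \<in> J" "x \<le> y" "y \<le> z" for x y z
  proof -
    have "{x..z} = {x..y} \<union> {y..z}" using that by auto
    moreover have "AE t in lborel. \<not> (t \<in> {x..y} \<and> t \<in> {y..z})"
      using AE_lborel_singleton[of y] by eventually_elim auto
    ultimately show ?thesis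
      unfolding I_def using set_integral_Un_AE[of "{x..y}" "{y..z}" lborel "\<lambda>t. \<bar>h' t\<bar>"] that i by simp
  qed
  have I0: "I x y = 0" if "y \<le> x" for x y
  proof -
    have "AE t in lborel. indicator {x..y} t *\<^sub>R \<bar>h' t\<bar> = 0"
      using AE_lborel_singleton[of x] by eventually_elim (use that in \<open>auto simp: indicator_def\<close>)
    thus ?thesis unfolding I_def set_lebesgue_integral_def by (simp add: integral_eq_zero_AE)
  qed
  have H: "H x = I c x - I x c" for x
    by (simp add: H_def I_def set_lebesgue_integral_def atLeastAtMost_def atLeast_def atMost_def Int_def)
  have "I x y = H y - H x" if "x \<in> J" "y \<in> J" "x \<le> y" for x y
  proof -
    consider "c \<le> x" | "x \<le> c" "c \<le> y" | "y \<le> c" by linarith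
    thus ?thesis
    proof cases
      case 1
      thus ?thesis using split[of c x y] I0[of c x] I0[of c y] that c by (simp add: H)
    next
      case 2
      thus ?thesis using split[of x c y] I0[of x c] I0[of c y] that c by (simp add: H)
    next
      case 3
      thus ?thesis using split[of x y c] I0[of x c] I0[of y c] that c by (simp add: H)
    qed
  qed
  hence "primitive_on J H (\<lambda>t. \<bar>h' t\<bar>)"
    using i by (auto simp: primitive_on_def I_def)
  thus ?thesis by (rule that)
qed

section \<open>Exchange of integrals and Cauchy--Schwarz\<close>

lemma tonelli_signed:
  fixes u v :: "real \<Rightarrow> ennreal"
  assumes [measurable]: "u \<in> borel_measurable borel" "v \<in> borel_measurable borel"
  shows "(\<integral>\<^sup>+x. u x * (\<integral>\<^sup>+t. v t * indicator {t. 0 < s * (x - t)} t \<partial>lborel) \<partial>lborel) =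
         (\<integral>\<^sup>+t. v t * (\<integral>\<^sup>+x. u x * indicator {x. 0 < s * (x - t)} x \<partial>lborel) \<partial>lborel)"
proof -
  have "(\<integral>\<^sup>+x. u x * (\<integral>\<^sup>+t. v t * indicator {t. 0 < s * (x - t)} t \<partial>lborel) \<partial>lborel) =
    (\<integral>\<^sup>+x. (\<integral>\<^sup>+t. u x * v t * indicator {p. 0 < s * (fst p - snd p)} (x, t) \<partial>lborel) \<partial>lborel)"
    by (intro nn_integral_cong) (simp add: nn_integral_cmult[symmetric] mult.assoc indicator_def)
  also have "\<dots> = (\<integral>\<^sup>+t. (\<integral>\<^sup>+x. u x * v t * indicator {p. 0 < s * (fst p - snd p)} (x, t) \<partial>lborel) \<partial>lborel)"
    by (rule lborel_pair.Fubini'[symmetric]) measurable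
  also have "\<dots> = (\<integral>\<^sup>+t. v t * (\<integral>\<^sup>+x. u x * indicator {x. 0 < s * (x - t)} x \<partial>lborel) \<partial>lborel)"
    by (intro nn_integral_cong)
      (simp add: nn_integral_cmult[symmetric] indicator_def algebra_simps)
  finally show ?thesis .
qed

lemma integral_le_nn_integral:
  assumes "integrable M f"
  shows "ennreal (\<integral>x. f x \<partial>M) \<le> (\<integral>\<^sup>+x. ennreal (f x) \<partial>M)"
proof -
  have "ennreal (\<integral>x. f x \<partial>M) \<le> ennreal (\<integral>x. max 0 (f x) \<partial>M)"
    using assms by (intro ennreal_leI integral_mono) auto
  also have "\<dots> = (\<integral>\<^sup>+x. ennreal (max 0 (f x)) \<partial>M)"
    using assms by (intro nn_integral_eq_integral[symmetric]) auto
  also have "\<dots> = (\<integral>\<^sup>+x. ennreal (f x) \<partial>M)"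
    by (intro nn_integral_cong) (auto simp: max_def ennreal_neg)
  finally show ?thesis .
qed

text \<open>The Cauchy--Schwarz inequality, integrated from
  \<open>f\<^sup>2 / g \<ge> 2 k f - k\<^sup>2 g\<close> with \<open>k\<close> the quotient of the two integrals.\<close>
lemma Cauchy_Schwarz_weighted:
  fixes f g :: "'a \<Rightarrow> real"
  assumes i: "integrable M (\<lambda>t. indicator B t * f t)" "integrable M (\<lambda>t. indicator B t * g t)"
    and pos: "\<And>t. t \<in> B \<Longrightarrow> 0 < g t" "0 < (\<integral>t. indicator B t * g t \<partial>M)"
  shows "ennreal ((\<integral>t. indicator B t * f t \<partial>M)\<^sup>2)
    \<le> ennreal (\<integral>t. indicator B t * g t \<partial>M) * (\<integral>\<^sup>+t. ennreal ((f t)\<^sup>2 / g t) * indicator B t \<partial>M)"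
proof -
  define H A where "H = (\<integral>t. indicator B t * f t \<partial>M)" "A = (\<integral>t. indicator B t * g t \<partial>M)"
  define k where "k = H / A"
  have A: "A > 0" using pos by (simp add: H_A_def)
  have "ennreal (H\<^sup>2) = ennreal A * ennreal (2 * k * H - k\<^sup>2 * A)"
    using A by (subst ennreal_mult'[symmetric]) (auto simp: k_def field_simps power2_eq_square)
  also have "2 * k * H - k\<^sup>2 * A = (\<integral>t. 2 * k * (indicator B t * f t) - k\<^sup>2 * (indicator B t * g t) \<partial>M)"
    using i by (simp add: H_A_def)
  also have "ennreal \<dots> \<le> (\<integral>\<^sup>+t. ennreal (2 * k * (indicator B t * f t) - k\<^sup>2 * (indicator B t * g t)) \<partial>M)"
    using i by (intro integral_le_nn_integral) auto
  also have "\<dots> \<le> (\<integral>\<^sup>+t. ennreal ((f t)\<^sup>2 / g t) * indicator B t \<partial>M)"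
  proof (intro nn_integral_mono)
    fix t
    show "ennreal (2 * k * (indicator B t * f t) - k\<^sup>2 * (indicator B t * g t))
      \<le> ennreal ((f t)\<^sup>2 / g t) * indicator B t"
    proof (cases "t \<in> B")
      case True
      have "0 \<le> (f t - k * g t)\<^sup>2" by simp
      hence "2 * k * f t - k\<^sup>2 * g t \<le> (f t)\<^sup>2 / g t"
        using pos(1)[OF True] by (simp add: field_simps power2_eq_square)
      thus ?thesis using True by (simp add: ennreal_leI)
    qed auto
  qed
  finally show ?thesis by (simp add: H_A_def mult_left_mono)
qed

text \<open>The assumption \<open>tail\<close> is (q w p)' = ((d - a x) p + q p') w integrated from
  t to an end of J. It expresses the Pearson equation (q w)' = (d - a x) w and the vanishing of q w
  p at the ends without differentiating w.\<close>

locale pearson_weight =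
  fixes J :: "real set" and w :: "real \<Rightarrow> real" and a b c d \<delta> :: real
  assumes open_J: "open J" and interval_J: "is_interval J" and J_nonempty: "J \<noteq> {}"
    and w_measurable [measurable]: "w \<in> borel_measurable borel"
    and w_pos: "x \<in> J \<Longrightarrow> 0 < w x" and w_zero: "x \<notin> J \<Longrightarrow> w x = 0"
    and q_pos: "x \<in> J \<Longrightarrow> 0 < poly [:c, b, \<delta>:] x"
    and integrable_poly: "integrable lborel (\<lambda>x. poly p x * w x)"
    and a_pos: "0 < a" and \<delta>_nonpos: "\<delta> \<le> 0"
    and tail: "s = 1 \<or> s = -1 \<Longrightarrow> t \<in> J \<Longrightarrow>
      (LINT x|lborel. indicator {x. 0 < s * (x - t)} x *
         (poly ([:d, - a:] * p + [:c, b, \<delta>:] * pderiv p) x * w x)) =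
      - s * (poly [:c, b, \<delta>:] t * w t * poly p t)"
begin

abbreviation "q \<equiv> [:c, b, \<delta>:]"
abbreviation "L \<equiv> sl_op q [:d, - a:]"

lemma J_measurable [measurable]: "J \<in> sets borel"
  using open_J by simp

lemma w_nonneg: "0 \<le> w x"
  using w_pos[of x] w_zero[of x] by (cases "x \<in> J") auto

lemma qw_nonneg: "0 \<le> poly q x * w x"
  using q_pos[of x] w_nonneg[of x] w_zero[of x] by (cases "x \<in> J") (auto intro: mult_nonneg_nonneg less_imp_le)

lemma poly_borel [measurable]: "poly p \<in> borel_measurable (borel :: real measure)"
  by (intro borel_measurable_continuous_onI continuous_intros)

text \<open>The tail identity for p', because w L p = -(q w p')'.\<close>

lemma tail_L:
  assumes "s = 1 \<or> s = -1" "t \<in> J"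
  shows "(LINT x|lborel. indicator {x. 0 < s * (x - t)} x * (poly (L p) x * w x)) =
     s * (poly q t * w t * poly (pderiv p) t)"
proof -
  have "(LINT x|lborel. indicator {x. 0 < s * (x - t)} x * (poly (L p) x * w x))
    = - (LINT x|lborel. indicator {x. 0 < s * (x - t)} x *
         (poly ([:d, - a:] * pderiv p + [:c, b, \<delta>:] * pderiv (pderiv p)) x * w x))"
    by (subst integral_minus[symmetric], intro Bochner_Integration.integral_cong)
      (auto simp: sl_op_def algebra_simps)
  also have "\<dots> = s * (poly q t * w t * poly (pderiv p) t)"
    using tail[OF assms, of "pderiv p"] by simp
  finally show ?thesis .
qed

lemma integrable_indicator_poly:
  assumes [measurable]: "A \<in> sets borel"
  shows "integrable lborel (\<lambda>x. indicator A x * (poly p x * w x))"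
  using integrable_real_mult_indicator[OF _ integrable_poly[of p], of A] by (simp add: mult.commute)

lemma mem_J: "\<lbrakk>x \<in> J; y \<in> J; x \<le> z; z \<le> y\<rbrakk> \<Longrightarrow> z \<in> J"
  using interval_J by (metis mem_is_interval_1_I)

end

subsection \<open>The Poincare inequality for functions vanishing at the zeros of an eigenpolynomial\<close>

context pearson_weight
begin

text \<open>The points of J that are reached from t in direction s before p' vanishes, so that p is
  strictly monotone up to them; empty if p' vanishes at t itself.\<close>

definition branch :: "real poly \<Rightarrow> real \<Rightarrow> real \<Rightarrow> real set" where
  "branch p s t = {x \<in> J. 0 < s * (x - t) \<and> (\<forall>y\<in>closed_segment t x. poly (pderiv p) y \<noteq> 0)}"

lemma branch_measurable [measurable]:
  assumes "pderiv p \<noteq> 0"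
  shows "branch p s t \<in> sets borel"
proof -
  have "branch p s t = (J \<inter> {x. 0 < s * (x - t)})
    - (\<Union>y\<in>{y. poly (pderiv p) y = 0}. {x. t \<le> y \<and> y \<le> x \<or> x \<le> y \<and> y \<le> t})"
    by (auto simp: branch_def closed_segment_eq_real_ivl split: if_splits)
  also have "\<dots> \<in> sets borel"
    using poly_roots_finite[OF assms] by (intro sets.Diff sets.finite_UN) (auto, measurable)
  finally show ?thesis .
qed

text \<open>After the exchange of integrals the inner domain is the part of a branch beyond t. It is
  again a branch, so \<open>integral_branch\<close> evaluates the integral.\<close>

lemma branch_Int:
  assumes "t \<in> branch p s z" and s: "s = 1 \<or> s = -1"
  shows "branch p s t = branch p s z \<inter> {x. 0 < s * (x - t)}"
proof -
  have t: "t \<in> J" "0 < s * (t - z)" "\<And>y. y \<in> closed_segment z t \<Longrightarrow> poly (pderiv p) y \<noteq> 0"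
    using assms by (auto simp: branch_def)
  have seg: "closed_segment z x = closed_segment z t \<union> closed_segment t x" if "0 < s * (x - t)" for x
    using that t(2) s by (auto simp: closed_segment_eq_real_ivl split: if_splits)
  show ?thesis
  proof (rule set_eqI)
    fix x
    show "x \<in> branch p s t \<longleftrightarrow> x \<in> branch p s z \<inter> {x. 0 < s * (x - t)}"
    proof (cases "0 < s * (x - t)")
      case True
      moreover have "0 < s * (x - z)" using True t(2) s by auto
      ultimately show ?thesis using t(3) by (simp add: branch_def seg[OF True] ball_Un)
    qed (simp add: branch_def)
  qed
qed

text \<open>The branch is the half-line beyond t without the half-line beyond the first zero y0 of
  p' on that side. By the tail identity the second integral is a multiple of p'(y0) = 0.\<close>

lemma integral_branch:
  assumes s: "s = 1 \<or> s = -1" and t: "t \<in> J" "poly (pderiv p) t \<noteq> 0"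
    and L: "L p = smult l p" and l: "0 < l"
  shows "(LINT x|lborel. indicator (branch p s t) x * (poly p x * w x)) = s * (poly q t * w t * poly (pderiv p) t) / l"
proof -
  have p0: "pderiv p \<noteq> 0" using t by auto
  let ?u = "\<lambda>t x. indicator {x. 0 < s * (x - t)} x * (poly p x * w x)"
  have u: "(LINT x|lborel. ?u t x) = s * (poly q t * w t * poly (pderiv p) t) / l" if "t \<in> J" for t
  proof -
    have "l * (LINT x|lborel. ?u t x) = (LINT x|lborel. indicator {x. 0 < s * (x - t)} x * (poly (L p) x * w x))"
      unfolding L by (subst integral_mult_right_zero[symmetric]) (simp add: algebra_simps)
    thus ?thesis using tail_L[OF s that, of p] l by (simp add: field_simps)
  qed
  have ui: "integrable lborel (?u t)" for t
    by (rule integrable_indicator_poly) measurable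
  define R where "R = {y \<in> J. poly (pderiv p) y = 0 \<and> 0 < s * (y - t)}"
  have "finite R" using poly_roots_finite[OF p0] by (rule rev_finite_subset) (auto simp: R_def)
  show ?thesis
  proof (cases "R = {}")
    case True
    have "indicator (branch p s t) x * (poly p x * w x) = ?u t x" for x
    proof (cases "x \<in> J \<and> 0 < s * (x - t)")
      case x: True
      have "poly (pderiv p) y \<noteq> 0" if "y \<in> closed_segment t x" for y
      proof
        assume y: "poly (pderiv p) y = 0"
        have "y \<in> J" using mem_J[of t x y] mem_J[of x t y] that x t
          by (auto simp: closed_segment_eq_real_ivl split: if_splits)
        moreover have "0 < s * (y - t)"
          using that x s y t(2) by (cases "y = t") (auto simp: closed_segment_eq_real_ivl split: if_splits)
        ultimately show False using True y by (auto simp: R_def)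
      qed
      hence "x \<in> branch p s t" using x by (auto simp: branch_def)
      thus ?thesis using x by simp
    next
      case False
      thus ?thesis using w_zero[of x] by (auto simp: branch_def indicator_def)
    qed
    hence "(\<lambda>x. indicator (branch p s t) x * (poly p x * w x)) = ?u t" by blast
    thus ?thesis using u[OF t(1)] by (simp only:)
  next
    case False
    \<comment> \<open>Multiplication by s makes the zero nearest to t a minimum on either
      side.\<close>
    define m where "m = Min ((\<lambda>y. s * y) ` R)"
    have "m \<in> (\<lambda>y. s * y) ` R" unfolding m_def using False \<open>finite R\<close> by (intro Min_in) auto
    then obtain y0 where y0: "y0 \<in> R" "m = s * y0" by auto
    have min: "s * y0 \<le> s * y" if "y \<in> R" for y
      unfolding y0(2)[symmetric] m_def using \<open>finite R\<close> that by (intro Min_le) auto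
    have y0J: "y0 \<in> J" "poly (pderiv p) y0 = 0" "0 < s * (y0 - t)" using y0 by (auto simp: R_def)
    have "AE x in lborel. indicator (branch p s t) x * (poly p x * w x) = ?u t x - ?u y0 x"
      using AE_lborel_singleton[of y0]
    proof eventually_elim
      case (elim x)
      show ?case
      proof (cases "x \<in> J")
        case x: True
        have "x \<in> branch p s t \<longleftrightarrow> 0 < s * (x - t) \<and> \<not> 0 < s * (x - y0)"
        proof
          assume b: "x \<in> branch p s t"
          hence "y0 \<notin> closed_segment t x" using y0J by (auto simp: branch_def)
          thus "0 < s * (x - t) \<and> \<not> 0 < s * (x - y0)"
            using b y0J s by (auto simp: branch_def closed_segment_eq_real_ivl split: if_splits)
        next
          assume b: "0 < s * (x - t) \<and> \<not> 0 < s * (x - y0)"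
          have "poly (pderiv p) y \<noteq> 0" if "y \<in> closed_segment t x" for y
          proof
            assume y: "poly (pderiv p) y = 0"
            have "y \<in> J" using mem_J[of t x y] mem_J[of x t y] that x t
              by (auto simp: closed_segment_eq_real_ivl split: if_splits)
            moreover have "0 < s * (y - t)"
              using that b s y t(2) by (cases "y = t") (auto simp: closed_segment_eq_real_ivl split: if_splits)
            ultimately have "y \<in> R" using y by (auto simp: R_def)
            from min[OF this] that b s elim show False
              by (auto simp: closed_segment_eq_real_ivl split: if_splits)
          qed
          thus "x \<in> branch p s t" using b x by (auto simp: branch_def)
        qed
        moreover have "0 < s * (x - y0) \<longrightarrow> 0 < s * (x - t)" using y0J s by auto
        ultimately show ?thesis by (auto simp: indicator_def)
      qed (simp add: w_zero)
    qed
    hence "(LINT x|lborel. indicator (branch p s t) x * (poly p x * w x)) = (LINT x|lborel. ?u t x - ?u y0 x)"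
      using p0 by (intro integral_cong_AE) measurable
    also have "\<dots> = (LINT x|lborel. ?u t x) - (LINT x|lborel. ?u y0 x)"
      by (intro Bochner_Integration.integral_diff ui)
    finally show ?thesis using u[OF t(1)] u[OF y0J(1)] y0J(2) by simp
  qed
qed

text \<open>Otherwise \<open>p\<close> has constant sign on the component of \<open>x\<close>, and the tail identities
  on both sides of \<open>x\<close> give \<open>poly (pderiv p) x\<close> opposite signs.\<close>
lemma ex_root_in_component:
  assumes x: "x \<in> J" "poly (pderiv p) x \<noteq> 0" and L: "L p = smult l p" and l: "0 < l"
  obtains z where "z \<in> J" "poly p z = 0" "\<And>y. y \<in> closed_segment z x \<Longrightarrow> poly (pderiv p) y \<noteq> 0"
proof (rule ccontr)
  note root = that
  assume "\<not> thesis"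
  hence no: "poly p z \<noteq> 0" if "z \<in> J" "\<And>y. y \<in> closed_segment x z \<Longrightarrow> poly (pderiv p) y \<noteq> 0" for z
    using that root[of z] by (auto simp: closed_segment_commute)
  have px: "poly p x \<noteq> 0" using x by (intro no) auto
  have "0 \<le> s * sgn (poly p x) * poly (pderiv p) x" if s: "s = 1 \<or> s = -1" for s
  proof -
    have "0 \<le> sgn (poly p x) * poly p y" if y: "y \<in> branch p s x" for y
    proof -
      have "poly p u \<noteq> 0" if u: "u \<in> closed_segment x y" for u
      proof (rule no)
        show "u \<in> J" using mem_J[of x y u] mem_J[of y x u] u x y
          by (auto simp: branch_def closed_segment_eq_real_ivl split: if_splits)
        fix v assume "v \<in> closed_segment x u"
        hence "v \<in> closed_segment x y"
          using u by (auto simp: closed_segment_eq_real_ivl split: if_splits)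
        thus "poly (pderiv p) v \<noteq> 0" using y by (auto simp: branch_def)
      qed
      from poly_sgn_eq[OF this] show ?thesis by (simp add: sgn_mult_abs mult.commute sgn_if)
    qed
    hence "0 \<le> sgn (poly p x) * (indicator (branch p s x) y * (poly p y * w y))" for y
      using w_nonneg[of y] by (cases "y \<in> branch p s x") (auto simp: mult.assoc[symmetric])
    hence "0 \<le> (LINT y|lborel. sgn (poly p x) * (indicator (branch p s x) y * (poly p y * w y)))"
      by (intro Bochner_Integration.integral_nonneg)
    hence "0 \<le> sgn (poly p x) * (s * (poly q x * w x * poly (pderiv p) x) / l)"
      using integral_branch[OF s x L l] by simp
    also have "\<dots> = (s * sgn (poly p x) * poly (pderiv p) x) * (poly q x * w x / l)" by simp
    finally have "0 \<le> (s * sgn (poly p x) * poly (pderiv p) x) * (poly q x * w x / l)" .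
    moreover have "0 < poly q x * w x / l"
      using l q_pos[OF x(1)] w_pos[OF x(1)] by (intro divide_pos_pos mult_pos_pos)
    ultimately show ?thesis using mult_neg_pos not_le by blast
  qed
  from this[of 1] this[of "-1"] px x(2) show False by (auto simp: sgn_if split: if_splits)
qed

text \<open>Weighting Cauchy--Schwarz by \<open>|p'|\<close> loses nothing for h = p, which is why
  the constant comes out as exactly 1 / l.\<close>

lemma nn_integral_branch_le:
  assumes s: "s = 1 \<or> s = -1" and z: "z \<in> J" "poly p z = 0"
    and L: "L p = smult l p" and l: "0 < l" and p0: "pderiv p \<noteq> 0"
    and h: "primitive_on J h h'" "h z = 0"
  shows "(\<integral>\<^sup>+x. ennreal (w x * (h x)\<^sup>2) * indicator (branch p s z) x \<partial>lborel)
    \<le> ennreal (1 / l) * (\<integral>\<^sup>+x. ennreal (poly q x * w x * (h' x)\<^sup>2) * indicator (branch p s z) x \<partial>lborel)"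
proof -
  note [measurable] = primitive_onD(1,2)[OF h(1)] branch_measurable[OF p0]
  define D where "D = branch p s z"
  have [measurable]: "D \<in> sets borel" by (simp add: D_def p0)
  define \<epsilon> where "\<epsilon> = sgn (poly (pderiv p) z)"
  have abs_p': "\<bar>poly (pderiv p) t\<bar> = \<epsilon> * poly (pderiv p) t \<and> \<epsilon> * poly (pderiv p) t > 0 \<and> \<bar>\<epsilon>\<bar> = 1"
    if "t \<in> D" for t
  proof -
    have "\<epsilon> = sgn (poly (pderiv p) t)"
      unfolding \<epsilon>_def by (rule poly_sgn_eq) (use that in \<open>auto simp: D_def branch_def\<close>)
    moreover have "poly (pderiv p) t \<noteq> 0" using that by (auto simp: D_def branch_def)
    ultimately show ?thesis by (auto simp: sgn_if)
  qed
  have seg: "t \<in> D" if "x \<in> D" "0 < s * (t - z)" "0 \<le> s * (x - t)" for t x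
    using that s z mem_J[of z x t] mem_J[of x z t]
    by (auto simp: D_def branch_def closed_segment_eq_real_ivl split: if_splits)
  \<comment> \<open>Since p vanishes at z and p' has the sign \<open>\<epsilon>\<close> on the
    branch, the mean value theorem gives the sign of p.\<close>
  have abs_p: "\<bar>poly p x\<bar> = s * \<epsilon> * poly p x \<and> s * \<epsilon> * poly p x > 0" if x: "x \<in> D" for x
  proof -
    obtain t where t: "t \<in> D" "poly p x = (x - z) * poly (pderiv p) t"
    proof (cases "z < x")
      case True
      from poly_MVT[OF this, of p] obtain t where "z < t" "t < x" "poly p x = (x - z) * poly (pderiv p) t"
        using z by auto
      with seg[OF x, of t] x True s show ?thesis by (intro that[of t]) (auto simp: D_def branch_def)
    next
      case False
      hence "x < z" using x by (cases "x = z") (auto simp: D_def branch_def)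
      from poly_MVT[OF this, of p] obtain t where "x < t" "t < z" "- poly p x = (z - x) * poly (pderiv p) t"
        using z by auto
      with seg[OF x, of t] x False s show ?thesis by (intro that[of t]) (auto simp: D_def branch_def algebra_simps)
    qed
    have "s * \<epsilon> * poly p x = (s * (x - z)) * (\<epsilon> * poly (pderiv p) t)" using t by simp
    also have "\<dots> > 0"
    proof (rule mult_pos_pos)
      show "0 < s * (x - z)" using x by (simp add: D_def branch_def)
    qed (use abs_p'[OF t(1)] in blast)
    finally have "s * \<epsilon> * poly p x > 0" .
    moreover have "\<bar>s * \<epsilon> * poly p x\<bar> = \<bar>poly p x\<bar>" using s abs_p'[OF t(1)] by (auto simp: abs_mult)
    ultimately show ?thesis by simp
  qed
  \<comment> \<open>The integrand factors into v, the Cauchy--Schwarz quotient, and u, the weight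
    times the bound \<open>|p|\<close>.\<close>
  define v where "v t = ennreal ((h' t)\<^sup>2 / \<bar>poly (pderiv p) t\<bar>) * indicator D t" for t
  define u where "u x = ennreal (w x * \<bar>poly p x\<bar>) * indicator D x" for x
  have [measurable]: "u \<in> borel_measurable borel" "v \<in> borel_measurable borel"
    unfolding u_def v_def by measurable
  have 1: "ennreal ((h x)\<^sup>2) \<le> ennreal \<bar>poly p x\<bar> * (\<integral>\<^sup>+t. v t * indicator {t. 0 < s * (x - t)} t \<partial>lborel)"
    if x: "x \<in> D" for x
  proof -
    define B where "B = {t. 0 < s * (t - z) \<and> 0 < s * (x - t)}"
    have xJ: "x \<in> J" "0 < s * (x - z)" using x by (auto simp: D_def branch_def)
    have BD: "t \<in> D" if "t \<in> B" for t using seg[OF x, of t] that by (auto simp: B_def)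
    note hB = primitive_on_between[OF h(1) s z(1) xJ, folded B_def]
    note pB = primitive_on_between[OF primitive_on_poly[of J p] s z(1) xJ, folded B_def]
    have g: "(LINT t|lborel. indicator B t * (\<epsilon> * poly (pderiv p) t)) = \<bar>poly p x\<bar>"
      using pB(2) abs_p[OF x] z by (simp add: mult.left_commute)
    have "ennreal ((LINT t|lborel. indicator B t * h' t)\<^sup>2)
        \<le> ennreal (LINT t|lborel. indicator B t * (\<epsilon> * poly (pderiv p) t)) *
          (\<integral>\<^sup>+t. ennreal ((h' t)\<^sup>2 / (\<epsilon> * poly (pderiv p) t)) * indicator B t \<partial>lborel)"
    proof (rule Cauchy_Schwarz_weighted)
      show "integrable lborel (\<lambda>t. indicator B t * (\<epsilon> * poly (pderiv p) t))"
        using integrable_mult_right[OF pB(1), of \<epsilon>] by (simp add: mult.left_commute)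
      show "0 < (LINT t|lborel. indicator B t * (\<epsilon> * poly (pderiv p) t))"
        unfolding g using abs_p[OF x] by simp
    qed (use hB abs_p' BD in auto)
    also have "(LINT t|lborel. indicator B t * h' t)\<^sup>2 = (h x)\<^sup>2"
      using hB(2) h(2) s by auto
    also have "(\<integral>\<^sup>+t. ennreal ((h' t)\<^sup>2 / (\<epsilon> * poly (pderiv p) t)) * indicator B t \<partial>lborel)
      = (\<integral>\<^sup>+t. v t * indicator {t. 0 < s * (x - t)} t \<partial>lborel)"
    proof (intro nn_integral_cong)
      fix t
      show "ennreal ((h' t)\<^sup>2 / (\<epsilon> * poly (pderiv p) t)) * indicator B t = v t * indicator {t. 0 < s * (x - t)} t"
      proof (cases "t \<in> B")
        case True
        thus ?thesis using abs_p'[OF BD[OF True]] BD[OF True] by (simp add: v_def B_def)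
      next
        case False
        hence "t \<notin> D \<or> \<not> 0 < s * (x - t)" by (auto simp: B_def D_def branch_def)
        thus ?thesis using False by (auto simp: v_def)
      qed
    qed
    finally show ?thesis unfolding g .
  qed
  have "(\<integral>\<^sup>+x. ennreal (w x * (h x)\<^sup>2) * indicator D x \<partial>lborel)
    \<le> (\<integral>\<^sup>+x. u x * (\<integral>\<^sup>+t. v t * indicator {t. 0 < s * (x - t)} t \<partial>lborel) \<partial>lborel)"
  proof (intro nn_integral_mono)
    fix x
    show "ennreal (w x * (h x)\<^sup>2) * indicator D x \<le> u x * (\<integral>\<^sup>+t. v t * indicator {t. 0 < s * (x - t)} t \<partial>lborel)"
    proof (cases "x \<in> D")
      case True
      thus ?thesis using mult_left_mono[OF 1[OF True], of "ennreal (w x)"]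
        by (simp add: u_def ennreal_mult w_nonneg mult.assoc)
    qed auto
  qed
  also have "\<dots> = (\<integral>\<^sup>+t. v t * (\<integral>\<^sup>+x. u x * indicator {x. 0 < s * (x - t)} x \<partial>lborel) \<partial>lborel)"
    by (rule tonelli_signed) measurable
  \<comment> \<open>The inner integral of \<open>|p| w\<close> over the points beyond t equals q w
    \<open>|p'|\<close> / l at t, and its factor \<open>|p'|\<close> cancels the denominator of
    v.\<close>
  also have "\<dots> = (\<integral>\<^sup>+t. ennreal (1 / l) * (ennreal (poly q t * w t * (h' t)\<^sup>2) * indicator D t) \<partial>lborel)"
  proof (intro nn_integral_cong)
    fix t
    show "v t * (\<integral>\<^sup>+x. u x * indicator {x. 0 < s * (x - t)} x \<partial>lborel) =
      ennreal (1 / l) * (ennreal (poly q t * w t * (h' t)\<^sup>2) * indicator D t)"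
    proof (cases "t \<in> D")
      case True
      have tJ: "t \<in> J" "poly (pderiv p) t \<noteq> 0" using True by (auto simp: D_def branch_def)
      have Dt: "branch p s t = D \<inter> {x. 0 < s * (x - t)}"
        using branch_Int[OF _ s] True by (simp add: D_def)
      have i: "integrable lborel (\<lambda>x. indicator (branch p s t) x * (poly p x * w x))"
        by (rule integrable_indicator_poly) (simp add: p0)
      have "(\<integral>\<^sup>+x. u x * indicator {x. 0 < s * (x - t)} x \<partial>lborel)
        = (\<integral>\<^sup>+x. ennreal (s * \<epsilon> * (indicator (branch p s t) x * (poly p x * w x))) \<partial>lborel)"
      proof (intro nn_integral_cong)
        fix x
        show "u x * indicator {x. 0 < s * (x - t)} x =
          ennreal (s * \<epsilon> * (indicator (branch p s t) x * (poly p x * w x)))"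
        proof (cases "x \<in> branch p s t")
          case True
          hence "x \<in> D" "0 < s * (x - t)" by (auto simp: Dt)
          thus ?thesis using abs_p[OF \<open>x \<in> D\<close>] True by (simp add: u_def mult_ac)
        next
          case False
          hence "x \<notin> D \<or> \<not> 0 < s * (x - t)" using Dt by auto
          thus ?thesis using False by (auto simp: u_def)
        qed
      qed
      also have "\<dots> = ennreal (LINT x|lborel. s * \<epsilon> * (indicator (branch p s t) x * (poly p x * w x)))"
      proof (rule nn_integral_eq_integral)
        show "AE x in lborel. 0 \<le> s * \<epsilon> * (indicator (branch p s t) x * (poly p x * w x))"
        proof (intro AE_I2)
          fix x
          show "0 \<le> s * \<epsilon> * (indicator (branch p s t) x * (poly p x * w x))"
          proof (cases "x \<in> branch p s t")
            case True
            hence "x \<in> D" by (auto simp: Dt)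
            from abs_p[OF this] w_nonneg[of x] True show ?thesis by (auto simp: mult.assoc[symmetric])
          qed auto
        qed
      qed (use i in auto)
      also have "(LINT x|lborel. s * \<epsilon> * (indicator (branch p s t) x * (poly p x * w x)))
        = s * \<epsilon> * (s * (poly q t * w t * poly (pderiv p) t) / l)"
        using integral_branch[OF s tJ L l] by simp
      also have "\<dots> = poly q t * w t * \<bar>poly (pderiv p) t\<bar> / l"
        using s abs_p'[OF True] by auto
      finally have "(\<integral>\<^sup>+x. u x * indicator {x. 0 < s * (x - t)} x \<partial>lborel) = ennreal \<dots>" .
      hence "v t * (\<integral>\<^sup>+x. u x * indicator {x. 0 < s * (x - t)} x \<partial>lborel)
        = ennreal ((h' t)\<^sup>2 / \<bar>poly (pderiv p) t\<bar> * (poly q t * w t * \<bar>poly (pderiv p) t\<bar> / l))"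
        using True l qw_nonneg[of t] by (simp add: v_def ennreal_mult'[symmetric])
      also have "(h' t)\<^sup>2 / \<bar>poly (pderiv p) t\<bar> * (poly q t * w t * \<bar>poly (pderiv p) t\<bar> / l)
        = 1 / l * (poly q t * w t * (h' t)\<^sup>2)"
        using tJ by simp
      also have "ennreal \<dots> = ennreal (1 / l) * ennreal (poly q t * w t * (h' t)\<^sup>2)"
        using l by (intro ennreal_mult') simp
      finally show ?thesis using True by simp
    qed (simp add: v_def)
  qed
  also have "\<dots> = ennreal (1 / l) * (\<integral>\<^sup>+t. ennreal (poly q t * w t * (h' t)\<^sup>2) * indicator D t \<partial>lborel)"
    by (rule nn_integral_cmult) measurable
  finally show ?thesis by (simp add: D_def)
qed

text \<open>The branches issuing from the zeros of p are disjoint, as p' vanishes between two zeros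
  by Rolle, and they cover J up to finitely many points by \<open>ex_root_in_component\<close>. The
  inequalities on the branches add up.\<close>

lemma nn_integral_le_of_zero_at_roots:
  assumes L: "L p = smult l p" and l: "0 < l" and p0: "p \<noteq> 0"
    and h: "primitive_on J h h'" and h0: "\<And>z. z \<in> J \<Longrightarrow> poly p z = 0 \<Longrightarrow> h z = 0"
  shows "(\<integral>\<^sup>+x. ennreal (w x * (h x)\<^sup>2) \<partial>lborel)
    \<le> ennreal (1 / l) * (\<integral>\<^sup>+x. ennreal (poly q x * w x * (h' x)\<^sup>2) \<partial>lborel)"
proof -
  have p'0: "pderiv p \<noteq> 0"
  proof
    assume "pderiv p = 0"
    hence "L p = 0" by (simp add: sl_op_def)
    thus False using L l p0 by simp
  qed
  note [measurable] = primitive_onD(1,2)[OF h(1)] branch_measurable[OF p'0]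
  define Z where "Z = {z \<in> J. poly p z = 0}"
  define I where "I = {1, -1 :: real} \<times> Z"
  define D where "D i = branch p (fst i) (snd i)" for i
  have "finite Z" using poly_roots_finite[OF p0] by (rule rev_finite_subset) (auto simp: Z_def)
  hence fin: "finite I" by (simp add: I_def)
  have [measurable]: "D i \<in> sets borel" for i by (simp add: D_def p'0)
  have disj: "disjoint_family_on D I"
    unfolding disjoint_family_on_def
  proof (intro ballI impI)
    fix i j assume ij: "i \<in> I" "j \<in> I" "i \<noteq> j"
    obtain s z s' z' where [simp]: "i = (s, z)" "j = (s', z')" by (metis surj_pair)
    have z: "s \<in> {1, -1}" "s' \<in> {1, -1}" "poly p z = 0" "poly p z' = 0" using ij by (auto simp: I_def Z_def)
    have False if x: "x \<in> D i" "x \<in> D j" for x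
    proof -
      have *: "poly (pderiv p) y \<noteq> 0" if "y \<in> closed_segment z x \<or> y \<in> closed_segment z' x" for y
        using x that by (auto simp: D_def branch_def)
      have "z = z'"
      proof (rule ccontr)
        assume "z \<noteq> z'"
        have "\<exists>y. min z z' < y \<and> y < max z z' \<and> poly p (max z z') - poly p (min z z') = (max z z' - min z z') * poly (pderiv p) y"
          using \<open>z \<noteq> z'\<close> by (intro poly_MVT) auto
        then obtain y where y: "min z z' < y" "y < max z z'" "poly (pderiv p) y = 0"
          using z \<open>z \<noteq> z'\<close> by (auto simp: min_def max_def split: if_splits)
        hence "y \<in> closed_segment z x \<or> y \<in> closed_segment z' x"
          by (auto simp: closed_segment_eq_real_ivl min_def max_def split: if_splits)
        with * y show False by blast
      qed
      thus False using ij x z by (auto simp: D_def branch_def)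
    qed
    thus "D i \<inter> D j = {}" by blast
  qed
  have sum_ind: "(\<Sum>i\<in>I. indicator (D i) x :: ennreal) = indicator (\<Union>i\<in>I. D i) x" for x
    by (rule indicator_UN_disjoint[symmetric, OF fin disj])
  have cover: "AE x in lborel. x \<in> J \<longrightarrow> x \<in> (\<Union>i\<in>I. D i)"
  proof -
    have "finite ({y. poly (pderiv p) y = 0} \<union> Z)"
      using poly_roots_finite[OF p'0] \<open>finite Z\<close> by simp
    hence "AE x in lborel. x \<notin> {y. poly (pderiv p) y = 0} \<union> Z"
      by (intro AE_not_in finite_imp_null_set_lborel)
    thus ?thesis
    proof eventually_elim
      case (elim x)
      show ?case
      proof
        assume x: "x \<in> J"
        then obtain z where z: "z \<in> J" "poly p z = 0" "\<And>y. y \<in> closed_segment z x \<Longrightarrow> poly (pderiv p) y \<noteq> 0"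
          using ex_root_in_component[OF x _ L l] elim by auto
        have "z \<noteq> x" using elim z by (auto simp: Z_def)
        hence "x \<in> D (sgn (x - z), z)" using x z by (auto simp: D_def branch_def sgn_if)
        moreover have "(sgn (x - z), z) \<in> I" using z \<open>z \<noteq> x\<close> by (auto simp: I_def Z_def sgn_if)
        ultimately show "x \<in> (\<Union>i\<in>I. D i)" by blast
      qed
    qed
  qed
  let ?F = "\<lambda>x. ennreal (w x * (h x)\<^sup>2)" and ?G = "\<lambda>x. ennreal (poly q x * w x * (h' x)\<^sup>2)"
  have "(\<integral>\<^sup>+x. ?F x \<partial>lborel) \<le> (\<integral>\<^sup>+x. (\<Sum>i\<in>I. ?F x * indicator (D i) x) \<partial>lborel)"
    using cover
    by (intro nn_integral_mono_AE, elim eventually_mono)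
      (auto simp: sum_distrib_left[symmetric] sum_ind w_zero split: split_indicator)
  also have "\<dots> = (\<Sum>i\<in>I. \<integral>\<^sup>+x. ?F x * indicator (D i) x \<partial>lborel)"
    by (rule nn_integral_sum) measurable
  also have "\<dots> \<le> (\<Sum>i\<in>I. ennreal (1 / l) * (\<integral>\<^sup>+x. ?G x * indicator (D i) x \<partial>lborel))"
    unfolding D_def
    by (intro sum_mono nn_integral_branch_le L l p'0 h h0) (auto simp: I_def Z_def)
  also have "\<dots> = ennreal (1 / l) * (\<integral>\<^sup>+x. (\<Sum>i\<in>I. ?G x * indicator (D i) x) \<partial>lborel)"
    by (subst nn_integral_sum) (simp_all add: sum_distrib_left)
  also have "\<dots> \<le> ennreal (1 / l) * (\<integral>\<^sup>+x. ?G x \<partial>lborel)"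
    by (intro mult_left_mono nn_integral_mono)
      (auto simp: sum_distrib_left[symmetric] sum_ind split: split_indicator)
  finally show ?thesis .
qed

end

subsection \<open>Integration by parts\<close>

text \<open>The inner integral of k from c to x is, up to the sign s, the increment of a primitive
  of k. Moving the integration to u produces the half-line integrals that the tail identities
  evaluate.\<close>

lemma fubini_signed:
  fixes u k :: "real \<Rightarrow> real"
  assumes [measurable]: "u \<in> borel_measurable borel" "k \<in> borel_measurable borel"
    and fin: "(\<integral>\<^sup>+x. ennreal \<bar>u x\<bar> * (\<integral>\<^sup>+t. ennreal (indicator {t. 0 < s * (t - c) \<and> 0 < s * (x - t)} t * \<bar>k t\<bar>) \<partial>lborel) \<partial>lborel) < \<infinity>"
  shows "(LINT x|lborel. u x * (LINT t|lborel. indicator {t. 0 < s * (t - c) \<and> 0 < s * (x - t)} t * k t)) =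
      (LINT t|lborel. indicator {t. 0 < s * (t - c)} t * k t * (LINT x|lborel. indicator {x. 0 < s * (x - t)} x * u x))"
    and "integrable lborel (\<lambda>x. u x * (LINT t|lborel. indicator {t. 0 < s * (t - c) \<and> 0 < s * (x - t)} t * k t))"
    and "integrable lborel (\<lambda>t. indicator {t. 0 < s * (t - c)} t * k t * (LINT x|lborel. indicator {x. 0 < s * (x - t)} x * u x))"
proof -
  define F where "F x t = u x * (indicator {t. 0 < s * (t - c) \<and> 0 < s * (x - t)} t * k t)" for x t
  have F: "case_prod F \<in> borel_measurable (lborel \<Otimes>\<^sub>M lborel)"
  proof -
    have "case_prod F = (\<lambda>p. u (fst p) * (indicator {p. 0 < s * (snd p - c) \<and> 0 < s * (fst p - snd p)} p * k (snd p)))"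
      by (auto simp: F_def indicator_def fun_eq_iff)
    also have "\<dots> \<in> borel_measurable (lborel \<Otimes>\<^sub>M lborel)" by measurable
    finally show ?thesis .
  qed
  have "(\<integral>\<^sup>+p. ennreal (norm (case_prod F p)) \<partial>(lborel \<Otimes>\<^sub>M lborel)) = (\<integral>\<^sup>+x. \<integral>\<^sup>+t. ennreal (norm (F x t)) \<partial>lborel \<partial>lborel)"
    using F by (subst lborel.nn_integral_fst[symmetric]) auto
  also have "\<dots> = (\<integral>\<^sup>+x. ennreal \<bar>u x\<bar> * (\<integral>\<^sup>+t. ennreal (indicator {t. 0 < s * (t - c) \<and> 0 < s * (x - t)} t * \<bar>k t\<bar>) \<partial>lborel) \<partial>lborel)"
    by (intro nn_integral_cong, subst nn_integral_cmult[symmetric])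
      (auto intro!: nn_integral_cong simp: F_def abs_mult ennreal_mult)
  finally have int: "integrable (lborel \<Otimes>\<^sub>M lborel) (case_prod F)"
    using fin F by (intro integrableI_bounded) auto
  have 1: "(LINT t|lborel. F x t) = u x * (LINT t|lborel. indicator {t. 0 < s * (t - c) \<and> 0 < s * (x - t)} t * k t)" for x
    by (simp add: F_def)
  have 2: "(LINT x|lborel. F x t) = indicator {t. 0 < s * (t - c)} t * k t * (LINT x|lborel. indicator {x. 0 < s * (x - t)} x * u x)" for t
    by (subst integral_mult_right_zero[symmetric], intro Bochner_Integration.integral_cong)
      (auto simp: F_def indicator_def)
  from lborel_pair.Fubini_integral[OF int]
  show "(LINT x|lborel. u x * (LINT t|lborel. indicator {t. 0 < s * (t - c) \<and> 0 < s * (x - t)} t * k t)) =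
      (LINT t|lborel. indicator {t. 0 < s * (t - c)} t * k t * (LINT x|lborel. indicator {x. 0 < s * (x - t)} x * u x))"
    unfolding 1 2 by simp
  show "integrable lborel (\<lambda>x. u x * (LINT t|lborel. indicator {t. 0 < s * (t - c) \<and> 0 < s * (x - t)} t * k t))"
    using lborel_pair.integrable_fst[OF int] unfolding 1 .
  show "integrable lborel (\<lambda>t. indicator {t. 0 < s * (t - c)} t * k t * (LINT x|lborel. indicator {x. 0 < s * (x - t)} x * u x))"
    using lborel_pair.integrable_snd[OF int] unfolding 2 .
qed

section \<open>Weighted inner products and square-integrability\<close>

definition wip :: "(real \<Rightarrow> real) \<Rightarrow> (real \<Rightarrow> real) \<Rightarrow> (real \<Rightarrow> real) \<Rightarrow> real" where
  "wip w h k = (LINT x|lborel. w x * (h x * k x))"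

definition wL2 :: "(real \<Rightarrow> real) \<Rightarrow> (real \<Rightarrow> real) \<Rightarrow> bool" where
  "wL2 w h \<longleftrightarrow> h \<in> borel_measurable borel \<and> integrable lborel (\<lambda>x. w x * (h x)\<^sup>2)"

lemma wip_commute: "wip w h k = wip w k h"
  by (simp add: wip_def mult.commute)

lemma wip_self: "wip w h h = (LINT x|lborel. w x * (h x)\<^sup>2)"
  by (simp add: wip_def power2_eq_square)

lemma wL2_integrable:
  assumes [measurable]: "w \<in> borel_measurable borel" and w: "\<And>x. 0 \<le> w x"
    and h: "wL2 w h" and k: "wL2 w k"
  shows "integrable lborel (\<lambda>x. w x * (h x * k x))"
proof (rule Bochner_Integration.integrable_bound)
  show "integrable lborel (\<lambda>x. w x * (h x)\<^sup>2 + w x * (k x)\<^sup>2)"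
    using h k by (intro Bochner_Integration.integrable_add) (auto simp: wL2_def)
  have [measurable]: "h \<in> borel_measurable borel" "k \<in> borel_measurable borel"
    using h k by (auto simp: wL2_def)
  show "(\<lambda>x. w x * (h x * k x)) \<in> borel_measurable lborel" by measurable
  have "\<bar>w x * (h x * k x)\<bar> \<le> w x * (h x)\<^sup>2 + w x * (k x)\<^sup>2" for x
  proof -
    have "0 \<le> (\<bar>h x\<bar> - \<bar>k x\<bar>)\<^sup>2 + (\<bar>h x\<bar>)\<^sup>2 + (\<bar>k x\<bar>)\<^sup>2" by simp
    hence "\<bar>h x * k x\<bar> \<le> (h x)\<^sup>2 + (k x)\<^sup>2"
      by (simp add: power2_diff abs_mult)
    from mult_left_mono[OF this w[of x]] show ?thesis
      by (simp add: abs_mult w distrib_left)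
  qed
  thus "AE x in lborel. norm (w x * (h x * k x)) \<le> norm (w x * (h x)\<^sup>2 + w x * (k x)\<^sup>2)"
    using w by (intro AE_I2) (auto intro: order_trans[OF _ abs_ge_self])
qed

lemma wL2_diff:
  assumes [measurable]: "w \<in> borel_measurable borel" and w: "\<And>x. 0 \<le> w x"
    and h: "wL2 w h" and k: "wL2 w k"
  shows "wL2 w (\<lambda>x. h x - k x)"
    and "wip w (\<lambda>x. h x - k x) (\<lambda>x. h x - k x) = wip w h h - 2 * wip w h k + wip w k k"
proof -
  note i = wL2_integrable[OF assms(1) w h h] wL2_integrable[OF assms(1) w h k] wL2_integrable[OF assms(1) w k k]
  have eq: "w x * (h x - k x)\<^sup>2 = w x * (h x * h x) - 2 * (w x * (h x * k x)) + w x * (k x * k x)" for x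
    by (simp add: power2_eq_square algebra_simps)
  show "wL2 w (\<lambda>x. h x - k x)"
    using i h k unfolding wL2_def eq by auto
  show "wip w (\<lambda>x. h x - k x) (\<lambda>x. h x - k x) = wip w h h - 2 * wip w h k + wip w k k"
    unfolding wip_self[of w "\<lambda>x. h x - k x"] eq using i by (simp add: wip_def)
qed

context pearson_weight
begin

abbreviation "qw \<equiv> (\<lambda>x. poly q x * w x)"

lemma qw_measurable [measurable]: "qw \<in> borel_measurable borel"
  by measurable

lemma wL2_poly: "wL2 w (poly p)"
  using integrable_poly[of "p * p"] by (auto simp: wL2_def power2_eq_square mult_ac)

lemma wL2_qw_poly: "wL2 qw (poly p)"
proof -
  have "(\<lambda>x. qw x * (poly p x)\<^sup>2) = (\<lambda>x. poly (q * (p * p)) x * w x)"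
    by (simp add: fun_eq_iff power2_eq_square algebra_simps)
  thus ?thesis using integrable_poly[of "q * (p * p)"] by (simp only: wL2_def poly_borel simp_thms)
qed

text \<open>The inequality for the eigenpolynomial d - a x, whose eigenvalue is a: once the value of
  h at the single zero d / a is subtracted, finite energy of h' bounds h. Thus only the top
  derivative needs an integrability assumption.\<close>

lemma primitive_on_wL2:
  assumes h: "primitive_on J h h'" and h': "wL2 qw h'"
  shows "wL2 w h"
proof -
  note [measurable] = primitive_onD(1,2)[OF h]
  define k where "k = h (d / a)"
  have "(\<integral>\<^sup>+x. ennreal (w x * (h x - poly [:k:] x)\<^sup>2) \<partial>lborel)
    \<le> ennreal (1 / a) * (\<integral>\<^sup>+x. ennreal (qw x * (h' x - poly (pderiv [:k:]) x)\<^sup>2) \<partial>lborel)"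
  proof (rule nn_integral_le_of_zero_at_roots)
    show "L [:d, - a:] = smult a [:d, - a:]" by (simp add: sl_op_def pderiv_pCons)
    show "primitive_on J (\<lambda>x. h x - poly [:k:] x) (\<lambda>x. h' x - poly (pderiv [:k:]) x)"
      by (intro primitive_on_diff h primitive_on_poly)
  next
    fix z assume "poly [:d, - a:] z = 0"
    hence "z = d / a" using a_pos by (simp add: field_simps)
    thus "h z - poly [:k:] z = 0" by (simp add: k_def)
  qed (use a_pos in auto)
  also have "\<dots> < \<infinity>"
  proof -
    have "norm (qw x * (h' x)\<^sup>2) = qw x * (h' x)\<^sup>2" for x
      using mult_nonneg_nonneg[OF qw_nonneg[of x] zero_le_power2[of "h' x"]]
      by (simp only: real_norm_def abs_of_nonneg)
    hence "(\<integral>\<^sup>+x. ennreal (qw x * (h' x)\<^sup>2) \<partial>lborel) < \<infinity>"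
      using h' unfolding wL2_def integrable_iff_bounded by (simp only: simp_thms)
    moreover have "poly (pderiv [:k:]) x = 0" for x by (simp add: pderiv_pCons)
    ultimately show ?thesis by (simp only: diff_zero ennreal_mult_less_top infinity_ennreal_def) simp
  qed
  finally have "integrable lborel (\<lambda>x. w x * (h x - k)\<^sup>2)"
    by (intro integrableI_bounded) (auto simp: w_nonneg)
  hence "wL2 w (\<lambda>x. h x - k)" by (simp add: wL2_def)
  from wL2_diff(1)[OF w_measurable w_nonneg this wL2_poly[of "[:- k:]"]] show ?thesis by simp
qed

text \<open>The boundary terms of the two half-lines at a common point t cancel.\<close>

lemma integral_L_eq_0: "(LINT x|lborel. poly (L p) x * w x) = 0"
proof -
  obtain t where t: "t \<in> J" using J_nonempty by auto
  have "(LINT x|lborel. poly (L p) x * w x) =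
    (LINT x|lborel. indicator {x. 0 < 1 * (x - t)} x * (poly (L p) x * w x) + indicator {x. 0 < - 1 * (x - t)} x * (poly (L p) x * w x))"
  proof (rule integral_cong_AE)
    show "AE x in lborel. poly (L p) x * w x =
      indicator {x. 0 < 1 * (x - t)} x * (poly (L p) x * w x) + indicator {x. 0 < - 1 * (x - t)} x * (poly (L p) x * w x)"
      using AE_lborel_singleton[of t] by eventually_elim (auto simp: indicator_def)
  qed measurable
  also have "\<dots> = (LINT x|lborel. indicator {x. 0 < 1 * (x - t)} x * (poly (L p) x * w x))
    + (LINT x|lborel. indicator {x. 0 < - 1 * (x - t)} x * (poly (L p) x * w x))"
    by (intro Bochner_Integration.integral_add integrable_indicator_poly) measurable
  also have "\<dots> = 0" using tail_L[of 1 t p] tail_L[of "-1" t p] t by simp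
  finally show ?thesis .
qed

text \<open>Fubini, applied separately on both sides of a base point; absolute integrability holds
  because a primitive of \<open>\<bar>h'\<bar>\<close> is again square-integrable.\<close>
lemma integration_by_parts:
  assumes h: "primitive_on J h h'" and h': "wL2 qw h'"
  shows "wip qw h' (poly (pderiv p)) = wip w h (poly (L p))"
proof -
  note [measurable] = primitive_onD(1,2)[OF h]
  obtain e where e: "e \<in> J" using J_nonempty by auto
  obtain H where H: "primitive_on J H (\<lambda>t. \<bar>h' t\<bar>)"
    using primitive_on_abs[OF h interval_J J_nonempty] .
  note [measurable] = primitive_onD(1)[OF H]
  have HL: "wL2 w H"
    by (rule primitive_on_wL2[OF H]) (use h' in \<open>auto simp: wL2_def\<close>)
  have hL: "wL2 w h" by (rule primitive_on_wL2[OF h h'])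
  define u where "u x = poly (L p) x * w x" for x
  \<comment> \<open>Outside J nothing is known about h'; inside, the interval between e and x stays
    in J, so the cut changes nothing.\<close>
  define k where "k t = indicator J t * h' t" for t
  have [measurable]: "u \<in> borel_measurable borel" "k \<in> borel_measurable borel"
    unfolding u_def k_def by measurable
  have u0: "u x = 0" if "x \<notin> J" for x using that by (simp add: u_def w_zero)
  let ?B = "\<lambda>s x. {t. 0 < s * (t - e) \<and> 0 < s * (x - t)}"
  have kB: "indicator (?B s x) t * k t = indicator (?B s x) t * h' t"
    if "x \<in> J" and s: "s = 1 \<or> s = -1" for s x t
    using that e mem_J[of e x t] mem_J[of x e t] by (auto simp: k_def indicator_def)
  have fin: "(\<integral>\<^sup>+x. ennreal \<bar>u x\<bar> * (\<integral>\<^sup>+t. ennreal (indicator (?B s x) t * \<bar>k t\<bar>) \<partial>lborel) \<partial>lborel) < \<infinity>"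
    if s: "s = 1 \<or> s = -1" for s
  proof -
    have "(\<integral>\<^sup>+x. ennreal \<bar>u x\<bar> * (\<integral>\<^sup>+t. ennreal (indicator (?B s x) t * \<bar>k t\<bar>) \<partial>lborel) \<partial>lborel)
      \<le> (\<integral>\<^sup>+x. ennreal (norm (w x * (poly (L p) x * (H x - H e)))) \<partial>lborel)"
    proof (intro nn_integral_mono)
      fix x
      show "ennreal \<bar>u x\<bar> * (\<integral>\<^sup>+t. ennreal (indicator (?B s x) t * \<bar>k t\<bar>) \<partial>lborel)
        \<le> ennreal (norm (w x * (poly (L p) x * (H x - H e))))"
      proof (cases "x \<in> J \<and> 0 < s * (x - e)")
        case True
        note Hb = primitive_on_between[OF H s e, of x]
        have eq: "indicator (?B s x) t * \<bar>k t\<bar> = indicator (?B s x) t * \<bar>h' t\<bar>" for t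
          using kB[OF _ s, of x t] True by (auto simp: indicator_def)
        have "(\<integral>\<^sup>+t. ennreal (indicator (?B s x) t * \<bar>k t\<bar>) \<partial>lborel) = ennreal (s * (H x - H e))"
          unfolding eq using Hb True by (subst nn_integral_eq_integral) auto
        also have "s * (H x - H e) \<le> \<bar>H x - H e\<bar>" using s by auto
        finally have "(\<integral>\<^sup>+t. ennreal (indicator (?B s x) t * \<bar>k t\<bar>) \<partial>lborel) \<le> ennreal \<bar>H x - H e\<bar>"
          by (simp add: ennreal_leI)
        from mult_left_mono[OF this, of "ennreal \<bar>u x\<bar>"] show ?thesis
          by (simp add: u_def abs_mult w_nonneg ennreal_mult mult_ac)
      next
        case False
        hence "x \<notin> J \<or> ?B s x = {}" using s by auto
        thus ?thesis by (auto simp: u0)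
      qed
    qed
    also have "\<dots> < \<infinity>"
    proof -
      have "wL2 w (\<lambda>x. H x - poly [:H e:] x)"
        by (rule wL2_diff[OF w_measurable w_nonneg HL wL2_poly])
      from wL2_integrable[OF w_measurable w_nonneg wL2_poly[of "L p"] this]
      show ?thesis by (simp add: integrable_iff_bounded)
    qed
    finally show ?thesis .
  qed
  have part: "(LINT x|lborel. indicator {x. 0 < s * (x - e)} x * (u x * (h x - h e))) =
      (LINT t|lborel. indicator {t. 0 < s * (t - e)} t * (qw t * (h' t * poly (pderiv p) t)))
    \<and> integrable lborel (\<lambda>x. indicator {x. 0 < s * (x - e)} x * (u x * (h x - h e)))
    \<and> integrable lborel (\<lambda>t. indicator {t. 0 < s * (t - e)} t * (qw t * (h' t * poly (pderiv p) t)))"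
    if s: "s = 1 \<or> s = -1" for s
  proof -
    have 1: "u x * (LINT t|lborel. indicator (?B s x) t * k t) = s * (indicator {x. 0 < s * (x - e)} x * (u x * (h x - h e)))" for x
    proof (cases "x \<in> J \<and> 0 < s * (x - e)")
      case True
      hence eq: "indicator (?B s x) t * k t = indicator (?B s x) t * h' t" for t
        using kB[OF _ s] by blast
      show ?thesis unfolding eq using primitive_on_between(2)[OF h s e, of x] True by simp
    next
      case False
      hence "x \<notin> J \<or> ?B s x = {} \<and> \<not> 0 < s * (x - e)" using s by auto
      thus ?thesis by (auto simp: u0)
    qed
    have 2: "indicator {t. 0 < s * (t - e)} t * k t * (LINT x|lborel. indicator {x. 0 < s * (x - t)} x * u x)
      = s * (indicator {t. 0 < s * (t - e)} t * (qw t * (h' t * poly (pderiv p) t)))" for t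
    proof (cases "t \<in> J")
      case True
      thus ?thesis using tail_L[OF s True, of p] by (simp add: u_def k_def mult_ac)
    qed (simp add: k_def w_zero)
    have ss: "s * s = 1" "s \<noteq> 0" using s by auto
    note F = fubini_signed[OF _ _ fin[OF s]]
    show ?thesis
    proof (intro conjI)
      have "s * (LINT x|lborel. indicator {x. 0 < s * (x - e)} x * (u x * (h x - h e))) =
        s * (LINT t|lborel. indicator {t. 0 < s * (t - e)} t * (qw t * (h' t * poly (pderiv p) t)))"
        using F(1) unfolding 1 2 by simp
      thus "(LINT x|lborel. indicator {x. 0 < s * (x - e)} x * (u x * (h x - h e))) =
        (LINT t|lborel. indicator {t. 0 < s * (t - e)} t * (qw t * (h' t * poly (pderiv p) t)))"
        using ss by simp
    qed (use F(2,3) ss in \<open>simp_all only: 1 2 integrable_mult_right_iff measurable_lborel1 \<open>u \<in> _\<close> \<open>k \<in> _\<close>, simp_all\<close>)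
  qed
  have split: "(LINT x|lborel. f x) = (LINT x|lborel. indicator {x. 0 < 1 * (x - e)} x * f x) + (LINT x|lborel. indicator {x. 0 < - 1 * (x - e)} x * f x)"
    if [measurable]: "f \<in> borel_measurable borel" and i: "integrable lborel (\<lambda>x. indicator {x. 0 < 1 * (x - e)} x * f x)"
      "integrable lborel (\<lambda>x. indicator {x. 0 < - 1 * (x - e)} x * f x)" for f :: "real \<Rightarrow> real"
  proof (subst Bochner_Integration.integral_add[OF i, symmetric], rule integral_cong_AE)
    show "AE x in lborel. f x = indicator {x. 0 < 1 * (x - e)} x * f x + indicator {x. 0 < - 1 * (x - e)} x * f x"
      using AE_lborel_singleton[of e] by eventually_elim (auto simp: indicator_def)
  qed measurable
  have "wip qw h' (poly (pderiv p)) = (LINT x|lborel. u x * (h x - h e))"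
    unfolding wip_def using part[of 1] part[of "-1"] by (subst (1 2) split) auto
  \<comment> \<open>The base value h e drops out, because L p has weighted integral 0.\<close>
  also have "\<dots> = (LINT x|lborel. w x * (h x * poly (L p) x) - h e * u x)"
    by (intro Bochner_Integration.integral_cong) (auto simp: u_def algebra_simps)
  also have "\<dots> = wip w h (poly (L p)) - h e * (LINT x|lborel. u x)"
    unfolding wip_def
    using wL2_integrable[OF w_measurable w_nonneg hL wL2_poly[of "L p"]] integrable_poly[of "L p"]
    by (subst Bochner_Integration.integral_diff) (auto simp: u_def[abs_def])
  finally show ?thesis using integral_L_eq_0[of p] by (simp add: u_def)
qed

end

subsection \<open>The spectral gap\<close>

context pearson_weight
begin

abbreviation "ev \<equiv> sl_ev a \<delta>"

lemma ev_less: "i < j \<Longrightarrow> ev i < ev j"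
  using sl_ev_less[OF a_pos \<delta>_nonpos] .

lemma wip_cong_J:
  assumes [measurable]: "h \<in> borel_measurable borel" "h' \<in> borel_measurable borel"
      "k \<in> borel_measurable borel" "k' \<in> borel_measurable borel"
    and "AE x in lborel. x \<in> J \<longrightarrow> h x = h' x" "AE x in lborel. x \<in> J \<longrightarrow> k x = k' x"
  shows "wip w h k = wip w h' k'" "wip qw h k = wip qw h' k'"
proof -
  have "AE x in lborel. w x * (h x * k x) = w x * (h' x * k' x)"
    using assms(5,6) by eventually_elim (use w_zero in auto)
  thus "wip w h k = wip w h' k'" unfolding wip_def by (intro integral_cong_AE) auto
  have "AE x in lborel. qw x * (h x * k x) = qw x * (h' x * k' x)"
    using assms(5,6) by eventually_elim (use w_zero in auto)
  thus "wip qw h k = wip qw h' k'" unfolding wip_def by (intro integral_cong_AE) auto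
qed

lemma wip_poly_sum:
  assumes h: "wL2 w h"
  shows "wip w h (poly (\<Sum>i\<in>I. smult (e i) (\<phi> i))) = (\<Sum>i\<in>I. e i * wip w h (poly (\<phi> i)))"
proof -
  have "wip w h (poly (\<Sum>i\<in>I. smult (e i) (\<phi> i))) = (LINT x|lborel. (\<Sum>i\<in>I. e i * (w x * (h x * poly (\<phi> i) x))))"
    unfolding wip_def
    by (intro Bochner_Integration.integral_cong) (auto simp: poly_sum sum_distrib_left mult_ac)
  also have "\<dots> = (\<Sum>i\<in>I. e i * wip w h (poly (\<phi> i)))"
    unfolding wip_def
    by (subst Bochner_Integration.integral_sum)
      (auto intro!: integrable_mult_right wL2_integrable h wL2_poly w_nonneg)
  finally show ?thesis .
qed

text \<open>Both sides equal the integral of q w p' r'.\<close>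

lemma L_symmetric: "wip w (poly p) (poly (L r)) = wip w (poly r) (poly (L p))"
  using integration_by_parts[OF primitive_on_poly wL2_qw_poly, of p r]
    integration_by_parts[OF primitive_on_poly wL2_qw_poly, of r p]
  by (metis wip_commute)

lemma wip_smult_right: "wip w h (poly (smult k p)) = k * wip w h (poly p)"
  by (simp add: wip_def mult.left_commute)

lemma emeasure_J_pos: "emeasure lborel J \<noteq> 0"
  using open_not_negligible[OF open_J J_nonempty] by (auto simp: negligible_iff_null_sets null_sets_def)

lemma integral_weight_pos:
  assumes "\<And>x. x \<in> J \<Longrightarrow> 0 < poly p x"
  shows "0 < (LINT x|lborel. poly p x * w x)"
proof -
  have nn: "0 \<le> poly p x * w x" for x
    using assms[of x] w_pos[of x] w_zero[of x] by (cases "x \<in> J") auto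
  have "(LINT x|lborel. poly p x * w x) \<noteq> 0"
  proof
    assume "(LINT x|lborel. poly p x * w x) = 0"
    hence "AE x in lborel. poly p x * w x = 0"
      using integral_nonneg_eq_0_iff_AE[OF integrable_poly[of p]] nn by simp
    hence "AE x in lborel. x \<notin> J"
      by eventually_elim (use assms w_pos in fastforce)
    hence "J \<in> null_sets lborel" by (subst AE_iff_null_sets) auto
    thus False using emeasure_J_pos by auto
  qed
  moreover have "0 \<le> (LINT x|lborel. poly p x * w x)" using nn by (intro Bochner_Integration.integral_nonneg)
  ultimately show ?thesis by simp
qed

lemma wip_poly_self_pos:
  assumes "p \<noteq> 0"
  shows "0 < wip w (poly p) (poly p)"
proof -
  have nn: "0 \<le> w x * (poly p x)\<^sup>2" for x by (simp add: w_nonneg)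
  have i: "integrable lborel (\<lambda>x. w x * (poly p x)\<^sup>2)" using wL2_poly[of p] by (simp add: wL2_def)
  have "wip w (poly p) (poly p) \<noteq> 0"
  proof
    assume "wip w (poly p) (poly p) = 0"
    hence "AE x in lborel. w x * (poly p x)\<^sup>2 = 0"
      unfolding wip_self using integral_nonneg_eq_0_iff_AE[OF i] nn by simp
    moreover have "AE x in lborel. x \<notin> {x. poly p x = 0}"
      by (intro AE_not_in finite_imp_null_set_lborel poly_roots_finite assms)
    ultimately have "AE x in lborel. x \<notin> J"
      by eventually_elim (use w_pos in fastforce)
    hence "J \<in> null_sets lborel" by (subst AE_iff_null_sets) auto
    thus False using emeasure_J_pos by auto
  qed
  moreover have "0 \<le> wip w (poly p) (poly p)" unfolding wip_self using nn by (intro Bochner_Integration.integral_nonneg)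
  ultimately show ?thesis by simp
qed

section \<open>Orthonormal eigenpolynomials and expansions\<close>

definition orthonormal_eigenpolys :: "(nat \<Rightarrow> real poly) \<Rightarrow> bool" where
  "orthonormal_eigenpolys \<phi> \<longleftrightarrow> (\<forall>i. degree (\<phi> i) = i \<and> \<phi> i \<noteq> 0 \<and> L (\<phi> i) = smult (ev i) (\<phi> i)) \<and>
     (\<forall>i j. wip w (poly (\<phi> i)) (poly (\<phi> j)) = (if i = j then 1 else 0))"

text \<open>The eigenvalues are distinct and L is symmetric, so eigenpolynomials of different
  degrees are orthogonal; only normalisation remains.\<close>

lemma ex_orthonormal_eigenpolys: "\<exists>\<phi>. orthonormal_eigenpolys \<phi>"
proof -
  have "\<exists>\<phi>. \<forall>m. degree (\<phi> m) = m \<and> \<phi> m \<noteq> 0 \<and> L (\<phi> m) = smult (ev m) (\<phi> m)"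
    using sl_op_eigenpoly[OF a_pos \<delta>_nonpos] by (intro choice) blast
  then obtain \<psi> where \<psi>: "\<And>m. degree (\<psi> m) = m" "\<And>m. \<psi> m \<noteq> 0" "\<And>m. L (\<psi> m) = smult (ev m) (\<psi> m)"
    by blast
  define n where "n m = sqrt (wip w (poly (\<psi> m)) (poly (\<psi> m)))" for m
  have n: "n m > 0" for m using wip_poly_self_pos[OF \<psi>(2)] by (simp add: n_def)
  define \<phi> where "\<phi> m = smult (1 / n m) (\<psi> m)" for m
  have wip: "wip w (poly (\<phi> i)) (poly (\<phi> j)) = wip w (poly (\<psi> i)) (poly (\<psi> j)) / (n i * n j)" for i j
    unfolding \<phi>_def by (simp add: wip_smult_right wip_commute[of w "poly (smult _ _)"] wip_commute[of w "poly (\<psi> j)"])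
  have orth: "wip w (poly (\<psi> i)) (poly (\<psi> j)) = 0" if "i \<noteq> j" for i j
  proof -
    have "ev j * wip w (poly (\<psi> i)) (poly (\<psi> j)) = ev i * wip w (poly (\<psi> i)) (poly (\<psi> j))"
      using L_symmetric[of "\<psi> i" "\<psi> j"] by (simp add: \<psi> wip_smult_right wip_commute[of w "poly (\<psi> j)"])
    moreover have "ev i \<noteq> ev j" using that ev_less[of i j] ev_less[of j i] by (cases i j rule: linorder_cases) auto
    ultimately show ?thesis by simp
  qed
  have "n m * n m = wip w (poly (\<psi> m)) (poly (\<psi> m))" for m
    using wip_poly_self_pos[OF \<psi>(2)[of m]] by (simp add: n_def)
  hence "wip w (poly (\<phi> m)) (poly (\<phi> m)) = 1" for m
    using wip_poly_self_pos[OF \<psi>(2)[of m]] by (simp add: wip)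
  hence "wip w (poly (\<phi> i)) (poly (\<phi> j)) = (if i = j then 1 else 0)" for i j
    using orth[of i j] wip[of i j] by (cases "i = j") auto
  moreover have "degree (\<phi> i) = i" "\<phi> i \<noteq> 0" "L (\<phi> i) = smult (ev i) (\<phi> i)" for i
    using n[of i] \<psi>[of i] by (auto simp: \<phi>_def sl_op_smult mult.commute)
  ultimately have "orthonormal_eigenpolys \<phi>"
    unfolding orthonormal_eigenpolys_def by blast
  thus ?thesis by blast
qed

lemma eigenpoly_expansion:
  assumes \<phi>: "orthonormal_eigenpolys \<phi>" and "degree p \<le> m"
  shows "\<exists>e. p = (\<Sum>i\<le>m. smult (e i) (\<phi> i))"
  using assms(2)
proof (induction m arbitrary: p)
  case 0
  have "degree (\<phi> 0) = 0" "\<phi> 0 \<noteq> 0" using \<phi> by (auto simp: orthonormal_eigenpolys_def)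
  then obtain k where k: "\<phi> 0 = [:k:]" "k \<noteq> 0" by (metis degree_eq_zeroE pCons_0_0)
  obtain j where "p = [:j:]" using 0 by (metis degree_eq_zeroE le_zero_eq)
  thus ?case using k by (intro exI[of _ "\<lambda>_. j / k"]) simp
next
  case (Suc m)
  have d: "degree (\<phi> (Suc m)) = Suc m" "\<phi> (Suc m) \<noteq> 0" using \<phi> by (auto simp: orthonormal_eigenpolys_def)
  hence lc: "coeff (\<phi> (Suc m)) (Suc m) \<noteq> 0" by (metis leading_coeff_0_iff)
  define k where "k = coeff p (Suc m) / coeff (\<phi> (Suc m)) (Suc m)"
  let ?r = "p - smult k (\<phi> (Suc m))"
  have "degree ?r \<le> Suc m" using Suc.prems d by (intro degree_diff_le) auto
  moreover have "coeff ?r (Suc m) = 0" using lc by (simp add: k_def)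
  ultimately have "degree ?r \<le> m"
    by (metis le_Suc_eq leading_coeff_0_iff degree_0 zero_le)
  from Suc.IH[OF this] obtain e where e: "?r = (\<Sum>i\<le>m. smult (e i) (\<phi> i))" by blast
  have "p = ?r + smult k (\<phi> (Suc m))" by simp
  also have "\<dots> = (\<Sum>i\<le>Suc m. smult ((e(Suc m := k)) i) (\<phi> i))"
    unfolding e by simp
  finally show ?case by blast
qed

lemma wip_expansion:
  assumes \<phi>: "orthonormal_eigenpolys \<phi>" and p: "p = (\<Sum>i\<le>m. smult (e i) (\<phi> i))" and h: "wL2 w h"
  shows "wip w h (poly p) = (\<Sum>i\<le>m. e i * wip w h (poly (\<phi> i)))"
    and "wip w h (poly (L p)) = (\<Sum>i\<le>m. ev i * e i * wip w h (poly (\<phi> i)))"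
    and "i \<le> m \<Longrightarrow> wip w (poly p) (poly (\<phi> i)) = e i"
proof -
  have 1: "wip w h (poly p) = (\<Sum>i\<le>m. e i * wip w h (poly (\<phi> i)))" if "wL2 w h" for h
    unfolding p by (rule wip_poly_sum[OF that])
  show "wip w h (poly p) = (\<Sum>i\<le>m. e i * wip w h (poly (\<phi> i)))" by (rule 1[OF h])
  have "L p = (\<Sum>i\<le>m. smult (ev i * e i) (\<phi> i))"
    unfolding p sl_op_sum using \<phi>
    by (intro sum.cong) (auto simp: orthonormal_eigenpolys_def sl_op_smult mult.commute)
  thus "wip w h (poly (L p)) = (\<Sum>i\<le>m. ev i * e i * wip w h (poly (\<phi> i)))"
    by (simp add: wip_poly_sum[OF h])
  assume i: "i \<le> m"
  have "wip w (poly p) (poly (\<phi> i)) = (\<Sum>j\<le>m. e j * wip w (poly (\<phi> i)) (poly (\<phi> j)))"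
    by (subst wip_commute) (rule 1[OF wL2_poly])
  also have "\<dots> = (\<Sum>j\<le>m. if j = i then e j else 0)"
    using \<phi> by (intro sum.cong) (auto simp: orthonormal_eigenpolys_def)
  also have "\<dots> = e i" using i by simp
  finally show "wip w (poly p) (poly (\<phi> i)) = e i" .
qed

text \<open>Subtracting a polynomial \<open>p\<close> of degree at most \<open>m\<close> that interpolates \<open>h\<close> at the zeros of the
  next eigenpolynomial makes \<open>nn_integral_le_of_zero_at_roots\<close> applicable. What \<open>p\<close> contributes has
  the favourable sign, so \<open>p\<close> need not be the orthogonal projection of \<open>h\<close>.\<close>
lemma spectral_gap:
  assumes \<phi>: "orthonormal_eigenpolys \<phi>" and h: "primitive_on J h h'" and h': "wL2 qw h'"
  shows "ev (Suc m) * wip w h h + (\<Sum>i\<le>m. (ev i - ev (Suc m)) * (wip w h (poly (\<phi> i)))\<^sup>2) \<le> wip qw h' h'"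
proof -
  define l where "l = ev (Suc m)"
  have l: "l > 0" unfolding l_def by (rule sl_ev_pos[OF a_pos \<delta>_nonpos]) simp
  have f: "\<phi> (Suc m) \<noteq> 0" "degree (\<phi> (Suc m)) = Suc m" "L (\<phi> (Suc m)) = smult l (\<phi> (Suc m))"
    using \<phi> by (auto simp: orthonormal_eigenpolys_def l_def)
  have hL: "wL2 w h" by (rule primitive_on_wL2[OF h h'])
  \<comment> \<open>The eigenpolynomial has at most m + 1 zeros, so degree m suffices to interpolate
    at all of them.\<close>
  obtain p where p: "degree p \<le> m" "\<And>z. poly (\<phi> (Suc m)) z = 0 \<Longrightarrow> poly p z = h z"
    using poly_interpolation[of "{z. poly (\<phi> (Suc m)) z = 0}" m h] poly_roots_finite[OF f(1)]
      card_poly_roots_bound[OF f(1)] f(2) by auto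
  obtain e where e: "p = (\<Sum>i\<le>m. smult (e i) (\<phi> i))" using eigenpoly_expansion[OF \<phi> p(1)] ..
  define b where "b i = wip w h (poly (\<phi> i))" for i
  note X = wip_expansion[OF \<phi> e]
  have k: "primitive_on J (\<lambda>x. h x - poly p x) (\<lambda>x. h' x - poly (pderiv p) x)"
    by (intro primitive_on_diff h primitive_on_poly)
  have D: "wL2 w (\<lambda>x. h x - poly p x)"
    "wip w (\<lambda>x. h x - poly p x) (\<lambda>x. h x - poly p x) = wip w h h - 2 * wip w h (poly p) + wip w (poly p) (poly p)"
    by (intro wL2_diff hL wL2_poly w_measurable w_nonneg)+
  have D': "wL2 qw (\<lambda>x. h' x - poly (pderiv p) x)"
    "wip qw (\<lambda>x. h' x - poly (pderiv p) x) (\<lambda>x. h' x - poly (pderiv p) x)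
      = wip qw h' h' - 2 * wip qw h' (poly (pderiv p)) + wip qw (poly (pderiv p)) (poly (pderiv p))"
    by (intro wL2_diff h' wL2_qw_poly qw_measurable qw_nonneg)+
  have "(\<integral>\<^sup>+x. ennreal (w x * (h x - poly p x)\<^sup>2) \<partial>lborel)
    \<le> ennreal (1 / l) * (\<integral>\<^sup>+x. ennreal (qw x * (h' x - poly (pderiv p) x)\<^sup>2) \<partial>lborel)"
    by (rule nn_integral_le_of_zero_at_roots[OF f(3) l f(1) k]) (simp add: p(2))
  also have "(\<integral>\<^sup>+x. ennreal (w x * (h x - poly p x)\<^sup>2) \<partial>lborel) = ennreal (wip w (\<lambda>x. h x - poly p x) (\<lambda>x. h x - poly p x))"
    unfolding wip_self using D(1) by (intro nn_integral_eq_integral) (auto simp: wL2_def w_nonneg)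
  also have "(\<integral>\<^sup>+x. ennreal (qw x * (h' x - poly (pderiv p) x)\<^sup>2) \<partial>lborel) =
      ennreal (wip qw (\<lambda>x. h' x - poly (pderiv p) x) (\<lambda>x. h' x - poly (pderiv p) x))"
    unfolding wip_self using D'(1)
    by (intro nn_integral_eq_integral AE_I2 mult_nonneg_nonneg qw_nonneg zero_le_power2) (simp add: wL2_def)
  also have "ennreal (1 / l) * \<dots> = ennreal (1 / l * wip qw (\<lambda>x. h' x - poly (pderiv p) x) (\<lambda>x. h' x - poly (pderiv p) x))"
    using l by (intro ennreal_mult'[symmetric]) simp
  finally have "wip w (\<lambda>x. h x - poly p x) (\<lambda>x. h x - poly p x)
      \<le> 1 / l * wip qw (\<lambda>x. h' x - poly (pderiv p) x) (\<lambda>x. h' x - poly (pderiv p) x)"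
  proof (subst (asm) ennreal_le_iff)
    show "0 \<le> 1 / l * wip qw (\<lambda>x. h' x - poly (pderiv p) x) (\<lambda>x. h' x - poly (pderiv p) x)"
      unfolding wip_self using l
      by (intro mult_nonneg_nonneg Bochner_Integration.integral_nonneg qw_nonneg zero_le_power2) simp
  qed
  hence "l * wip w (\<lambda>x. h x - poly p x) (\<lambda>x. h x - poly p x)
      \<le> wip qw (\<lambda>x. h' x - poly (pderiv p) x) (\<lambda>x. h' x - poly (pderiv p) x)"
    using l by (simp add: field_simps)
  hence "l * (wip w h h - 2 * (\<Sum>i\<le>m. e i * b i) + (\<Sum>i\<le>m. e i * e i))
    \<le> wip qw h' h' - 2 * (\<Sum>i\<le>m. ev i * e i * b i) + (\<Sum>i\<le>m. ev i * e i * e i)"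
    unfolding D D' integration_by_parts[OF h h'] integration_by_parts[OF primitive_on_poly wL2_qw_poly]
      X(1,2)[OF hL] X(1,2)[OF wL2_poly[of p]] b_def[symmetric]
    by (simp add: X(3)[OF wL2_poly])
  hence "l * wip w h h \<le> wip qw h' h' + (\<Sum>i\<le>m. (l - ev i) * (2 * (e i * b i) - e i * e i))"
    by (simp add: sum_subtractf sum.distrib sum_distrib_left algebra_simps)
  \<comment> \<open>Completing the square: 2 e b - e^2 is at most b^2, with equality when e is the
    Fourier coefficient b of h. The factor l - ev i is positive because i \<le> m.\<close>
  also have "(\<Sum>i\<le>m. (l - ev i) * (2 * (e i * b i) - e i * e i)) \<le> (\<Sum>i\<le>m. (l - ev i) * (b i)\<^sup>2)"
  proof (intro sum_mono mult_left_mono)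
    fix i assume "i \<in> {..m}"
    thus "0 \<le> l - ev i" using ev_less[of i "Suc m"] by (simp add: l_def)
    have "0 \<le> (e i - b i)\<^sup>2" by simp
    thus "2 * (e i * b i) - e i * e i \<le> (b i)\<^sup>2" by (simp add: power2_eq_square algebra_simps)
  qed
  finally show ?thesis
    by (simp add: l_def b_def sum_subtractf left_diff_distrib)
qed

text \<open>The mode of degree m + 1 contributes \<open>ev (Suc m)\<close> times its squared
  coefficient to both sides, so equality reaches up to degree m + 1. This is the origin of the
  degree bounds in the equality cases.\<close>

lemma spectral_gap_eq:
  assumes \<phi>: "orthonormal_eigenpolys \<phi>" and p: "degree p \<le> Suc m"
  shows "ev (Suc m) * wip w (poly p) (poly p)
      + (\<Sum>i\<le>m. (ev i - ev (Suc m)) * (wip w (poly p) (poly (\<phi> i)))\<^sup>2)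
    = wip qw (poly (pderiv p)) (poly (pderiv p))"
proof -
  obtain e where e: "p = (\<Sum>i\<le>Suc m. smult (e i) (\<phi> i))" using eigenpoly_expansion[OF \<phi> p] ..
  note X = wip_expansion[OF \<phi> e wL2_poly[of p]]
  have "wip w (poly p) (poly p) = (\<Sum>i\<le>Suc m. e i * e i)"
    unfolding X(1) by (intro sum.cong) (auto simp: X(3))
  moreover have "wip qw (poly (pderiv p)) (poly (pderiv p)) = (\<Sum>i\<le>Suc m. ev i * e i * e i)"
    unfolding integration_by_parts[OF primitive_on_poly wL2_qw_poly] X(2)
    by (intro sum.cong) (auto simp: X(3))
  moreover have "(\<Sum>i\<le>m. (ev i - ev (Suc m)) * (wip w (poly p) (poly (\<phi> i)))\<^sup>2)
     = (\<Sum>i\<le>m. (ev i - ev (Suc m)) * (e i * e i))"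
    by (intro sum.cong) (auto simp: X(3) power2_eq_square)
  ultimately show ?thesis
    by (simp add: left_diff_distrib sum_subtractf sum_distrib_left algebra_simps)
qed

end

subsection \<open>Iterated differentiation\<close>

text \<open>The tail identity for w applied to q p. The new drift is (d - a x) + q', whose slope is
  -(a - 2 \<delta>).\<close>

lemma (in pearson_weight) pearson_weight_shift:
  "pearson_weight J (\<lambda>x. poly [:c, b, \<delta>:] x * w x) (a - 2 * \<delta>) b c (d + b) \<delta>"
proof
  show "0 < a - 2 * \<delta>" using a_pos \<delta>_nonpos by simp
  show "integrable lborel (\<lambda>x. poly p x * (poly q x * w x))" for p
    using integrable_poly[of "p * q"] by (simp only: poly_mult mult.assoc)
next
  fix s t :: real and p assume st: "s = 1 \<or> s = -1" "t \<in> J"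
  have eq: "poly ([:d + b, - (a - 2 * \<delta>):] * p + q * pderiv p) x * (poly q x * w x) =
      poly ([:d, - a:] * (q * p) + q * pderiv (q * p)) x * w x" for x
  proof -
    have "([:d + b, - (a - 2 * \<delta>):] * p + q * pderiv p) * q = [:d, - a:] * (q * p) + q * pderiv (q * p)"
    proof -
      have "[:d + b, - (a - 2 * \<delta>):] = [:d, - a:] + pderiv q" by (simp add: pderiv_pCons)
      thus ?thesis by (simp only: pderiv_mult) (simp only: ring_distribs mult_ac add_ac)
    qed
    thus ?thesis by (simp only: poly_mult[symmetric] mult.assoc[symmetric])
  qed
  show "(LINT x|lborel. indicator {x. 0 < s * (x - t)} x *
         (poly ([:d + b, - (a - 2 * \<delta>):] * p + q * pderiv p) x * (poly q x * w x))) =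
      - s * (poly q t * (poly q t * w t) * poly p t)"
    unfolding eq tail[OF st] by (simp only: poly_mult mult_ac)
qed (use q_pos w_pos w_zero \<delta>_nonpos open_J interval_J J_nonempty in auto)

lemma pearson_weight_power:
  assumes "pearson_weight J w a b c d \<delta>"
  shows "pearson_weight J (\<lambda>x. poly [:c, b, \<delta>:] x ^ k * w x) (a - 2 * real k * \<delta>) b c (d + real k * b) \<delta>"
proof (induction k)
  case (Suc k)
  have "(\<lambda>x. poly [:c, b, \<delta>:] x * (poly [:c, b, \<delta>:] x ^ k * w x)) = (\<lambda>x. poly [:c, b, \<delta>:] x ^ Suc k * w x)"
    by (simp only: power_Suc mult.assoc)
  moreover have "a - 2 * real k * \<delta> - 2 * \<delta> = a - 2 * real (Suc k) * \<delta>" "d + real k * b + b = d + real (Suc k) * b"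
    by (simp_all add: algebra_simps)
  ultimately show ?case using pearson_weight.pearson_weight_shift[OF Suc] by (simp only:)
qed (use assms in simp)

text \<open>The factor l_i - l_j is the eigenvalue, for the weight q^j w, of the j-th derivative of
  the i-th eigenpolynomial. The product collects the eigenvalues met in k differentiations.\<close>

definition sl_ev_prod :: "real \<Rightarrow> real \<Rightarrow> nat \<Rightarrow> nat \<Rightarrow> real" where
  "sl_ev_prod a \<delta> i k = (\<Prod>j<k. sl_ev a \<delta> i - sl_ev a \<delta> j)"

lemma sl_ev_prod_Suc:
  "sl_ev_prod a \<delta> (Suc i) (Suc k) = sl_ev a \<delta> (Suc i) * sl_ev_prod (a - 2 * \<delta>) \<delta> i k"
  unfolding sl_ev_prod_def by (subst prod.lessThan_Suc_shift) (simp add: sl_ev_shift)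

lemma sl_ev_prod_pos:
  assumes "0 < a" "\<delta> \<le> 0" "k \<le> i"
  shows "0 < sl_ev_prod a \<delta> i k"
  unfolding sl_ev_prod_def by (intro prod_pos) (use sl_ev_less[OF assms(1,2)] assms(3) in auto)

text \<open>Square-integrability is demanded of the last function only;
  \<open>deriv_chain_mono\<close> hands it down to the others.\<close>

definition deriv_chain :: "real set \<Rightarrow> (real \<Rightarrow> real) \<Rightarrow> (real \<Rightarrow> real) \<Rightarrow> nat \<Rightarrow> (nat \<Rightarrow> real \<Rightarrow> real) \<Rightarrow> bool" where
  "deriv_chain J q w n h \<longleftrightarrow>
     (\<forall>j<n. primitive_on J (h j) (h (Suc j))) \<and> wL2 (\<lambda>x. q x ^ n * w x) (h n)"

lemma deriv_chain_Suc:
  assumes "deriv_chain J q w (Suc n) h"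
  shows "primitive_on J (h 0) (h 1)" "deriv_chain J q (\<lambda>x. q x * w x) n (\<lambda>j. h (Suc j))"
  using assms by (auto simp: deriv_chain_def mult_ac)

text \<open>Each step down is \<open>primitive_on_wL2\<close> for the weight q^n w.\<close>

lemma deriv_chain_mono:
  assumes w: "pearson_weight J w a b c d \<delta>" and "deriv_chain J (poly [:c, b, \<delta>:]) w n h" "k \<le> n"
  shows "deriv_chain J (poly [:c, b, \<delta>:]) w k h"
  using assms(2,3)
proof (induction n)
  case (Suc n)
  interpret W: pearson_weight J "\<lambda>x. poly [:c, b, \<delta>:] x ^ n * w x" "a - 2 * real n * \<delta>" b c "d + real n * b" \<delta>
    by (rule pearson_weight_power[OF w])
  have "wL2 (\<lambda>x. poly [:c, b, \<delta>:] x ^ n * w x) (h n)"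
    by (rule W.primitive_on_wL2[of _ "h (Suc n)"])
      (use Suc.prems in \<open>simp_all only: deriv_chain_def power_Suc mult.assoc lessI simp_thms\<close>)
  hence "deriv_chain J (poly [:c, b, \<delta>:]) w n h"
    using Suc.prems by (simp only: deriv_chain_def) auto
  from Suc.IH[OF this] Suc.prems show ?case
    by (cases "k = Suc n") (simp_all only: le_Suc_eq simp_thms)
qed (simp only: le_zero_eq)

lemma deriv_chain_wL2:
  assumes "pearson_weight J w a b c d \<delta>" "deriv_chain J (poly [:c, b, \<delta>:]) w n h" "k \<le> n"
  shows "wL2 (\<lambda>x. poly [:c, b, \<delta>:] x ^ k * w x) (h k)"
  using deriv_chain_mono[OF assms] by (simp only: deriv_chain_def)

text \<open>Differentiating \<tau> p' + q p'' + l p = 0 adds q' to the drift and \<tau>' = -a to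
  l.\<close>

lemma sl_op_pderiv:
  assumes "sl_op [:c, b, \<delta>:] [:d, - a:] p = smult l p"
  shows "sl_op [:c, b, \<delta>:] [:d + b, - (a - 2 * \<delta>):] (pderiv p) = smult (l - a) (pderiv p)"
proof -
  let ?q = "[:c, b, \<delta>:]" and ?t = "[:d, - a:]"
  have 1: "[:d + b, - (a - 2 * \<delta>):] = ?t + pderiv ?q" by (simp add: pderiv_pCons)
  have "pderiv (sl_op ?q ?t p) = - (pderiv ?t * pderiv p + ?t * pderiv (pderiv p)
     + pderiv ?q * pderiv (pderiv p) + ?q * pderiv (pderiv (pderiv p)))"
    unfolding sl_op_def pderiv_minus pderiv_add pderiv_mult by (simp only: ring_distribs mult_ac add_ac)
  hence "sl_op ?q (?t + pderiv ?q) (pderiv p) = pderiv (sl_op ?q ?t p) + pderiv ?t * pderiv p"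
    unfolding sl_op_def[of ?q "?t + pderiv ?q"] by (simp only: ring_distribs)
  also have "pderiv ?t = [:- a:]" by (simp add: pderiv_pCons)
  finally show ?thesis
    unfolding 1 assms by (simp add: pderiv_smult smult_diff_left)
qed

text \<open>Every integration by parts yields one eigenvalue and passes to h' and p', where p' is an
  eigenpolynomial for the weight q w. After i steps p has become the constant
  \<open>coeff p i * fact i\<close>.\<close>

lemma wip_eigenpoly:
  assumes "pearson_weight J w a b c d \<delta>" and "deriv_chain J (poly [:c, b, \<delta>:]) w i h"
    and "degree p \<le> i" and "sl_op [:c, b, \<delta>:] [:d, - a:] p = smult (sl_ev a \<delta> i) p"
  shows "sl_ev_prod a \<delta> i i * wip w (h 0) (poly p) =
    coeff p i * fact i * (LINT x|lborel. poly [:c, b, \<delta>:] x ^ i * w x * h i x)"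
  using assms
proof (induction i arbitrary: w a d h p)
  case 0
  then obtain k where "p = [:k:]" by (metis degree_eq_zeroE le_zero_eq)
  moreover have "(LINT x|lborel. w x * (h 0 x * k)) = k * (LINT x|lborel. w x * h 0 x)"
    by (subst integral_mult_right_zero[symmetric]) (simp add: mult_ac)
  ultimately show ?case by (simp add: sl_ev_prod_def wip_def)
next
  case (Suc i)
  interpret pearson_weight J w a b c d \<delta> by fact
  note ch = deriv_chain_Suc[OF Suc.prems(2)]
  have w1: "wL2 qw (h 1)"
    using deriv_chain_wL2[OF pearson_weight_shift ch(2), of 0] by (simp only: power_0 mult_1_left One_nat_def)
  have "sl_ev a \<delta> (Suc i) * wip w (h 0) (poly p) = wip w (h 0) (poly (L p))"
    unfolding Suc.prems(4) wip_smult_right ..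
  also have "\<dots> = wip qw (h 1) (poly (pderiv p))"
    by (rule integration_by_parts[OF ch(1) w1, symmetric])
  finally have 1: "sl_ev a \<delta> (Suc i) * wip w (h 0) (poly p) = wip qw (h 1) (poly (pderiv p))" .
  have "sl_ev a \<delta> (Suc i) - a = sl_ev (a - 2 * \<delta>) \<delta> i" by (simp add: sl_ev_def algebra_simps)
  hence "sl_op q [:d + b, - (a - 2 * \<delta>):] (pderiv p) = smult (sl_ev (a - 2 * \<delta>) \<delta> i) (pderiv p)"
    using sl_op_pderiv[OF Suc.prems(4)] by simp
  from Suc.IH[OF pearson_weight_shift ch(2) _ this] Suc.prems(3)
  have "sl_ev_prod (a - 2 * \<delta>) \<delta> i i * wip qw (h 1) (poly (pderiv p))
     = coeff (pderiv p) i * fact i * (LINT x|lborel. poly q x ^ i * (poly q x * w x) * h (Suc i) x)"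
    by (simp add: degree_pderiv)
  also have "(LINT x|lborel. poly q x ^ i * (poly q x * w x) * h (Suc i) x) = (LINT x|lborel. poly q x ^ Suc i * w x * h (Suc i) x)"
    by (simp only: power_Suc mult_ac)
  finally show ?case
    unfolding sl_ev_prod_Suc mult.assoc[of "sl_ev a \<delta> (Suc i)"] 1[symmetric]
    by (simp add: coeff_pderiv mult_ac)
qed

text \<open>The squared i-th Fourier coefficient of h 0, written without the eigenpolynomial; see
  \<open>fourier_sq_eq\<close>.\<close>

definition fourier_sq :: "real \<Rightarrow> real \<Rightarrow> (real \<Rightarrow> real) \<Rightarrow> (real \<Rightarrow> real) \<Rightarrow> (nat \<Rightarrow> real \<Rightarrow> real) \<Rightarrow> nat \<Rightarrow> real" where
  "fourier_sq a \<delta> q w h i = (LINT x|lborel. q x ^ i * w x * h i x)\<^sup>2 /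
     ((LINT x|lborel. q x ^ i * w x) * sl_ev_prod a \<delta> i i)"

text \<open>Multiplying by the eigenvalue removes the first factor of \<open>sl_ev_prod\<close>; the
  case distinction reflects that division by 0 gives 0.\<close>

lemma fourier_sq_Suc:
  "sl_ev a \<delta> (Suc i) * fourier_sq a \<delta> q w h (Suc i) =
    (if sl_ev a \<delta> (Suc i) = 0 then 0 else fourier_sq (a - 2 * \<delta>) \<delta> q (\<lambda>x. q x * w x) (\<lambda>j. h (Suc j)) i)"
proof -
  have eq: "q x ^ i * (q x * w x) = q x ^ Suc i * w x" for x by simp
  show ?thesis unfolding fourier_sq_def sl_ev_prod_Suc eq by simp
qed

context pearson_weight
begin

lemma integral_power_weight_pos: "0 < (LINT x|lborel. poly q x ^ i * w x)"
  using integral_weight_pos[of "q ^ i"] q_pos by (simp only: poly_power zero_less_power)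

text \<open>\<open>wip_eigenpoly\<close> is applied to h and to the eigenpolynomial itself. The
  second application, with norm 1, gives P = \<kappa>^2 E and so eliminates the unknown leading
  coefficient.\<close>

lemma fourier_sq_eq:
  assumes \<phi>: "orthonormal_eigenpolys \<phi>" and ch: "deriv_chain J (poly q) w i h"
  shows "(wip w (h 0) (poly (\<phi> i)))\<^sup>2 = fourier_sq a \<delta> (poly q) w h i"
proof -
  define p where "p = \<phi> i"
  have p: "degree p \<le> i" "L p = smult (ev i) p" "wip w (poly p) (poly p) = 1"
    using \<phi> by (auto simp: p_def orthonormal_eigenpolys_def)
  define \<kappa> where "\<kappa> = coeff p i * fact i"
  define P where "P = sl_ev_prod a \<delta> i i"
  define E where "E = (LINT x|lborel. poly q x ^ i * w x)"
  have W: "pearson_weight J w a b c d \<delta>" ..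
  have P: "P > 0" unfolding P_def by (rule sl_ev_prod_pos[OF a_pos \<delta>_nonpos]) simp
  have h: "P * wip w (h 0) (poly p) = \<kappa> * (LINT x|lborel. poly q x ^ i * w x * h i x)"
    unfolding P_def \<kappa>_def by (rule wip_eigenpoly[OF W ch p(1,2)])
  have top: "(pderiv ^^ i) p = [:\<kappa>:]"
  proof (rule poly_eqI)
    fix n
    show "coeff ((pderiv ^^ i) p) n = coeff [:\<kappa>:] n"
      using p(1) by (cases n) (auto simp: coeff_higher_pderiv \<kappa>_def pochhammer_fact[symmetric] coeff_eq_0 mult.commute)
  qed
  have "deriv_chain J (poly q) w i (\<lambda>j. poly ((pderiv ^^ j) p))"
    unfolding deriv_chain_def
  proof (intro conjI allI impI)
    fix j
    show "primitive_on J (poly ((pderiv ^^ j) p)) (poly ((pderiv ^^ Suc j) p))"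
      using primitive_on_poly[of J "(pderiv ^^ j) p"] by simp
  next
    have "(\<lambda>x. poly q x ^ i * w x * (poly ((pderiv ^^ i) p) x)\<^sup>2)
      = (\<lambda>x. poly (q ^ i * ((pderiv ^^ i) p)\<^sup>2) x * w x)"
      by (simp only: poly_mult poly_power mult_ac)
    thus "wL2 (\<lambda>x. poly q x ^ i * w x) (poly ((pderiv ^^ i) p))"
      using integrable_poly by (simp only: wL2_def poly_borel simp_thms)
  qed
  from wip_eigenpoly[OF W this p(1,2)] have "P = \<kappa> * (LINT x|lborel. poly q x ^ i * w x * poly [:\<kappa>:] x)"
    unfolding top by (simp only: funpow_0 p(3) P_def \<kappa>_def mult_1_right)
  also have "(LINT x|lborel. poly q x ^ i * w x * poly [:\<kappa>:] x) = \<kappa> * E"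
    unfolding E_def by (subst integral_mult_right_zero[symmetric]) (simp add: mult_ac)
  finally have PE: "P = \<kappa>\<^sup>2 * E" by (simp add: power2_eq_square)
  have E: "E > 0" unfolding E_def by (rule integral_power_weight_pos)
  define e where "e = (LINT x|lborel. poly q x ^ i * w x * h i x)"
  have "(wip w (h 0) (poly p))\<^sup>2 = (\<kappa> * e / P)\<^sup>2"
  proof -
    have "wip w (h 0) (poly p) = \<kappa> * e / P"
      using P h[folded e_def] by (metis mult.commute nonzero_mult_div_cancel_right less_irrefl)
    thus ?thesis by simp
  qed
  also have "\<dots> = e\<^sup>2 * \<kappa>\<^sup>2 / (P * P)" by (simp add: power_divide power_mult_distrib power2_eq_square)
  also have "\<dots> = e\<^sup>2 / (E * P)"
  proof -
    have "\<kappa> \<noteq> 0" using P PE by auto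
    thus ?thesis using E P by (subst (1) PE) (simp add: field_simps)
  qed
  finally show ?thesis by (simp add: fourier_sq_def e_def E_def P_def p_def)
qed

end

text \<open>Almost everywhere, because the last function of a chain is only an almost everywhere
  derivative.\<close>

definition poly_chain_AE :: "real set \<Rightarrow> nat \<Rightarrow> (nat \<Rightarrow> real \<Rightarrow> real) \<Rightarrow> nat \<Rightarrow> bool" where
  "poly_chain_AE J n h m \<longleftrightarrow>
     (\<exists>p. degree p \<le> m \<and> (\<forall>j\<le>n. AE x in lborel. x \<in> J \<longrightarrow> h j x = poly ((pderiv ^^ j) p) x))"

text \<open>The two parts of the theorem are the cases \<open>r = 1\<close> and \<open>r = 0\<close>.\<close>
lemma deriv_chain_inequality:
  assumes "pearson_weight J w a b c d \<delta>" and "deriv_chain J (poly [:c, b, \<delta>:]) w n h" and r: "r \<le> 1"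
  defines "lhs \<equiv> wip w (h 0) (h 0) - (\<Sum>i<n + r. fourier_sq a \<delta> (poly [:c, b, \<delta>:]) w h i)"
    and "rhs \<equiv> (wip (\<lambda>x. poly [:c, b, \<delta>:] x ^ n * w x) (h n) (h n)
      - (if r = 0 then 0 else (LINT x|lborel. poly [:c, b, \<delta>:] x ^ n * w x * h n x)\<^sup>2 / (LINT x|lborel. poly [:c, b, \<delta>:] x ^ n * w x)))
      / sl_ev_prod a \<delta> (n + r) n"
  shows "lhs \<le> rhs" and "n = 0 \<or> poly_chain_AE J n h (n + r) \<Longrightarrow> lhs = rhs"
proof -
  have "lhs \<le> rhs \<and> (n = 0 \<or> poly_chain_AE J n h (n + r) \<longrightarrow> lhs = rhs)"
    using assms(1,2) unfolding lhs_def rhs_def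
  proof (induction n arbitrary: w a d h)
    case 0
    \<comment> \<open>Without derivatives both sides agree: the product is empty, and for r = 1 the
      single Fourier term, i = 0, is the subtracted quotient.\<close>
    show ?case using r by (cases "r = 0") (auto simp: sl_ev_prod_def fourier_sq_def le_Suc_eq)
  next
    case (Suc n)
    interpret pearson_weight J w a b c d \<delta> by fact
    note ch = deriv_chain_Suc[OF Suc.prems(2)]
    obtain \<phi> where \<phi>: "orthonormal_eigenpolys \<phi>" using ex_orthonormal_eigenpolys ..
    let ?k = "n + r" and ?h = "\<lambda>j. h (Suc j)"
    have w1: "wL2 qw (h 1)"
      using deriv_chain_wL2[OF pearson_weight_shift ch(2), of 0] by (simp only: power_0 mult_1_left One_nat_def)
    define l where "l = ev (Suc ?k)"
    have l: "l > 0" unfolding l_def by (rule sl_ev_pos[OF a_pos \<delta>_nonpos]) simp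
    define F where "F = fourier_sq a \<delta> (poly q) w h"
    define F' where "F' = fourier_sq (a - 2 * \<delta>) \<delta> (poly q) qw ?h"
    \<comment> \<open>The i-th coefficient needs i derivatives, and n + r \<le> Suc n because r
      \<le> 1.\<close>
    have F: "(wip w (h 0) (poly (\<phi> i)))\<^sup>2 = F i" if "i \<le> ?k" for i
      unfolding F_def
      by (rule fourier_sq_eq[OF \<phi> deriv_chain_mono[OF Suc.prems]]) (use that r in simp)
    have F': "ev (Suc i) * F (Suc i) = F' i" for i
      unfolding F_def F'_def fourier_sq_Suc using sl_ev_pos[OF a_pos \<delta>_nonpos, of "Suc i"] by simp
    \<comment> \<open>As ev 0 = 0, shifting the index turns the sum of ev i * F i into the Fourier
      sum of the derivative.\<close>
    have sumF: "(\<Sum>i\<le>?k. (ev i - l) * F i) = (\<Sum>i<?k. F' i) - l * (\<Sum>i<Suc ?k. F i)"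
    proof -
      have "(\<Sum>i\<le>?k. ev i * F i) = (\<Sum>i<?k. ev (Suc i) * F (Suc i))"
        unfolding lessThan_Suc_atMost[symmetric] by (subst sum.lessThan_Suc_shift) simp
      thus ?thesis
        by (simp add: F' left_diff_distrib sum_subtractf sum_distrib_left lessThan_Suc_atMost)
    qed
    define R where "R = (wip (\<lambda>x. poly q x ^ Suc n * w x) (h (Suc n)) (h (Suc n))
      - (if r = 0 then 0 else (LINT x|lborel. poly q x ^ Suc n * w x * h (Suc n) x)\<^sup>2 / (LINT x|lborel. poly q x ^ Suc n * w x)))"
    have P: "sl_ev_prod a \<delta> (Suc ?k) (Suc n) = l * sl_ev_prod (a - 2 * \<delta>) \<delta> ?k n"
      unfolding sl_ev_prod_Suc l_def ..
    have eq: "poly q x ^ n * (poly q x * w x) = poly q x ^ Suc n * w x" for x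
      by (simp only: power_Suc mult_ac)
    have IH: "wip qw (h 1) (h 1) - (\<Sum>i<?k. F' i) \<le> R / sl_ev_prod (a - 2 * \<delta>) \<delta> ?k n"
      "n = 0 \<or> poly_chain_AE J n ?h ?k \<Longrightarrow> wip qw (h 1) (h 1) - (\<Sum>i<?k. F' i) = R / sl_ev_prod (a - 2 * \<delta>) \<delta> ?k n"
      using Suc.IH[OF pearson_weight_shift ch(2)] unfolding eq R_def F'_def One_nat_def by blast+
    \<comment> \<open>The gap at degree n + r carries the remainder of h 0 for w over to that of h 1
      for q w; the divisor l becomes the first factor of \<open>sl_ev_prod\<close>.\<close>
    have gap: "l * (wip w (h 0) (h 0) - (\<Sum>i<Suc ?k. F i)) \<le> wip qw (h 1) (h 1) - (\<Sum>i<?k. F' i)"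
      using spectral_gap[OF \<phi> ch(1) w1, of ?k] F sumF by (simp add: l_def algebra_simps)
    have gap_eq: "l * (wip w (h 0) (h 0) - (\<Sum>i<Suc ?k. F i)) = wip qw (h 1) (h 1) - (\<Sum>i<?k. F' i)"
      if "poly_chain_AE J (Suc n) h (Suc ?k)"
    proof -
      obtain p where p: "degree p \<le> Suc ?k"
        and ae: "\<And>j. j \<le> Suc n \<Longrightarrow> AE x in lborel. x \<in> J \<longrightarrow> h j x = poly ((pderiv ^^ j) p) x"
        using \<open>poly_chain_AE J (Suc n) h (Suc ?k)\<close> unfolding poly_chain_AE_def by blast
      have ae0: "AE x in lborel. x \<in> J \<longrightarrow> h 0 x = poly p x" using ae[of 0] by simp
      have ae1: "AE x in lborel. x \<in> J \<longrightarrow> h 1 x = poly (pderiv p) x" using ae[of 1] by simp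
      note m = primitive_onD(1,2)[OF ch(1)] poly_borel
      have tr: "AE x in lborel. x \<in> J \<longrightarrow> f x = f x" for f :: "real \<Rightarrow> real" by simp
      have "wip w (h 0) (h 0) = wip w (poly p) (poly p)"
        by (rule wip_cong_J(1)[OF m(1,3,1,3) ae0 ae0])
      moreover have "wip qw (h 1) (h 1) = wip qw (poly (pderiv p)) (poly (pderiv p))"
        by (rule wip_cong_J(2)[OF m(2,3,2,3) ae1 ae1])
      moreover have "wip w (h 0) (poly (\<phi> i)) = wip w (poly p) (poly (\<phi> i))" for i
        by (rule wip_cong_J(1)[OF m(1,3,3,3) ae0 tr])
      ultimately show ?thesis using spectral_gap_eq[OF \<phi> p] F sumF by (simp add: l_def algebra_simps)
    qed
    have chain_tail: "poly_chain_AE J n ?h ?k" if "poly_chain_AE J (Suc n) h (Suc ?k)"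
    proof -
      obtain p where "degree p \<le> Suc ?k"
        and ae: "\<And>j. j \<le> Suc n \<Longrightarrow> AE x in lborel. x \<in> J \<longrightarrow> h j x = poly ((pderiv ^^ j) p) x"
        using \<open>poly_chain_AE J (Suc n) h (Suc ?k)\<close> unfolding poly_chain_AE_def by blast
      hence "degree (pderiv p) \<le> ?k" by (simp add: degree_pderiv)
      moreover have "AE x in lborel. x \<in> J \<longrightarrow> ?h j x = poly ((pderiv ^^ j) (pderiv p)) x" if "j \<le> n" for j
        using ae[of "Suc j"] that by (simp add: funpow_swap1)
      ultimately show ?thesis unfolding poly_chain_AE_def by blast
    qed
    have "wip w (h 0) (h 0) - (\<Sum>i<Suc ?k. F i) \<le> (R / sl_ev_prod (a - 2 * \<delta>) \<delta> ?k n) / l"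
      by (subst pos_le_divide_eq[OF l], subst mult.commute) (rule order_trans[OF gap IH(1)])
    moreover have "wip w (h 0) (h 0) - (\<Sum>i<Suc ?k. F i) = (R / sl_ev_prod (a - 2 * \<delta>) \<delta> ?k n) / l"
      if "poly_chain_AE J (Suc n) h (Suc ?k)"
      using l trans[OF gap_eq[OF that] IH(2)[OF disjI2[OF chain_tail[OF that]]]]
      by (metis less_irrefl mult.commute nonzero_eq_divide_eq)
    moreover have "(R / sl_ev_prod (a - 2 * \<delta>) \<delta> ?k n) / l = R / sl_ev_prod a \<delta> (Suc ?k) (Suc n)"
      unfolding P by simp
    ultimately show ?case
      unfolding add_Suc F_def[symmetric] R_def[symmetric] by auto
  qed
  thus "lhs \<le> rhs" and "n = 0 \<or> poly_chain_AE J n h (n + r) \<Longrightarrow> lhs = rhs" by blast+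
qed

subsection \<open>Integrated Pearson densities\<close>

lemma ex_poly_antiderivative: "\<exists>R :: real poly. pderiv R = r"
proof
  have "pderiv (\<Sum>i\<le>degree r. monom (coeff r i / real (Suc i)) (Suc i)) = (\<Sum>i\<le>degree r. monom (coeff r i) i)"
    by (simp add: higher_pderiv_sum[of 1, simplified] pderiv_monom del: of_nat_Suc)
  thus "pderiv (\<Sum>i\<le>degree r. monom (coeff r i / real (Suc i)) (Suc i)) = r"
    by (simp only: poly_as_sum_of_monoms)
qed

locale IP_density =
  fixes f :: "real \<Rightarrow> real" and \<mu> \<delta> \<beta> \<gamma> :: real
  assumes IP: "IP f \<mu> \<delta> \<beta> \<gamma>" and \<delta>_le_0: "\<delta> \<le> 0"
begin

lemma f_measurable [measurable]: "f \<in> borel_measurable borel"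
  and f_nonneg: "0 \<le> f x"
  and f_integrable: "integrable lborel f"
  and f_integral: "(LINT x|lborel. f x) = 1"
  and xf_integrable: "integrable lborel (\<lambda>t. t * f t)"
  and mean: "\<mu> = (LINT t|lborel. t * f t)"
  and IP_identity: "(LINT t:{..x}|lborel. (\<mu> - t) * f t) = qpoly \<delta> \<beta> \<gamma> x * f x"
  using IP by (auto simp: IP_def is_density_def)

lemma qpoly_eq: "qpoly \<delta> \<beta> \<gamma> = poly [:\<gamma>, \<beta>, \<delta>:]"
  by (auto simp: qpoly_def power2_eq_square algebra_simps)

lemma centered_integrable: "integrable lborel (\<lambda>y. (\<mu> - y) * f y)"
proof -
  have "integrable lborel (\<lambda>y. \<mu> * f y - y * f y)"
    using f_integrable xf_integrable by (intro Bochner_Integration.integrable_diff integrable_mult_right)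
  thus ?thesis by (simp add: left_diff_distrib)
qed

lemma centered_integral: "(LINT y|lborel. (\<mu> - y) * f y) = 0"
  using f_integrable xf_integrable f_integral mean by (simp add: left_diff_distrib)

text \<open>For s = -1 this is the defining identity; for s = 1 it follows because the total centred
  integral is 0.\<close>

lemma centered_tail:
  assumes "s = 1 \<or> s = -1"
  shows "(LINT y|lborel. indicator {y. 0 < s * (y - x)} y * ((\<mu> - y) * f y)) = - s * (qpoly \<delta> \<beta> \<gamma> x * f x)"
proof -
  have id: "(LINT y|lborel. indicator {..x} y * ((\<mu> - y) * f y)) = qpoly \<delta> \<beta> \<gamma> x * f x"
    using IP_identity[of x] by (simp add: set_lebesgue_integral_def)
  have i: "integrable lborel (\<lambda>y. indicator {..x} y * ((\<mu> - y) * f y))"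
    using integrable_real_mult_indicator[OF _ centered_integrable, of "{..x}"] by (simp add: mult.commute)
  from assms show ?thesis
  proof
    assume [simp]: "s = 1"
    have "(LINT y|lborel. indicator {y. 0 < s * (y - x)} y * ((\<mu> - y) * f y))
      = (LINT y|lborel. (\<mu> - y) * f y - indicator {..x} y * ((\<mu> - y) * f y))"
      by (intro Bochner_Integration.integral_cong) (auto simp: indicator_def)
    also have "\<dots> = - s * (qpoly \<delta> \<beta> \<gamma> x * f x)"
      using i centered_integrable centered_integral id by simp
    finally show ?thesis .
  next
    assume [simp]: "s = -1"
    have "(LINT y|lborel. indicator {y. 0 < s * (y - x)} y * ((\<mu> - y) * f y)) =
       (LINT y|lborel. indicator {..x} y * ((\<mu> - y) * f y))"
    proof (rule integral_cong_AE)
      show "AE y in lborel. indicator {y. 0 < s * (y - x)} y * ((\<mu> - y) * f y) = indicator {..x} y * ((\<mu> - y) * f y)"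
        using AE_lborel_singleton[of x] by eventually_elim (auto simp: indicator_def)
    qed measurable
    thus ?thesis using id by simp
  qed
qed

section \<open>The support and positivity of q f\<close>

lemma supp_eq_einterval: "supp f = einterval (supp_lo f) (supp_hi f)"
  by (auto simp: supp_def einterval_def)

text \<open>Every bound strictly outside the support holds only up to a null set of its own;
  restricting to rational bounds leaves countably many of them.\<close>

lemma AE_zero_outside_supp: "AE x in lborel. x \<notin> supp f \<longrightarrow> f x = 0"
proof -
  have "AE x in lborel. \<forall>r\<in>\<rat>. ereal r < supp_lo f \<longrightarrow> 0 < f x \<longrightarrow> r \<le> x"
  proof (subst AE_ball_countable[OF countable_rat], intro ballI)
    fix r :: real
    show "AE x in lborel. ereal r < supp_lo f \<longrightarrow> 0 < f x \<longrightarrow> r \<le> x"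
    proof (cases "ereal r < supp_lo f")
      case True
      then obtain a where "ereal r < ereal a" "AE x in lborel. 0 < f x \<longrightarrow> a \<le> x"
        unfolding supp_lo_def less_Sup_iff by blast
      thus ?thesis by (auto elim: eventually_mono)
    qed auto
  qed
  moreover have "AE x in lborel. \<forall>r\<in>\<rat>. supp_hi f < ereal r \<longrightarrow> 0 < f x \<longrightarrow> x \<le> r"
  proof (subst AE_ball_countable[OF countable_rat], intro ballI)
    fix r :: real
    show "AE x in lborel. supp_hi f < ereal r \<longrightarrow> 0 < f x \<longrightarrow> x \<le> r"
    proof (cases "supp_hi f < ereal r")
      case True
      then obtain a where "ereal a < ereal r" "AE x in lborel. 0 < f x \<longrightarrow> x \<le> a"
        unfolding supp_hi_def Inf_less_iff by blast
      thus ?thesis by (auto elim: eventually_mono)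
    qed auto
  qed
  \<comment> \<open>The endpoints are discarded as single points. For an infinite endpoint
    \<open>real_of_ereal\<close> is 0, and discarding 0 is harmless.\<close>
  moreover have "AE x in lborel. x \<noteq> real_of_ereal (supp_lo f)" by (rule AE_lborel_singleton)
  moreover have "AE x in lborel. x \<noteq> real_of_ereal (supp_hi f)" by (rule AE_lborel_singleton)
  ultimately show ?thesis
  proof eventually_elim
    case (elim x)
    show ?case
    proof (intro impI, rule ccontr)
      assume "x \<notin> supp f" "f x \<noteq> 0"
      hence f: "0 < f x" using f_nonneg[of x] by simp
      have "ereal x \<noteq> supp_lo f" "ereal x \<noteq> supp_hi f" using elim(3,4) by (metis real_of_ereal.simps(1))+
      with \<open>x \<notin> supp f\<close> consider "ereal x < supp_lo f" | "supp_hi f < ereal x"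
        by (auto simp: supp_def not_less le_less)
      thus False
      proof cases
        case 1
        then obtain z where z: "ereal x < ereal z" "ereal z < supp_lo f"
          using ereal_dense2[OF 1] by auto
        then obtain r where "r \<in> \<rat>" "x < r" "r < z" using Rats_dense_in_real[of x z] by auto
        moreover have "ereal r < supp_lo f" using \<open>r < z\<close> z(2) by (metis less_ereal.simps(1) less_trans)
        ultimately show False using elim(1) f by force
      next
        case 2
        then obtain z where z: "supp_hi f < ereal z" "ereal z < ereal x"
          using ereal_dense2[OF 2] by auto
        then obtain r where "r \<in> \<rat>" "z < r" "r < x" using Rats_dense_in_real[of z x] by auto
        moreover have "supp_hi f < ereal r" using \<open>z < r\<close> z(1) by (metis less_ereal.simps(1) less_trans)
        ultimately show False using elim(2) f by force
      qed
    qed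
  qed
qed

text \<open>Beyond the mean the factor \<mu> - y has constant sign, so q f is a tail of an absolute
  moment. Positivity, unimodality and the moment bounds all start from this formula.\<close>

lemma qpoly_f_eq_abs:
  assumes s: "s = 1 \<or> s = -1" and x: "0 \<le> s * (x - \<mu>)"
  shows "qpoly \<delta> \<beta> \<gamma> x * f x = (LINT y|lborel. indicator {y. 0 < s * (y - x)} y * (\<bar>y - \<mu>\<bar> * f y))"
proof -
  have "indicator {y. 0 < s * (y - x)} y * (\<bar>y - \<mu>\<bar> * f y) = - s * (indicator {y. 0 < s * (y - x)} y * ((\<mu> - y) * f y))" for y
    using s x by (auto simp: indicator_def algebra_simps)
  hence "(LINT y|lborel. indicator {y. 0 < s * (y - x)} y * (\<bar>y - \<mu>\<bar> * f y)) = - s * (- s * (qpoly \<delta> \<beta> \<gamma> x * f x))"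
    using centered_tail[OF s, of x] by simp
  thus ?thesis using s by auto
qed

lemma abs_tail_integrable:
  "integrable lborel (\<lambda>y. indicator {y. 0 < s * (y - x)} y * (\<bar>y - \<mu>\<bar> * f y))"
proof -
  have "integrable lborel (\<lambda>y. \<bar>(\<mu> - y) * f y\<bar>)" using centered_integrable by (rule integrable_abs)
  hence "integrable lborel (\<lambda>y. \<bar>y - \<mu>\<bar> * f y)"
    by (simp add: abs_mult f_nonneg abs_minus_commute)
  moreover have "{y. 0 < s * (y - x)} \<in> sets lborel" by measurable
  ultimately show ?thesis
    using integrable_real_mult_indicator by (metis (no_types, lifting) Bochner_Integration.integrable_cong mult.commute)
qed

lemma qpoly_f_nonneg: "0 \<le> qpoly \<delta> \<beta> \<gamma> x * f x"
proof -
  obtain s :: real where s: "s = 1 \<or> s = -1" "0 \<le> s * (x - \<mu>)" by (cases "\<mu> \<le> x") force+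
  show ?thesis unfolding qpoly_f_eq_abs[OF s]
    by (intro Bochner_Integration.integral_nonneg) (simp add: f_nonneg)
qed

text \<open>If q f vanished at x, then f would vanish almost everywhere on one side of x, and x
  would bound the support.\<close>

lemma qpoly_f_pos:
  assumes x: "x \<in> supp f"
  shows "0 < qpoly \<delta> \<beta> \<gamma> x * f x"
proof -
  obtain s :: real where s: "s = 1 \<or> s = -1" "0 \<le> s * (x - \<mu>)" by (cases "\<mu> \<le> x") force+
  have "qpoly \<delta> \<beta> \<gamma> x * f x \<noteq> 0"
  proof
    assume "qpoly \<delta> \<beta> \<gamma> x * f x = 0"
    hence "AE y in lborel. indicator {y. 0 < s * (y - x)} y * (\<bar>y - \<mu>\<bar> * f y) = 0"
      unfolding qpoly_f_eq_abs[OF s]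
      by (subst (asm) integral_nonneg_eq_0_iff_AE[OF abs_tail_integrable]) (auto simp: f_nonneg)
    hence ae: "AE y in lborel. 0 < f y \<longrightarrow> 0 \<le> s * (x - y)"
      by eventually_elim (use s in \<open>auto simp: indicator_def split: if_splits\<close>)
    from s(1) show False
    proof
      assume "s = 1"
      hence "AE y in lborel. 0 < f y \<longrightarrow> y \<le> x" using ae by simp
      hence "supp_hi f \<le> ereal x" unfolding supp_hi_def by (intro Inf_lower) auto
      thus False using x by (auto simp: supp_def)
    next
      assume "s = -1"
      hence "AE y in lborel. 0 < f y \<longrightarrow> x \<le> y" using ae by simp
      hence "ereal x \<le> supp_lo f" unfolding supp_lo_def by (intro Sup_upper) auto
      thus False using x by (auto simp: supp_def)
    qed
  qed
  thus ?thesis using qpoly_f_nonneg[of x] by linarith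
qed

section \<open>Finiteness of all moments and the tail identity\<close>

lemma qpoly_le: "qpoly \<delta> \<beta> \<gamma> t \<le> (\<bar>\<beta>\<bar> * (1 + \<bar>\<mu>\<bar>) + \<bar>\<gamma>\<bar>) * (1 + \<bar>t - \<mu>\<bar>)"
proof -
  have "\<delta> * t\<^sup>2 \<le> 0" using \<delta>_le_0 by (simp add: mult_nonpos_nonneg)
  moreover have "\<beta> * t \<le> \<bar>\<beta>\<bar> * \<bar>t\<bar>" by (metis abs_ge_self abs_mult)
  moreover have "\<bar>\<beta>\<bar> * \<bar>t\<bar> \<le> \<bar>\<beta>\<bar> * \<bar>t - \<mu>\<bar> + \<bar>\<beta>\<bar> * \<bar>\<mu>\<bar>"
    unfolding distrib_left[symmetric] by (intro mult_left_mono) auto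
  moreover have "(\<bar>\<beta>\<bar> * (1 + \<bar>\<mu>\<bar>) + \<bar>\<gamma>\<bar>) * (1 + \<bar>t - \<mu>\<bar>) = \<bar>\<beta>\<bar> + \<bar>\<beta>\<bar> * \<bar>\<mu>\<bar> + \<bar>\<gamma>\<bar>
      + \<bar>\<beta>\<bar> * \<bar>t - \<mu>\<bar> + \<bar>\<beta>\<bar> * \<bar>\<mu>\<bar> * \<bar>t - \<mu>\<bar> + \<bar>\<gamma>\<bar> * \<bar>t - \<mu>\<bar>"
    by (simp add: algebra_simps)
  moreover have "0 \<le> \<bar>\<beta>\<bar> * \<bar>\<mu>\<bar> * \<bar>t - \<mu>\<bar>" "0 \<le> \<bar>\<gamma>\<bar> * \<bar>t - \<mu>\<bar>" "\<gamma> \<le> \<bar>\<gamma>\<bar>" "0 \<le> \<bar>\<beta>\<bar>" by auto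
  ultimately show ?thesis unfolding qpoly_def by linarith
qed

text \<open>For \<open>\<delta> \<le> 0\<close> the quadratic is bounded above by a linear function of \<open>\<bar>y - \<mu>\<bar>\<close>, so Tonelli
  bounds the moment of order \<open>k + 1\<close> by those of orders \<open>k - 1\<close> and \<open>k\<close>.\<close>
lemma moment_integrable: "integrable lborel (\<lambda>y. \<bar>y - \<mu>\<bar> ^ k * f y)"
proof (induction k rule: less_induct)
  case (less n)
  consider "n = 0" | "n = 1" | k where "n = Suc (Suc k)" by (metis One_nat_def not0_implies_Suc)
  thus ?case
  proof cases
    case 1
    thus ?thesis using f_integrable by simp
  next
    case 2
    thus ?thesis using integrable_abs[OF centered_integrable] by (simp add: abs_mult f_nonneg abs_minus_commute)
  next
    case (3 k)
    define C where "C = \<bar>\<beta>\<bar> * (1 + \<bar>\<mu>\<bar>) + \<bar>\<gamma>\<bar>"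
    have C: "0 \<le> C" by (simp add: C_def)
    have part: "(\<integral>\<^sup>+y. ennreal (\<bar>y - \<mu>\<bar> ^ n * f y) * indicator {y. 0 < s * (y - \<mu>)} y \<partial>lborel) < \<infinity>"
      if s: "s = 1 \<or> s = -1" for s
    proof -
      \<comment> \<open>The power \<open>|y - \<mu>| ^ Suc k\<close> is the integral of v from \<mu>
        to y, and u carries the remaining factor. Exchanging the integrals leaves the tail of u
        beyond t, which is q f at t.\<close>
      define u where "u y = ennreal (\<bar>y - \<mu>\<bar> * f y) * indicator {y. 0 < s * (y - \<mu>)} y" for y
      define v where "v t = ennreal (real (Suc k) * \<bar>t - \<mu>\<bar> ^ k) * indicator {t. 0 < s * (t - \<mu>)} t" for t
      have [measurable]: "u \<in> borel_measurable borel" "v \<in> borel_measurable borel"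
        unfolding u_def v_def by measurable
      have v: "(\<integral>\<^sup>+t. v t * indicator {t. 0 < s * (y - t)} t \<partial>lborel) = ennreal (\<bar>y - \<mu>\<bar> ^ Suc k)"
        if y: "0 < s * (y - \<mu>)" for y
      proof -
        let ?B = "{t. 0 < s * (t - \<mu>) \<and> 0 < s * (y - t)}"
        \<comment> \<open>The outer factor s cancels the one from the chain rule, so that p' equals
          the polynomial in v on the chosen side.\<close>
        define p where "p = smult s ([:- s * \<mu>, s:] ^ Suc k)"
        have p: "poly p t = s * (s * (t - \<mu>)) ^ Suc k" for t by (simp add: p_def algebra_simps)
        have p': "poly (pderiv p) t = real (Suc k) * (s * (t - \<mu>)) ^ k" for t
          using s unfolding p_def pderiv_smult pderiv_power_Suc
          by (auto simp: pderiv_pCons algebra_simps)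
        note b = primitive_on_between[OF primitive_on_poly[of UNIV p] s _ _ y]
        have eq: "v t * indicator {t. 0 < s * (y - t)} t = ennreal (indicator ?B t * poly (pderiv p) t)" for t
        proof (cases "t \<in> ?B")
          case True
          hence "\<bar>t - \<mu>\<bar> = s * (t - \<mu>)" using s by auto
          thus ?thesis using True by (simp add: v_def p')
        qed (auto simp: v_def)
        have "(\<integral>\<^sup>+t. v t * indicator {t. 0 < s * (y - t)} t \<partial>lborel) = ennreal (s * (poly p y - poly p \<mu>))"
          unfolding eq using b by (subst nn_integral_eq_integral) (auto simp: p' indicator_def)
        also have "s * (poly p y - poly p \<mu>) = \<bar>y - \<mu>\<bar> ^ Suc k"
        proof -
          have "\<bar>y - \<mu>\<bar> = s * (y - \<mu>)" using s y by auto
          thus ?thesis using s unfolding p by auto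
        qed
        finally show ?thesis .
      qed
      have "(\<integral>\<^sup>+y. ennreal (\<bar>y - \<mu>\<bar> ^ n * f y) * indicator {y. 0 < s * (y - \<mu>)} y \<partial>lborel)
        = (\<integral>\<^sup>+y. u y * (\<integral>\<^sup>+t. v t * indicator {t. 0 < s * (y - t)} t \<partial>lborel) \<partial>lborel)"
      proof (intro nn_integral_cong)
        fix y
        show "ennreal (\<bar>y - \<mu>\<bar> ^ n * f y) * indicator {y. 0 < s * (y - \<mu>)} y
          = u y * (\<integral>\<^sup>+t. v t * indicator {t. 0 < s * (y - t)} t \<partial>lborel)"
        proof (cases "0 < s * (y - \<mu>)")
          case True
          have "\<bar>y - \<mu>\<bar> ^ n * f y = (\<bar>y - \<mu>\<bar> * f y) * \<bar>y - \<mu>\<bar> ^ Suc k" by (simp add: 3)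
          thus ?thesis unfolding v[OF True] using True
            by (simp only: u_def) (simp add: ennreal_mult[symmetric] f_nonneg)
        qed (simp add: u_def)
      qed
      also have "\<dots> = (\<integral>\<^sup>+t. v t * (\<integral>\<^sup>+y. u y * indicator {y. 0 < s * (y - t)} y \<partial>lborel) \<partial>lborel)"
        by (rule tonelli_signed) measurable
      also have "\<dots> \<le> (\<integral>\<^sup>+t. ennreal (real (Suc k) * C * (\<bar>t - \<mu>\<bar> ^ k * f t + \<bar>t - \<mu>\<bar> ^ Suc k * f t)) \<partial>lborel)"
      proof (intro nn_integral_mono)
        fix t
        show "v t * (\<integral>\<^sup>+y. u y * indicator {y. 0 < s * (y - t)} y \<partial>lborel)
          \<le> ennreal (real (Suc k) * C * (\<bar>t - \<mu>\<bar> ^ k * f t + \<bar>t - \<mu>\<bar> ^ Suc k * f t))"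
        proof (cases "0 < s * (t - \<mu>)")
          case True
          have "(\<integral>\<^sup>+y. u y * indicator {y. 0 < s * (y - t)} y \<partial>lborel)
            = (\<integral>\<^sup>+y. ennreal (indicator {y. 0 < s * (y - t)} y * (\<bar>y - \<mu>\<bar> * f y)) \<partial>lborel)"
            using True s by (intro nn_integral_cong) (auto simp: u_def indicator_def)
          also have "\<dots> = ennreal (qpoly \<delta> \<beta> \<gamma> t * f t)"
            using True s
            by (subst nn_integral_eq_integral[OF abs_tail_integrable]) (auto simp: f_nonneg qpoly_f_eq_abs[of s])
          also have "v t * \<dots> = ennreal (real (Suc k) * \<bar>t - \<mu>\<bar> ^ k * (qpoly \<delta> \<beta> \<gamma> t * f t))"
            using True by (simp add: v_def ennreal_mult'[symmetric] del: of_nat_Suc)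
          also have "\<dots> \<le> ennreal (real (Suc k) * \<bar>t - \<mu>\<bar> ^ k * (C * (1 + \<bar>t - \<mu>\<bar>) * f t))"
            using qpoly_le[of t] by (intro ennreal_leI mult_left_mono mult_right_mono) (auto simp: C_def f_nonneg)
          also have "real (Suc k) * \<bar>t - \<mu>\<bar> ^ k * (C * (1 + \<bar>t - \<mu>\<bar>) * f t)
            = real (Suc k) * C * (\<bar>t - \<mu>\<bar> ^ k * f t + \<bar>t - \<mu>\<bar> ^ Suc k * f t)"
            by (simp add: algebra_simps)
          finally show ?thesis .
        qed (simp add: v_def)
      qed
      also have "\<dots> < \<infinity>"
      proof -
        have "integrable lborel (\<lambda>t. real (Suc k) * C * (\<bar>t - \<mu>\<bar> ^ k * f t + \<bar>t - \<mu>\<bar> ^ Suc k * f t))"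
          using less[of k] less[of "Suc k"] 3 by (intro integrable_mult_right Bochner_Integration.integrable_add) auto
        moreover have "\<bar>real (Suc k) * C * (\<bar>t - \<mu>\<bar> ^ k * f t + \<bar>t - \<mu>\<bar> ^ Suc k * f t)\<bar>
          = real (Suc k) * C * (\<bar>t - \<mu>\<bar> ^ k * f t + \<bar>t - \<mu>\<bar> ^ Suc k * f t)" for t
          using C f_nonneg[of t] by (intro abs_of_nonneg mult_nonneg_nonneg add_nonneg_nonneg) auto
        ultimately show ?thesis unfolding integrable_iff_bounded real_norm_def by (simp only: simp_thms)
      qed
      finally show ?thesis .
    qed
    have "(\<integral>\<^sup>+y. ennreal (norm (\<bar>y - \<mu>\<bar> ^ n * f y)) \<partial>lborel) =
      (\<integral>\<^sup>+y. (ennreal (\<bar>y - \<mu>\<bar> ^ n * f y) * indicator {y. 0 < 1 * (y - \<mu>)} y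
        + ennreal (\<bar>y - \<mu>\<bar> ^ n * f y) * indicator {y. 0 < -1 * (y - \<mu>)} y) \<partial>lborel)"
      using 3 by (intro nn_integral_cong) (auto simp: indicator_def f_nonneg abs_mult)
    also have "\<dots> = (\<integral>\<^sup>+y. ennreal (\<bar>y - \<mu>\<bar> ^ n * f y) * indicator {y. 0 < 1 * (y - \<mu>)} y \<partial>lborel)
      + (\<integral>\<^sup>+y. ennreal (\<bar>y - \<mu>\<bar> ^ n * f y) * indicator {y. 0 < -1 * (y - \<mu>)} y \<partial>lborel)"
      by (rule nn_integral_add) measurable
    also have "\<dots> < \<infinity>" using part[of 1] part[of "-1"] by simp
    finally show ?thesis by (intro integrableI_bounded) auto
  qed
qed

lemma poly_f_integrable: "integrable lborel (\<lambda>x. poly p x * f x)"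
proof -
  define r where "r = pcompose p [:\<mu>, 1:]"
  have "poly p x = poly r (x - \<mu>)" for x by (simp add: r_def poly_pcompose)
  hence eq: "poly p x * f x = (\<Sum>i\<le>degree r. coeff r i * ((x - \<mu>) ^ i * f x))" for x
    by (simp add: poly_altdef sum_distrib_right mult.assoc)
  have "integrable lborel (\<lambda>x. (x - \<mu>) ^ i * f x)" for i
  proof (rule Bochner_Integration.integrable_bound[OF moment_integrable[of i]])
    show "AE x in lborel. norm ((x - \<mu>) ^ i * f x) \<le> norm (\<bar>x - \<mu>\<bar> ^ i * f x)"
      by (simp add: abs_mult power_abs)
  qed measurable
  thus ?thesis unfolding eq by (intro Bochner_Integration.integrable_sum integrable_mult_right)
qed

text \<open>Writing p(x) - p(t) as an integral of p' and exchanging integrals turns the centred tail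
  into q f p'; the constant p(t) leaves the boundary term.\<close>

lemma poly_tail:
  assumes s: "s = 1 \<or> s = -1"
  shows "(LINT x|lborel. indicator {x. 0 < s * (x - t)} x *
         (poly ([:\<mu>, - 1:] * p + [:\<gamma>, \<beta>, \<delta>:] * pderiv p) x * f x)) =
      - s * (poly [:\<gamma>, \<beta>, \<delta>:] t * f t * poly p t)"
proof -
  have [measurable]: "poly r \<in> borel_measurable borel" for r :: "real poly"
    by (intro borel_measurable_continuous_onI continuous_intros)
  define u where "u y = (\<mu> - y) * f y" for y
  have [measurable]: "u \<in> borel_measurable borel" unfolding u_def by measurable
  let ?B = "\<lambda>x. {y. 0 < s * (y - t) \<and> 0 < s * (x - y)}" and ?I = "indicator {x. 0 < s * (x - t)} :: real \<Rightarrow> real"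
  \<comment> \<open>The derivative 1 + p'^2 dominates \<open>|p'|\<close>, and R is a polynomial, so
    absolute integrability reduces to finite moments.\<close>
  obtain R where R: "pderiv R = 1 + pderiv p * pderiv p" using ex_poly_antiderivative by metis
  have "(\<integral>\<^sup>+x. ennreal \<bar>u x\<bar> * (\<integral>\<^sup>+y. ennreal (indicator (?B x) y * \<bar>poly (pderiv p) y\<bar>) \<partial>lborel) \<partial>lborel)
    \<le> (\<integral>\<^sup>+x. ennreal (norm (poly ([:\<mu>, -1:] * (R - [:poly R t:])) x * f x)) \<partial>lborel)"
  proof (intro nn_integral_mono)
    fix x
    show "ennreal \<bar>u x\<bar> * (\<integral>\<^sup>+y. ennreal (indicator (?B x) y * \<bar>poly (pderiv p) y\<bar>) \<partial>lborel)
      \<le> ennreal (norm (poly ([:\<mu>, -1:] * (R - [:poly R t:])) x * f x))"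
    proof (cases "0 < s * (x - t)")
      case True
      note b = primitive_on_between[OF primitive_on_poly[of UNIV R] s _ _ True]
      have le: "\<bar>poly (pderiv p) y\<bar> \<le> poly (pderiv R) y" for y
      proof -
        have "0 \<le> (\<bar>poly (pderiv p) y\<bar> - 1)\<^sup>2 + \<bar>poly (pderiv p) y\<bar>\<^sup>2 + 1" by simp
        thus ?thesis unfolding R by (simp add: power2_eq_square algebra_simps)
      qed
      have R0: "0 \<le> poly (pderiv R) y" for y using le[of y] by linarith
      have "(\<integral>\<^sup>+y. ennreal (indicator (?B x) y * \<bar>poly (pderiv p) y\<bar>) \<partial>lborel)
        \<le> (\<integral>\<^sup>+y. ennreal (indicator (?B x) y * poly (pderiv R) y) \<partial>lborel)"
        by (intro nn_integral_mono ennreal_leI mult_left_mono le) auto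
      also have "\<dots> = ennreal (s * (poly R x - poly R t))"
        using b R0 by (subst nn_integral_eq_integral) auto
      also have "\<dots> \<le> ennreal \<bar>poly R x - poly R t\<bar>" using s by (intro ennreal_leI) auto
      finally have "ennreal \<bar>u x\<bar> * (\<integral>\<^sup>+y. ennreal (indicator (?B x) y * \<bar>poly (pderiv p) y\<bar>) \<partial>lborel)
        \<le> ennreal \<bar>u x\<bar> * ennreal \<bar>poly R x - poly R t\<bar>" by (rule mult_left_mono) simp
      also have "\<dots> = ennreal (norm (poly ([:\<mu>, -1:] * (R - [:poly R t:])) x * f x))"
      proof -
        have "poly ([:\<mu>, -1:] * (R - [:poly R t:])) x * f x = u x * (poly R x - poly R t)"
          by (simp add: u_def algebra_simps)
        thus ?thesis by (simp only: real_norm_def abs_mult ennreal_mult abs_ge_zero)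
      qed
      finally show ?thesis .
    next
      case False
      hence "?B x = {}" using s by auto
      thus ?thesis by simp
    qed
  qed
  also have "\<dots> < \<infinity>"
    using poly_f_integrable[of "[:\<mu>, -1:] * (R - [:poly R t:])"] by (simp only: integrable_iff_bounded)
  finally have fin: "(\<integral>\<^sup>+x. ennreal \<bar>u x\<bar> * (\<integral>\<^sup>+y. ennreal (indicator (?B x) y * \<bar>poly (pderiv p) y\<bar>) \<partial>lborel) \<partial>lborel) < \<infinity>" .
  have 1: "u x * (LINT y|lborel. indicator (?B x) y * poly (pderiv p) y) = s * (?I x * (u x * (poly p x - poly p t)))" for x
  proof (cases "0 < s * (x - t)")
    case True
    thus ?thesis using primitive_on_between(2)[OF primitive_on_poly[of UNIV p] s _ _ True] by simp
  next
    case False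
    hence "?B x = {}" using s by auto
    thus ?thesis using False by simp
  qed
  have 2: "?I x * poly (pderiv p) x * (LINT y|lborel. indicator {y. 0 < s * (y - x)} y * u y)
    = - s * (?I x * (poly ([:\<gamma>, \<beta>, \<delta>:] * pderiv p) x * f x))" for x
    unfolding u_def centered_tail[OF s] qpoly_eq poly_mult
    by (simp only: mult_ac mult_minus_left mult_minus_right)
  have F: "s * (LINT x|lborel. ?I x * (u x * (poly p x - poly p t)))
    = - s * (LINT x|lborel. ?I x * (poly ([:\<gamma>, \<beta>, \<delta>:] * pderiv p) x * f x))"
    using fubini_signed(1)[of u "poly (pderiv p)", OF _ _ fin] unfolding 1 2 by simp
  have ii: "integrable lborel (\<lambda>x. ?I x * (poly r x * f x))" for r
  proof -
    have "{x. 0 < s * (x - t)} \<in> sets lborel" by measurable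
    from integrable_real_mult_indicator[OF this poly_f_integrable[of r]] show ?thesis by (simp add: mult_ac)
  qed
  have iu: "integrable lborel (\<lambda>x. ?I x * u x)"
    using ii[of "[:\<mu>, -1:]"] by (simp add: u_def)
  have "(LINT x|lborel. ?I x * (poly ([:\<mu>, - 1:] * p + [:\<gamma>, \<beta>, \<delta>:] * pderiv p) x * f x))
    = (LINT x|lborel. (?I x * (u x * (poly p x - poly p t)) + ?I x * (poly ([:\<gamma>, \<beta>, \<delta>:] * pderiv p) x * f x)) + poly p t * (?I x * u x))"
    by (intro Bochner_Integration.integral_cong) (auto simp: u_def algebra_simps)
  also have "\<dots> = (LINT x|lborel. ?I x * (u x * (poly p x - poly p t)))
     + (LINT x|lborel. ?I x * (poly ([:\<gamma>, \<beta>, \<delta>:] * pderiv p) x * f x)) + poly p t * (LINT x|lborel. ?I x * u x)"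
  proof -
    have "(\<lambda>x. ?I x * (u x * (poly p x - poly p t))) = (\<lambda>x. ?I x * (poly ([:\<mu>, -1:] * (p - [:poly p t:])) x * f x))"
      by (auto simp: u_def algebra_simps)
    hence "integrable lborel (\<lambda>x. ?I x * (u x * (poly p x - poly p t)))" using ii by (simp only:)
    thus ?thesis using ii iu by (simp only: Bochner_Integration.integral_add Bochner_Integration.integrable_add
          integrable_mult_right integral_mult_right_zero)
  qed
  also have "(LINT x|lborel. ?I x * u x) = - s * (poly [:\<gamma>, \<beta>, \<delta>:] t * f t)"
    using centered_tail[OF s, of t] unfolding u_def qpoly_eq .
  also have "(LINT x|lborel. ?I x * (u x * (poly p x - poly p t)))
      + (LINT x|lborel. ?I x * (poly ([:\<gamma>, \<beta>, \<delta>:] * pderiv p) x * f x)) = 0"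
    using F s by auto
  finally show ?thesis by simp
qed

text \<open>A version of f that is positive exactly on the support, as \<open>pearson_weight\<close>
  requires at every point and not only almost everywhere.\<close>

definition weight :: "real \<Rightarrow> real" where
  "weight x = indicator (supp f) x * f x"

lemma AE_weight: "AE x in lborel. weight x = f x"
  using AE_zero_outside_supp by eventually_elim (auto simp: weight_def indicator_def)

lemma supp_measurable [measurable]: "supp f \<in> sets borel"
  by (simp add: supp_eq_einterval)

lemma weight_measurable [measurable]: "weight \<in> borel_measurable borel"
  unfolding weight_def[abs_def] by measurable

lemma pearson_weight: "pearson_weight (supp f) weight 1 \<beta> \<gamma> \<mu> \<delta>"
proof
  show "open (supp f)" by (simp add: supp_eq_einterval)
  show "is_interval (supp f)"
    unfolding is_interval_1 supp_def
    by (auto intro: less_le_trans le_less_trans simp flip: ereal_less_eq(3))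
  show "supp f \<noteq> {}"
  proof
    assume "supp f = {}"
    hence "AE x in lborel. f x = 0" using AE_zero_outside_supp by simp
    hence "(LINT x|lborel. f x) = 0" by (rule integral_eq_zero_AE)
    thus False using f_integral by simp
  qed
  show "weight \<in> borel_measurable borel" by measurable
  fix x :: real
  assume x: "x \<in> supp f"
  have "f x \<noteq> 0" using qpoly_f_pos[OF x] by auto
  hence "0 < f x" using f_nonneg[of x] by simp
  thus "0 < weight x" "0 < poly [:\<gamma>, \<beta>, \<delta>:] x"
    using x qpoly_f_pos[OF x] by (auto simp: weight_def qpoly_eq zero_less_mult_iff)
next
  fix p :: "real poly"
  have [measurable]: "poly r \<in> borel_measurable borel" for r :: "real poly"
    by (intro borel_measurable_continuous_onI continuous_intros)
  show "integrable lborel (\<lambda>x. poly p x * weight x)"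
  proof (rule integrable_cong_AE_imp[OF poly_f_integrable[of p]])
    show "AE x in lborel. poly p x * f x = poly p x * weight x" using AE_weight by eventually_elim simp
  qed measurable
  fix s t :: real assume st: "s = 1 \<or> s = -1" "t \<in> supp f"
  let ?r = "[:\<mu>, - 1:] * p + [:\<gamma>, \<beta>, \<delta>:] * pderiv p"
  have "(LINT x|lborel. indicator {x. 0 < s * (x - t)} x * (poly ?r x * weight x))
    = (LINT x|lborel. indicator {x. 0 < s * (x - t)} x * (poly ?r x * f x))"
  proof (rule integral_cong_AE)
    show "AE x in lborel. indicator {x. 0 < s * (x - t)} x * (poly ?r x * weight x)
      = indicator {x. 0 < s * (x - t)} x * (poly ?r x * f x)"
      using AE_weight by eventually_elim simp
  qed measurable
  also have "\<dots> = - s * (poly [:\<gamma>, \<beta>, \<delta>:] t * weight t * poly p t)"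
    using poly_tail[OF st(1)] st(2) by (simp only: weight_def indicator_simps mult_1_left)
  finally show "(LINT x|lborel. indicator {x. 0 < s * (x - t)} x * (poly ?r x * weight x))
    = - s * (poly [:\<gamma>, \<beta>, \<delta>:] t * weight t * poly p t)" .
qed (use \<delta>_le_0 in \<open>auto simp: weight_def\<close>)

end

subsection \<open>The Fourier form of the sums\<close>

context IP_density
begin

interpretation W: pearson_weight "supp f" weight 1 \<beta> \<gamma> \<mu> \<delta>
  by (rule pearson_weight)

text \<open>As a tail moment, q f increases up to \<mu> and decreases afterwards. This bounds it
  from below on compact intervals without continuity of f.\<close>

lemma qpoly_f_ge_min:
  assumes "x \<le> t" "t \<le> y"
  shows "min (qpoly \<delta> \<beta> \<gamma> x * f x) (qpoly \<delta> \<beta> \<gamma> y * f y) \<le> qpoly \<delta> \<beta> \<gamma> t * f t"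
proof -
  have *: "qpoly \<delta> \<beta> \<gamma> z * f z \<le> qpoly \<delta> \<beta> \<gamma> t * f t"
    if s: "s = 1 \<or> s = -1" and t: "0 \<le> s * (t - \<mu>)" "0 \<le> s * (z - t)" for s z
  proof -
    have z: "0 \<le> s * (z - \<mu>)" using s t by auto
    show ?thesis
      unfolding qpoly_f_eq_abs[OF s t(1)] qpoly_f_eq_abs[OF s z]
      using s t by (intro integral_mono abs_tail_integrable mult_right_mono) (auto simp: f_nonneg indicator_def)
  qed
  show ?thesis
  proof (cases "\<mu> \<le> t")
    case True
    from *[of 1 y] True assms show ?thesis by simp
  next
    case False
    from *[of "-1" x] False assms show ?thesis by simp
  qed
qed

text \<open>On a compact subinterval the weight q^n f has a positive lower bound m, and
  \<open>|k|\<close> is at most 1 + k^2. It makes the last derivative of g locally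
  integrable.\<close>

lemma set_integrable_of_weighted_square:
  assumes xy: "x \<in> supp f" "y \<in> supp f" "x \<le> y"
    and k [measurable]: "k \<in> borel_measurable borel"
    and i: "integrable lborel (\<lambda>t. poly W.q t ^ n * weight t * (k t)\<^sup>2)" and n: "1 \<le> n"
  shows "set_integrable lborel {x..y} k"
proof -
  have sub: "t \<in> supp f" if "t \<in> {x..y}" for t using W.mem_J[OF xy(1,2)] that by simp
  have "\<exists>u\<in>{x..y}. \<forall>t\<in>{x..y}. poly W.q u \<le> poly W.q t"
    using xy(3) by (intro continuous_attains_inf) (auto intro!: continuous_intros)
  then obtain u where u: "u \<in> {x..y}" "\<And>t. t \<in> {x..y} \<Longrightarrow> poly W.q u \<le> poly W.q t" by blast
  \<comment> \<open>One factor q stays with f, since the lower bound is known for q f; hence the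
    exponent n - 1.\<close>
  define m where "m = poly W.q u ^ (n - 1) * min (qpoly \<delta> \<beta> \<gamma> x * f x) (qpoly \<delta> \<beta> \<gamma> y * f y)"
  have qu: "0 < poly W.q u" by (intro W.q_pos sub u)
  have m: "m > 0" unfolding m_def using qpoly_f_pos[OF xy(1)] qpoly_f_pos[OF xy(2)] qu
    by (intro mult_pos_pos zero_less_power) auto
  have le: "m \<le> poly W.q t ^ n * weight t" if t: "t \<in> {x..y}" for t
  proof -
    have "m \<le> poly W.q t ^ (n - 1) * (qpoly \<delta> \<beta> \<gamma> t * f t)"
      unfolding m_def using u(2)[OF t] qu qpoly_f_ge_min[of x t y] t
        qpoly_f_pos[OF xy(1)] qpoly_f_pos[OF xy(2)]
      by (intro mult_mono power_mono) auto
    also have "\<dots> = poly W.q t ^ n * weight t"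
      using sub[OF t] n by (cases n) (auto simp: weight_def qpoly_eq)
    finally show ?thesis .
  qed
  show ?thesis unfolding set_integrable_def
  proof (rule Bochner_Integration.integrable_bound)
    show "integrable lborel (\<lambda>t. indicator {x..y} t + 1 / m * (poly W.q t ^ n * weight t * (k t)\<^sup>2) :: real)"
      using i xy(3) by (intro Bochner_Integration.integrable_add integrable_mult_right integrable_real_indicator) auto
    show "AE t in lborel. norm (indicator {x..y} t *\<^sub>R k t)
      \<le> norm (indicator {x..y} t + 1 / m * (poly W.q t ^ n * weight t * (k t)\<^sup>2))"
    proof (intro AE_I2)
      fix t
      show "norm (indicator {x..y} t *\<^sub>R k t)
        \<le> norm (indicator {x..y} t + 1 / m * (poly W.q t ^ n * weight t * (k t)\<^sup>2))"
      proof (cases "t \<in> {x..y}")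
        case True
        have "0 \<le> (\<bar>k t\<bar> - 1)\<^sup>2 + \<bar>k t\<bar>\<^sup>2 + 1" by simp
        hence "\<bar>k t\<bar> \<le> 1 + (k t)\<^sup>2" by (simp add: power2_eq_square algebra_simps)
        also have "(k t)\<^sup>2 = 1 / m * (m * (k t)\<^sup>2)" using m by simp
        also have "\<dots> \<le> 1 / m * (poly W.q t ^ n * weight t * (k t)\<^sup>2)"
          using le[OF True] m by (intro mult_left_mono mult_right_mono) auto
        finally show ?thesis using True by simp
      qed simp
    qed
  qed measurable
qed

lemma Exp_eq: "Exp f h = (LINT x|lborel. weight x * h x)"
  unfolding Exp_def set_lebesgue_integral_def
  by (intro Bochner_Integration.integral_cong) (auto simp: weight_def)

end

section \<open>The constants as products of eigenvalue differences\<close>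

lemma sl_ev_1_eq: "sl_ev 1 \<delta> (Suc m) = (real m + 1) * (1 - real m * \<delta>)"
  by (simp add: sl_ev_def algebra_simps)

lemma sl_ev_prod_1_eq:
  assumes "k \<le> Suc m"
  shows "sl_ev_prod 1 \<delta> (Suc m) k = (\<Prod>j<k. real (Suc m - j)) * (\<Prod>j\<in>{m..<m + k}. 1 - real j * \<delta>)"
proof -
  have "sl_ev_prod 1 \<delta> (Suc m) k = (\<Prod>j<k. real (Suc m - j) * (1 - real (m + j) * \<delta>))"
    unfolding sl_ev_prod_def sl_ev_diff using assms by (intro prod.cong) (auto simp: of_nat_diff)
  also have "\<dots> = (\<Prod>j<k. real (Suc m - j)) * (\<Prod>j<k. 1 - real (m + j) * \<delta>)"
    by (rule prod.distrib)
  also have "(\<Prod>j<k. 1 - real (m + j) * \<delta>) = (\<Prod>j\<in>{m..<m + k}. 1 - real j * \<delta>)"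
    by (rule prod.reindex_bij_witness[of _ "\<lambda>j. j - m" "\<lambda>j. m + j"]) auto
  finally show ?thesis .
qed

lemma fact_eq_prod_diff: "fact i = (\<Prod>j<i. real (i - j))"
proof -
  have "fact i = (\<Prod>j\<in>{0..<i}. real (i - j))"
    by (simp add: fact_prod_rev)
  thus ?thesis by (simp add: atLeast0LessThan)
qed

lemma fact_prod_eq_sl_ev_prod:
  assumes "1 \<le> i"
  shows "fact i * (\<Prod>j\<in>{i - 1..2 * i - 2}. 1 - real j * \<delta>) = sl_ev_prod 1 \<delta> i i"
proof -
  obtain m where m: "i = Suc m" using assms by (cases i) auto
  have "{i - 1..2 * i - 2} = {m..<m + Suc m}" by (auto simp: m)
  moreover have "fact i = (\<Prod>j<i. real (Suc m - j))" unfolding fact_eq_prod_diff m ..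
  ultimately show ?thesis using sl_ev_prod_1_eq[of "Suc m" m \<delta>] by (simp only: m order_refl)
qed

text \<open>The integer factors run from n + 1 down to 2, which still gives (n + 1)!.\<close>

lemma fact_prod_eq_sl_ev_prod_Suc:
  assumes "1 \<le> n"
  shows "fact (n + 1) * (\<Prod>j\<in>{n..2 * n - 1}. 1 - real j * \<delta>) = sl_ev_prod 1 \<delta> (Suc n) n"
proof -
  have "{n..2 * n - 1} = {n..<n + n}" using assms by auto
  moreover have "fact (n + 1) = (\<Prod>j<n. real (Suc n - j))" by (simp add: fact_eq_prod_diff)
  ultimately show ?thesis using sl_ev_prod_1_eq[of n n \<delta>] by simp
qed

text \<open>Both sides are the falling factorial of m + 1 with i + 1 factors, split off at the first
  and at the last factor.\<close>

lemma binomial_fact_falling: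
  "(real m + 1) * (real (m choose i) * fact i) = (real m + 1 - real i) * falling (real m + 1) i"
proof -
  have "real (m choose i) * fact i = (\<Prod>j<i. real m - real j)"
    using gbinomial_mult_fact'[of "real m" i] by (simp add: binomial_gbinomial atLeast0LessThan)
  hence "(real m + 1) * (real (m choose i) * fact i) = (\<Prod>j<Suc i. real m + 1 - real j)"
    by (subst prod.lessThan_Suc_shift) simp
  thus ?thesis by (simp add: falling_def mult.commute)
qed

text \<open>The coefficient is (l_(m+1) - l_i) / l_(m+1) times the squared Fourier coefficient,
  since l_(m+1) - l_i = (m + 1 - i)(1 - (m + i) \<delta>).\<close>

lemma S1_coefficient:
  assumes "\<delta> \<le> 0" "i \<in> {1..m}"
  shows "real (m choose i) * (1 - real (m + i) * \<delta>) * e /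
      (falling (real m + 1) i * E * (\<Prod>j\<in>{i - 1..2 * i - 2}. 1 - real j * \<delta>) * (1 - real m * \<delta>))
    = e / (E * sl_ev_prod 1 \<delta> i i) - sl_ev 1 \<delta> i * (e / (E * sl_ev_prod 1 \<delta> i i)) / sl_ev 1 \<delta> (Suc m)"
proof -
  define P where "P = (\<Prod>j\<in>{i - 1..2 * i - 2}. 1 - real j * \<delta>)"
  define \<Phi> where "\<Phi> = falling (real m + 1) i"
  have pos: "0 < 1 - real j * \<delta>" for j
  proof -
    have "real j * \<delta> \<le> 0" using assms(1) by (intro mult_nonneg_nonpos) auto
    thus ?thesis by simp
  qed
  have P: "P > 0" unfolding P_def by (intro prod_pos) (use pos in auto)
  have \<Phi>: "\<Phi> > 0" unfolding \<Phi>_def falling_def using assms(2) by (intro prod_pos) auto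
  have PP: "sl_ev_prod 1 \<delta> i i = fact i * P"
    using fact_prod_eq_sl_ev_prod[of i \<delta>] assms(2) by (simp add: P_def)
  have dif: "sl_ev 1 \<delta> (Suc m) - sl_ev 1 \<delta> i = (real m + 1 - real i) * (1 - real (m + i) * \<delta>)"
    unfolding sl_ev_diff by (simp add: algebra_simps)
  have l: "sl_ev 1 \<delta> (Suc m) = (real m + 1) * (1 - real m * \<delta>)" by (rule sl_ev_1_eq)
  have lpos: "sl_ev 1 \<delta> (Suc m) > 0" using sl_ev_pos[of 1 \<delta> "Suc m"] assms(1) by simp
  have b: "real (m choose i) = (real m + 1 - real i) * \<Phi> / ((real m + 1) * fact i)"
  proof -
    have "(real m + 1) * fact i \<noteq> 0" using fact_nonzero[of i, where 'a = real] by auto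
    thus ?thesis using binomial_fact_falling[of m i]
      by (simp only: nonzero_eq_divide_eq \<Phi>_def mult_ac simp_thms)
  qed
  have "real (m choose i) * (1 - real (m + i) * \<delta>) * e / (\<Phi> * E * P * (1 - real m * \<delta>))
    = (real m + 1 - real i) * (1 - real (m + i) * \<delta>) * \<Phi> * e / ((real m + 1) * fact i * (\<Phi> * E * P * (1 - real m * \<delta>)))"
    unfolding b by simp
  also have "\<dots> = (sl_ev 1 \<delta> (Suc m) - sl_ev 1 \<delta> i) * (\<Phi> * e) / (\<Phi> * (E * (fact i * P) * sl_ev 1 \<delta> (Suc m)))"
    unfolding dif unfolding l by (simp only: mult_ac)
  also have "\<dots> = (sl_ev 1 \<delta> (Suc m) - sl_ev 1 \<delta> i) * e / (E * (fact i * P) * sl_ev 1 \<delta> (Suc m))"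
    using \<Phi> by simp
  also have "\<dots> = (sl_ev 1 \<delta> (Suc m) - sl_ev 1 \<delta> i) * (e / (E * sl_ev_prod 1 \<delta> i i)) / sl_ev 1 \<delta> (Suc m)"
    unfolding PP by simp
  also have "\<dots> = e / (E * sl_ev_prod 1 \<delta> i i) - sl_ev 1 \<delta> i * (e / (E * sl_ev_prod 1 \<delta> i i)) / sl_ev 1 \<delta> (Suc m)"
    using lpos by (simp only: left_diff_distrib diff_divide_distrib nonzero_mult_div_cancel_left less_irrefl)
  finally show ?thesis unfolding P_def \<Phi>_def .
qed

lemma S1_eq:
  fixes f :: "real \<Rightarrow> real" and G :: "nat \<Rightarrow> real \<Rightarrow> real" and \<beta> \<gamma> \<delta> :: real
  assumes "\<delta> \<le> 0"
  defines "c \<equiv> \<lambda>i. (Exp f (\<lambda>x. qpoly \<delta> \<beta> \<gamma> x ^ i * G i x))\<^sup>2 / (Exp f (\<lambda>x. qpoly \<delta> \<beta> \<gamma> x ^ i) * sl_ev_prod 1 \<delta> i i)"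
  shows "S1 f \<delta> \<beta> \<gamma> G m = (\<Sum>i=1..m. c i)
    + (Exp f (\<lambda>x. qpoly \<delta> \<beta> \<gamma> x * (G 1 x)\<^sup>2) - (\<Sum>i=1..m. sl_ev 1 \<delta> i * c i)) / sl_ev 1 \<delta> (Suc m)"
proof -
  have "S1 f \<delta> \<beta> \<gamma> G m = (\<Sum>i=1..m. c i - sl_ev 1 \<delta> i * c i / sl_ev 1 \<delta> (Suc m))
      + Exp f (\<lambda>x. qpoly \<delta> \<beta> \<gamma> x * (G 1 x)\<^sup>2) / sl_ev 1 \<delta> (Suc m)"
    unfolding S1_def sl_ev_1_eq[symmetric] c_def
    by (intro arg_cong2[where f = "(+)"] sum.cong S1_coefficient[OF assms(1)]) auto
  thus ?thesis by (simp add: sum_subtractf sum_divide_distrib[symmetric] diff_divide_distrib)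
qed

section \<open>The chain of derivatives of g\<close>

locale IP_density_Hnn = IP_density +
  fixes n :: nat and g :: "real \<Rightarrow> real" and G :: "nat \<Rightarrow> real \<Rightarrow> real"
  assumes n: "1 \<le> n" and H: "in_Hnn f (qpoly \<delta> \<beta> \<gamma>) n g G"
begin

interpretation W: pearson_weight "supp f" weight 1 \<beta> \<gamma> \<mu> \<delta>
  by (rule pearson_weight)

lemma has_deriv: "k < n - 1 \<Longrightarrow> x \<in> supp f \<Longrightarrow> (G k has_real_derivative G (Suc k) x) (at x)"
  and AE_deriv: "AE x in lborel. x \<in> supp f \<longrightarrow> (G (n - 1) has_real_derivative G n x) (at x)"
  and loc_ac: "loc_abs_cont_on (supp f) (G (n - 1))"
  and G_n_measurable: "set_borel_measurable lborel (supp f) (G n)"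
  and G_n_integrable: "set_integrable lborel (supp f) (\<lambda>x. qpoly \<delta> \<beta> \<gamma> x ^ n * (G n x)\<^sup>2 * f x)"
  and G_0: "x \<in> supp f \<Longrightarrow> G 0 x = g x"
  using H unfolding in_Hnn_def by auto

lemma G_continuous: "k < n \<Longrightarrow> continuous_on (supp f) (G k)"
proof (cases "k = n - 1")
  case True
  thus ?thesis using H unfolding in_Hnn_def by auto
next
  case False
  assume "k < n"
  with False have "k < n - 1" by simp
  thus ?thesis using has_deriv DERIV_isCont by (intro continuous_at_imp_continuous_on) blast
qed

text \<open>Extension by zero: \<open>primitive_on\<close> asks for measurability on the whole line,
  whereas the derivatives of g are given on the support only.\<close>

definition G0 :: "nat \<Rightarrow> real \<Rightarrow> real" where
  "G0 k x = indicator (supp f) x * G k x"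

lemma G0_measurable: "k \<le> n \<Longrightarrow> G0 k \<in> borel_measurable borel"
proof (cases "k = n")
  case True
  thus ?thesis using G_n_measurable by (simp add: set_borel_measurable_def G0_def[abs_def])
next
  case False
  assume "k \<le> n"
  with False have "continuous_on (supp f) (G k)" by (intro G_continuous) simp
  from borel_measurable_continuous_on_indicator[OF supp_measurable this]
  show ?thesis by (simp add: G0_def[abs_def])
qed

lemma weighted_square_integrable:
  "integrable lborel (\<lambda>x. poly W.q x ^ n * weight x * (G0 n x)\<^sup>2)"
proof -
  have "poly W.q x ^ n * weight x * (G0 n x)\<^sup>2 = indicator (supp f) x *\<^sub>R (qpoly \<delta> \<beta> \<gamma> x ^ n * (G n x)\<^sup>2 * f x)" for x
    by (auto simp: weight_def G0_def qpoly_eq indicator_def)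
  thus ?thesis using G_n_integrable unfolding set_integrable_def by (simp only:)
qed

lemma primitive_on_G0:
  assumes k: "k < n"
  shows "primitive_on (supp f) (G0 k) (G0 (Suc k))"
proof -
  have "set_integrable lborel {x..y} (G0 (Suc k)) \<and> (LINT t:{x..y}|lborel. G0 (Suc k) t) = G0 k y - G0 k x"
    if xy: "x \<in> supp f" "y \<in> supp f" "x \<le> y" for x y
  proof -
    have sub: "{x..y} \<subseteq> supp f" using W.mem_J[OF xy(1,2)] by auto
    have eq: "indicator {x..y} t *\<^sub>R G0 (Suc k) t = indicator {x..y} t *\<^sub>R G (Suc k) t" for t
      using sub by (auto simp: G0_def indicator_def)
    show ?thesis
    proof (cases "k = n - 1")
      case False
      hence k1: "k < n - 1" using k by simp
      have c: "continuous_on {x..y} (G (Suc k))"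
        by (rule continuous_on_subset[OF G_continuous sub]) (use k1 in auto)
      have "set_integrable lborel {x..y} (G (Suc k))" by (rule borel_integrable_atLeastAtMost'[OF c])
      moreover have "(LINT t:{x..y}|lborel. G (Suc k) t) = G k y - G k x"
        unfolding set_lebesgue_integral_def
      proof (rule integral_FTC_atLeastAtMost[OF xy(3) _ c])
        fix t assume "x \<le> t" "t \<le> y"
        hence "t \<in> supp f" using sub by auto
        from has_deriv[OF k1 this]
        show "(G k has_vector_derivative G (Suc k) t) (at t within {x..y})"
          by (simp add: has_real_derivative_iff_has_vector_derivative has_vector_derivative_at_within)
      qed
      ultimately show ?thesis
        unfolding set_integrable_def set_lebesgue_integral_def eq using xy by (simp add: G0_def)
    next
      case True
      hence [simp]: "Suc k = n" using n by simp
      \<comment> \<open>The gauge argument yields only a gauge integral of the last derivative;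
        Lebesgue integrability, from the weighted square, identifies the two integrals.\<close>
      have i: "set_integrable lborel {x..y} (G0 n)"
        by (rule set_integrable_of_weighted_square[OF xy G0_measurable weighted_square_integrable n]) simp
      have "(G n has_integral (G k y - G k x)) {x..y}"
      proof (rule abs_cont_has_integral_deriv[OF xy(3)])
        show "abs_cont_on_interval (G k) x y"
          using loc_ac xy True unfolding loc_abs_cont_on_def by auto
        show "AE t in lborel. t \<in> {x..y} \<longrightarrow> (G k has_real_derivative G n t) (at t)"
          using AE_deriv by eventually_elim (use sub True in auto)
      qed
      hence "(G0 n has_integral (G k y - G k x)) {x..y}"
        by (rule has_integral_eq[rotated]) (use sub in \<open>auto simp: G0_def\<close>)
      with set_borel_integral_eq_integral(2)[OF i] have "(LINT t:{x..y}|lborel. G0 n t) = G k y - G k x"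
        by (simp add: integral_unique)
      thus ?thesis using i xy by (simp add: G0_def)
    qed
  qed
  thus ?thesis unfolding primitive_on_def using G0_measurable[of k] G0_measurable[of "Suc k"] k by simp
qed

text \<open>The chain starts at g' with the weight q f, because the sums begin at i = 1 and
  \<open>S1\<close> contains E[q g'^2].\<close>

lemma deriv_chain_G0: "deriv_chain (supp f) (poly W.q) W.qw (n - 1) (\<lambda>j. G0 (Suc j))"
  unfolding deriv_chain_def
proof (intro conjI allI impI)
  fix j assume "j < n - 1"
  thus "primitive_on (supp f) (G0 (Suc j)) (G0 (Suc (Suc j)))" by (intro primitive_on_G0) simp
next
  have "poly W.q x ^ (n - 1) * (poly W.q x * weight x) = poly W.q x ^ n * weight x" for x
    using n by (cases n) auto
  moreover have "Suc (n - 1) = n" using n by simp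
  ultimately show "wL2 (\<lambda>x. poly W.q x ^ (n - 1) * (poly W.q x * weight x)) (G0 (Suc (n - 1)))"
    using weighted_square_integrable G0_measurable[of n] by (simp only: wL2_def order_refl simp_thms)
qed

lemma G_eq_poly:
  assumes p: "\<And>x. x \<in> supp f \<Longrightarrow> g x = poly p x" and k: "k < n" "x \<in> supp f"
  shows "G k x = poly ((pderiv ^^ k) p) x"
  using k
proof (induction k arbitrary: x)
  case 0
  thus ?case using p G_0 by simp
next
  case (Suc k)
  have "(G k has_real_derivative G (Suc k) x) (at x)" using Suc.prems by (intro has_deriv) auto
  hence "(poly ((pderiv ^^ k) p) has_real_derivative G (Suc k) x) (at x)"
    by (rule has_field_derivative_transform_within_open[OF _ W.open_J Suc.prems(2)]) (use Suc in auto)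
  from DERIV_unique[OF this poly_DERIV] show ?case by simp
qed

text \<open>Below order n the derivatives of g agree with those of p everywhere on the support; at
  order n only where G (n - 1) is differentiable with derivative G n.\<close>

lemma poly_chain_AE_G0:
  assumes p: "\<And>x. x \<in> supp f \<Longrightarrow> g x = poly p x" and deg: "degree p \<le> Suc m"
  shows "poly_chain_AE (supp f) (n - 1) (\<lambda>j. G0 (Suc j)) m"
  unfolding poly_chain_AE_def
proof (intro exI[of _ "pderiv p"] conjI allI impI)
  show "degree (pderiv p) \<le> m" using deg by (simp add: degree_pderiv)
  fix j assume j: "j \<le> n - 1"
  have swap: "(pderiv ^^ j) (pderiv p) = (pderiv ^^ Suc j) p" by (simp add: funpow_swap1)
  show "AE x in lborel. x \<in> supp f \<longrightarrow> G0 (Suc j) x = poly ((pderiv ^^ j) (pderiv p)) x"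
  proof (cases "Suc j < n")
    case True
    thus ?thesis unfolding swap using G_eq_poly[OF p True] by (simp add: G0_def)
  next
    case False
    hence jn: "Suc j = n" "n - 1 = j" using j n by auto
    show ?thesis using AE_deriv
    proof eventually_elim
      case (elim x)
      show ?case
      proof
        assume x: "x \<in> supp f"
        hence "(G j has_real_derivative G n x) (at x)" using elim jn by simp
        hence "(poly ((pderiv ^^ j) p) has_real_derivative G n x) (at x)"
          by (rule has_field_derivative_transform_within_open[OF _ W.open_J x])
            (rule G_eq_poly[OF p], use jn in auto)
        from DERIV_unique[OF this poly_DERIV] show "G0 (Suc j) x = poly ((pderiv ^^ j) (pderiv p)) x"
          using x by (simp add: swap G0_def jn(1)[symmetric])
      qed
    qed
  qed
qed

definition fourier :: "nat \<Rightarrow> real" where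
  "fourier i = (Exp f (\<lambda>x. qpoly \<delta> \<beta> \<gamma> x ^ i * G i x))\<^sup>2 / (Exp f (\<lambda>x. qpoly \<delta> \<beta> \<gamma> x ^ i) * sl_ev_prod 1 \<delta> i i)"

lemma Exp_qG: "Exp f (\<lambda>x. qpoly \<delta> \<beta> \<gamma> x ^ Suc i * G (Suc i) x) = (LINT x|lborel. poly W.q x ^ i * W.qw x * G0 (Suc i) x)"
proof -
  have "weight x * (qpoly \<delta> \<beta> \<gamma> x ^ Suc i * G (Suc i) x) = poly W.q x ^ i * W.qw x * G0 (Suc i) x" for x
    by (cases "x \<in> supp f") (simp_all add: weight_def G0_def qpoly_eq)
  thus ?thesis unfolding Exp_eq by (simp only:)
qed

lemma Exp_q: "Exp f (\<lambda>x. qpoly \<delta> \<beta> \<gamma> x ^ Suc i) = (LINT x|lborel. poly W.q x ^ i * W.qw x)"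
  unfolding Exp_eq qpoly_eq power_Suc by (simp only: mult_ac)

lemma Exp_qG_sq: "Exp f (\<lambda>x. qpoly \<delta> \<beta> \<gamma> x ^ Suc i * (G (Suc i) x)\<^sup>2) =
    wip (\<lambda>x. poly W.q x ^ i * W.qw x) (G0 (Suc i)) (G0 (Suc i))"
proof -
  have "weight x * (qpoly \<delta> \<beta> \<gamma> x ^ Suc i * (G (Suc i) x)\<^sup>2) = poly W.q x ^ i * W.qw x * (G0 (Suc i) x)\<^sup>2" for x
    by (cases "x \<in> supp f") (simp_all add: weight_def G0_def qpoly_eq)
  thus ?thesis unfolding Exp_eq wip_self by (simp only:)
qed

lemma fourier_Suc:
  "sl_ev 1 \<delta> (Suc i) * fourier (Suc i) = fourier_sq (1 - 2 * \<delta>) \<delta> (poly W.q) W.qw (\<lambda>j. G0 (Suc j)) i"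
proof -
  have "sl_ev 1 \<delta> (Suc i) > 0" using sl_ev_pos[of 1 \<delta> "Suc i"] \<delta>_le_0 by simp
  thus ?thesis
    unfolding fourier_def Exp_qG Exp_q sl_ev_prod_Suc fourier_sq_def by simp
qed

text \<open>Both sides contain the same sum of squared Fourier coefficients. The remainders,
  multiplied by l_(m+1), are the two sides of \<open>deriv_chain_inequality\<close> for g' with n -
  1 derivatives, which makes n = 1 an unconditional equality.\<close>

lemma S1_inequality:
  assumes r: "r \<le> 1"
  defines "m \<equiv> n - 1 + r"
  defines "rhs \<equiv> (\<Sum>i=1..m. fourier i) + (Exp f (\<lambda>x. qpoly \<delta> \<beta> \<gamma> x ^ n * (G n x)\<^sup>2)
      - (if r = 0 then 0 else (Exp f (\<lambda>x. qpoly \<delta> \<beta> \<gamma> x ^ n * G n x))\<^sup>2 / Exp f (\<lambda>x. qpoly \<delta> \<beta> \<gamma> x ^ n)))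
      / sl_ev_prod 1 \<delta> (Suc m) n"
  shows "S1 f \<delta> \<beta> \<gamma> G m \<le> rhs"
    and "n = 1 \<or> (\<exists>p :: real poly. degree p \<le> Suc m \<and> (\<forall>x\<in>supp f. g x = poly p x)) \<Longrightarrow> S1 f \<delta> \<beta> \<gamma> G m = rhs"
proof -
  obtain k where k: "n = Suc k" using n by (cases n) auto
  define l where "l = sl_ev 1 \<delta> (Suc m)"
  have l: "l > 0" unfolding l_def using sl_ev_pos[of 1 \<delta> "Suc m"] \<delta>_le_0 by simp
  define A where "A = Exp f (\<lambda>x. qpoly \<delta> \<beta> \<gamma> x * (G 1 x)\<^sup>2) - (\<Sum>i=1..m. sl_ev 1 \<delta> i * fourier i)"
  define B where "B = Exp f (\<lambda>x. qpoly \<delta> \<beta> \<gamma> x ^ n * (G n x)\<^sup>2)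
      - (if r = 0 then 0 else (Exp f (\<lambda>x. qpoly \<delta> \<beta> \<gamma> x ^ n * G n x))\<^sup>2 / Exp f (\<lambda>x. qpoly \<delta> \<beta> \<gamma> x ^ n))"
  have S1: "S1 f \<delta> \<beta> \<gamma> G m = (\<Sum>i=1..m. fourier i) + A / l"
    unfolding A_def l_def fourier_def by (rule S1_eq[OF \<delta>_le_0])
  have rhs: "rhs = (\<Sum>i=1..m. fourier i) + B / sl_ev_prod (1 - 2 * \<delta>) \<delta> m k / l"
    unfolding rhs_def B_def[symmetric] unfolding k sl_ev_prod_Suc l_def by simp
  have sum: "(\<Sum>i=1..m. sl_ev 1 \<delta> i * fourier i) = (\<Sum>i<m. fourier_sq (1 - 2 * \<delta>) \<delta> (poly W.q) W.qw (\<lambda>j. G0 (Suc j)) i)"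
    unfolding fourier_Suc[symmetric]
    by (rule sum.reindex_bij_witness[of _ Suc "\<lambda>i. i - 1"]) auto
  have A1: "Exp f (\<lambda>x. qpoly \<delta> \<beta> \<gamma> x * (G 1 x)\<^sup>2) = wip W.qw (G0 (Suc 0)) (G0 (Suc 0))"
    using Exp_qG_sq[of 0] by (simp only: power_Suc0_right power_0 mult_1_left One_nat_def)
  note C = deriv_chain_inequality[OF W.pearson_weight_shift deriv_chain_G0 r]
  have mk: "n - 1 = k" "k + r = m" using k by (simp_all add: m_def)
  have "A \<le> B / sl_ev_prod (1 - 2 * \<delta>) \<delta> m k"
    using C(1) unfolding A_def B_def sum A1 k Exp_qG Exp_q Exp_qG_sq mk[unfolded k] .
  thus "S1 f \<delta> \<beta> \<gamma> G m \<le> rhs" unfolding S1 rhs using l by (intro add_left_mono divide_right_mono) auto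
  assume eq: "n = 1 \<or> (\<exists>p :: real poly. degree p \<le> Suc m \<and> (\<forall>x\<in>supp f. g x = poly p x))"
  have "k = 0 \<or> poly_chain_AE (supp f) k (\<lambda>j. G0 (Suc j)) m"
    using eq poly_chain_AE_G0[of _ m] unfolding mk using k by auto
  hence "A = B / sl_ev_prod (1 - 2 * \<delta>) \<delta> m k"
    using C(2) unfolding A_def B_def sum A1 k Exp_qG Exp_q Exp_qG_sq mk[unfolded k] by blast
  thus "S1 f \<delta> \<beta> \<gamma> G m = rhs" unfolding S1 rhs by simp
qed

lemma sum_fourier_eq:
  "(\<Sum>i=1..m. (Exp f (\<lambda>x. qpoly \<delta> \<beta> \<gamma> x ^ i * G i x))\<^sup>2 / (fact i * Exp f (\<lambda>x. qpoly \<delta> \<beta> \<gamma> x ^ i)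
      * (\<Prod>j\<in>{i - 1..2 * i - 2}. 1 - real j * \<delta>))) = (\<Sum>i=1..m. fourier i)"
  unfolding fourier_def
  by (intro sum.cong refl, subst fact_prod_eq_sl_ev_prod[symmetric]) (auto simp: mult_ac)

lemma Sstr_eq:
  "Sstr f \<delta> \<beta> \<gamma> G n = (\<Sum>i=1..n. fourier i) + (Exp f (\<lambda>x. qpoly \<delta> \<beta> \<gamma> x ^ n * (G n x)\<^sup>2)
      - (Exp f (\<lambda>x. qpoly \<delta> \<beta> \<gamma> x ^ n * G n x))\<^sup>2 / Exp f (\<lambda>x. qpoly \<delta> \<beta> \<gamma> x ^ n)) / sl_ev_prod 1 \<delta> (Suc n) n"
  unfolding Sstr_def sum_fourier_eq fact_prod_eq_sl_ev_prod_Suc[OF n] ..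

lemma Sweak_eq:
  "Sweak f \<delta> \<beta> \<gamma> G n = (\<Sum>i=1..n - 1. fourier i)
      + Exp f (\<lambda>x. qpoly \<delta> \<beta> \<gamma> x ^ n * (G n x)\<^sup>2) / sl_ev_prod 1 \<delta> n n"
  unfolding Sweak_def sum_fourier_eq fact_prod_eq_sl_ev_prod[OF n] ..

end

theorem theorem3p2:
  fixes f g :: "real \<Rightarrow> real" and G :: "nat \<Rightarrow> real \<Rightarrow> real"
    and \<mu> \<delta> \<beta> \<gamma> :: real and n :: nat
  assumes IP: "IP f \<mu> \<delta> \<beta> \<gamma>"
    and delta: "\<delta> \<le> 0"
    and n: "n \<ge> 1"
    and moment: "integrable lborel (\<lambda>x. \<bar>x\<bar> ^ (2 * n) * f x)"
    and H: "in_Hnn f (qpoly \<delta> \<beta> \<gamma>) n g G"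
  shows "(S1 f \<delta> \<beta> \<gamma> G n \<le> Sstr f \<delta> \<beta> \<gamma> G n
         \<and> ((n = 1 \<or> (n > 1 \<and> (\<exists>p :: real poly. degree p \<le> n + 1 \<and> (\<forall>x\<in>supp f. g x = poly p x))))
            \<longrightarrow> S1 f \<delta> \<beta> \<gamma> G n = Sstr f \<delta> \<beta> \<gamma> G n))
         \<and> (S1 f \<delta> \<beta> \<gamma> G (n - 1) \<le> Sweak f \<delta> \<beta> \<gamma> G n
         \<and> ((n = 1 \<or> (n > 1 \<and> (\<exists>p :: real poly. degree p \<le> n \<and> (\<forall>x\<in>supp f. g x = poly p x))))
            \<longrightarrow> S1 f \<delta> \<beta> \<gamma> G (n - 1) = Sweak f \<delta> \<beta> \<gamma> G n))"
proof -
  interpret IP_density_Hnn f \<mu> \<delta> \<beta> \<gamma> n g G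
    by unfold_locales (rule IP delta n H)+
  have "n - 1 + 1 = n" "n - 1 + 0 = n - 1" "Suc (n - 1) = n" using n by auto
  note str = S1_inequality[of 1, unfolded this] and weak = S1_inequality[of 0, unfolded this]
  have "S1 f \<delta> \<beta> \<gamma> G n \<le> Sstr f \<delta> \<beta> \<gamma> G n"
    using str(1) unfolding Sstr_eq by simp
  moreover have "S1 f \<delta> \<beta> \<gamma> G n = Sstr f \<delta> \<beta> \<gamma> G n"
    if "n = 1 \<or> (\<exists>p :: real poly. degree p \<le> n + 1 \<and> (\<forall>x\<in>supp f. g x = poly p x))"
    using str(2)[OF _ that[folded Suc_eq_plus1]] unfolding Sstr_eq by simp
  moreover have "S1 f \<delta> \<beta> \<gamma> G (n - 1) \<le> Sweak f \<delta> \<beta> \<gamma> G n"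
    using weak(1) unfolding Sweak_eq by simp
  moreover have "S1 f \<delta> \<beta> \<gamma> G (n - 1) = Sweak f \<delta> \<beta> \<gamma> G n"
    if "n = 1 \<or> (\<exists>p :: real poly. degree p \<le> n \<and> (\<forall>x\<in>supp f. g x = poly p x))"
    using weak(2)[OF _ that] unfolding Sweak_eq by simp
  ultimately show ?thesis by blast
qed

end
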